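(* There is a constant $\gamma>0$, independent of the mesh-size $h$, such that $$\inf_{u_h\in V_h^{c}\setminus\{0\}}\ \sup_{v_h\in V_h^{c}\setminus\{0\}}\ \frac{A_h^{c}(u_h,v_h)}{|||u_h|||_{LPSD}\,|||v_h|||_{LPSD}}\ \ge\ \gamma>0 .$$
   Context: Setting. $\Omega\subset\mathbb{R}^2$ is a bounded polygonal domain, $\mathbf{b}\in[W^1_\infty(\Omega)]^2$, $\mu\in L_\infty(\Omega)$, and there is $\alpha>0$ with $\mu-\tfrac12\operatorname{div}\mathbf{b}\ge\alpha$ a.e. in $\Omega$. $\mathbf{n}$ is the unit outward normal on $\partial\Omega$. For a real number (or function) $w$, $w^{\ominus}:=\tfrac12(|w|-w)$. $(\cdot,\cdot)$ and $\|\cdot\|$ are the $L_2(\Omega)$ inner product and norm. Meshes. $\mathcal{T}_h$ is a member of a family of shape-regular, (locally) quasi-uniform triangulations of $\Omega$; $h_K=\operatorname{diam}(K)$, $h=\max_K h_K$; $h_{\mathcal T}$ is the piecewise constant function with $h_{\mathcal T}|_K=h_K$. $\mathcal{E}_h^B$ is the set of boundary edges and $\mathcal{V}_h$ the set of all vertices (interior and boundary). For $a\in\mathcal{V}_h$, $\mathcal{M}_a$ is the union of all triangles sharing the vertex $a$, $|\mathcal{M}_a|$ its measure, and $h_a$ is the average of $h_K$ over the triangles $K\subset\mathcal{M}_a$; local quasi-uniformity means there is $\zeta\ge1$ independent of $h$ with $\zeta^{-1}\le h_a/h_K\le\zeta$ for all $K\subset\mathcal{M}_a$. Space. $V_h^{c}=\{v\in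 H^1(\Omega): v|_K\in\mathbb{P}_1(K)\ \forall K\in\mathcal{T}_h\}$ (no boundary condition imposed). Stabilization. $\kappa_a(u):=\mathbf{b}\cdot\nabla u-\frac{1}{|\mathcal{M}_a|}\int_{\mathcal{M}_a}\mathbf{b}\cdot\nabla u\,dx$ on $\mathcal{M}_a$, and $S_h^{c}(u,v):=\sum_{a\in\mathcal{V}_h}\beta_a(\kappa_a(u),\kappa_a(v))_{L_2(\mathcal{M}_a)}$ with $\beta_a=\beta h_a$, where $\beta>0$ is a stabilization constant independent of $h$, required to satisfy $\beta|_{\mathcal{M}_a}\sim 1/\|\mathbf{b}\|_{W^1_\infty(\mathcal{M}_a)}$ (two-sided bounds with mesh-independent constants). Bilinear form. $A_h^{c}(u,v):=(\mathbf{b}\cdot\nabla u,v)+(\mu u,v)+\int_{\partial\Omega}(\mathbf{b}\cdot\mathbf{n})^{\ominus}uv\,ds+S_h^{c}(u,v)$. Norm. $|||v|||_{LPSD}^2:=\|h_{\mathcal T}^{1/2}(\mathbf{b}\cdot\nabla v)\|^2+\alpha\|v\|^2+\sum_{E\in\mathcal{E}_h^B}\int_E\frac{|\mathbf{b}\cdot\mathbf{n}|}{2}v^2\,ds+S_h^{c}(v,v)$. Independence of $h$ means that the constant is the same for all meshes of the family; it may depend on the shape-regularity and quasi-uniformity constants and on the data $\Omega,\mathbf{b},\mu,\alpha,\beta$. *)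

theory Defs
  imports "HOL-Analysis.Analysis" "HOL-Probability.Essential_Supremum"
begin

section \<open>Lebesgue and Sobolev spaces\<close>

definition L2 :: "(real^'n) set \<Rightarrow> (real^'n \<Rightarrow> real) \<Rightarrow> bool" where
  "L2 \<Omega> f \<longleftrightarrow> f \<in> borel_measurable (lebesgue_on \<Omega>) \<and> integrable (lebesgue_on \<Omega>) (\<lambda>x. (f x)\<^sup>2)"

definition L2_inner :: "(real^'n) set \<Rightarrow> (real^'n \<Rightarrow> real) \<Rightarrow> (real^'n \<Rightarrow> real) \<Rightarrow> real" where
  "L2_inner S f g = (LINT x|lebesgue_on S. f x * g x)"

definition L2_norm :: "(real^'n) set \<Rightarrow> (real^'n \<Rightarrow> real) \<Rightarrow> real" where
  "L2_norm S f = sqrt (L2_inner S f f)"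

definition Linf :: "(real^'n) set \<Rightarrow> (real^'n \<Rightarrow> real) \<Rightarrow> bool" where
  "Linf \<Omega> f \<longleftrightarrow> f \<in> borel_measurable (lebesgue_on \<Omega>)
     \<and> (\<exists>C. AE x in lebesgue_on \<Omega>. \<bar>f x\<bar> \<le> C)"

definition Linf_norm :: "(real^'n) set \<Rightarrow> (real^'n \<Rightarrow> real) \<Rightarrow> real" where
  "Linf_norm S f = real_of_ereal (esssup (lebesgue_on S) (\<lambda>x. ereal \<bar>f x\<bar>))"

primrec Ck :: "nat \<Rightarrow> (real^'n \<Rightarrow> real) \<Rightarrow> bool" where
  "Ck 0 f \<longleftrightarrow> continuous_on UNIV f"
| "Ck (Suc k) f \<longleftrightarrow> (\<exists>f'. (\<forall>x. (f has_derivative (\<lambda>h. \<Sum>i\<in>UNIV. h $ i * f' i x)) (at x))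
                        \<and> (\<forall>i. Ck k (f' i)))"

definition test_fun :: "(real^'n) set \<Rightarrow> (real^'n \<Rightarrow> real) \<Rightarrow> bool" where
  "test_fun \<Omega> \<phi> \<longleftrightarrow> (\<forall>k. Ck k \<phi>) \<and> compact (closure {x. \<phi> x \<noteq> 0}) \<and> closure {x. \<phi> x \<noteq> 0} \<subseteq> \<Omega>"

definition partial :: "'n \<Rightarrow> (real^'n \<Rightarrow> real) \<Rightarrow> real^'n \<Rightarrow> real" where
  "partial i \<phi> x = frechet_derivative \<phi> (at x) (axis i 1)"

definition loc_integrable :: "(real^'n) set \<Rightarrow> (real^'n \<Rightarrow> real) \<Rightarrow> bool" where
  "loc_integrable \<Omega> f \<longleftrightarrow> (\<forall>C. compact C \<and> C \<subseteq> \<Omega> \<longrightarrow> integrable (lebesgue_on C) f)"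

definition is_weak_deriv ::
  "(real^'n) set \<Rightarrow> 'n \<Rightarrow> (real^'n \<Rightarrow> real) \<Rightarrow> (real^'n \<Rightarrow> real) \<Rightarrow> bool" where
  "is_weak_deriv \<Omega> i f g \<longleftrightarrow> loc_integrable \<Omega> f \<and> loc_integrable \<Omega> g \<and>
     (\<forall>\<phi>. test_fun \<Omega> \<phi> \<longrightarrow> L2_inner \<Omega> f (partial i \<phi>) = - L2_inner \<Omega> g \<phi>)"

text \<open>Determined up to a null set of the open set \<open>\<Omega>\<close>; every use below is insensitive to
  modifications on null sets.\<close>

definition weak_deriv :: "(real^'n) set \<Rightarrow> 'n \<Rightarrow> (real^'n \<Rightarrow> real) \<Rightarrow> real^'n \<Rightarrow> real" where
  "weak_deriv \<Omega> i f = (SOME g. is_weak_deriv \<Omega> i f g)"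

definition weak_grad :: "(real^'n) set \<Rightarrow> (real^'n \<Rightarrow> real) \<Rightarrow> real^'n \<Rightarrow> real^'n" where
  "weak_grad \<Omega> f x = (\<chi> i. weak_deriv \<Omega> i f x)"

definition weak_div :: "(real^'n) set \<Rightarrow> (real^'n \<Rightarrow> real^'n) \<Rightarrow> real^'n \<Rightarrow> real" where
  "weak_div \<Omega> b x = (\<Sum>i\<in>UNIV. weak_deriv \<Omega> i (\<lambda>y. b y $ i) x)"

definition H1 :: "(real^'n) set \<Rightarrow> (real^'n \<Rightarrow> real) \<Rightarrow> bool" where
  "H1 \<Omega> f \<longleftrightarrow> L2 \<Omega> f \<and> (\<forall>i. \<exists>g. L2 \<Omega> g \<and> is_weak_deriv \<Omega> i f g)"

definition W1inf :: "(real^'n) set \<Rightarrow> (real^'n \<Rightarrow> real) \<Rightarrow> bool" where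
  "W1inf \<Omega> f \<longleftrightarrow> Linf \<Omega> f \<and> (\<forall>i. \<exists>g. Linf \<Omega> g \<and> is_weak_deriv \<Omega> i f g)"

text \<open>Norm of a vector field, for an open set \<open>D\<close>: the maximum over all components and all
  derivatives of order at most one.\<close>

definition W1inf_norm :: "(real^'n) set \<Rightarrow> (real^'n \<Rightarrow> real^'n) \<Rightarrow> real" where
  "W1inf_norm D b = Max (range (\<lambda>i. Linf_norm D (\<lambda>x. b x $ i))
     \<union> range (\<lambda>(i, j). Linf_norm D (weak_deriv D j (\<lambda>x. b x $ i))))"


section \<open>Polygonal domains and meshes\<close>

definition closed_polygon :: "(real^2) set \<Rightarrow> bool" where
  "closed_polygon J \<longleftrightarrow> (\<exists>p. simple_path p \<and> pathfinish p = pathstart p \<and> path_image p = J)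
     \<and> (\<exists>\<S>. finite \<S> \<and> (\<forall>s\<in>\<S>. \<exists>x y. s = closed_segment x y) \<and> J = \<Union>\<S>)"

text \<open>Holes are allowed.  As the boundary curves are simple and disjoint, the connected set
  \<open>\<Omega>\<close> lies locally on one side of its boundary: slits and pinch points are excluded.\<close>

definition polygonal_domain :: "(real^2) set \<Rightarrow> bool" where
  "polygonal_domain \<Omega> \<longleftrightarrow> open \<Omega> \<and> connected \<Omega> \<and> bounded \<Omega> \<and> \<Omega> \<noteq> {} \<and>
     (\<exists>\<J>. finite \<J> \<and> pairwise disjnt \<J> \<and> (\<forall>J\<in>\<J>. closed_polygon J) \<and> frontier \<Omega> = \<Union>\<J>)"

text \<open>Well defined at every boundary point that is not a corner.\<close>

definition outward_normal :: "(real^2) set \<Rightarrow> real^2 \<Rightarrow> real^2" where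
  "outward_normal \<Omega> x =
     (THE n. norm n = 1 \<and> (\<exists>r>0. \<Omega> \<inter> ball x r = {y \<in> ball x r. (y - x) \<bullet> n < 0}))"

text \<open>Meshes consist of closed triangles.\<close>

definition mesh_of :: "(real^2) set \<Rightarrow> (real^2) set set \<Rightarrow> bool" where
  "mesh_of \<Omega> \<T> \<longleftrightarrow> triangulation \<T> \<and> (\<forall>K\<in>\<T>. 2 simplex K) \<and> \<Union>\<T> = closure \<Omega>"

definition vertices :: "(real^2) set set \<Rightarrow> (real^2) set" where
  "vertices \<T> = {a. \<exists>K\<in>\<T>. a extreme_point_of K}"

definition boundary_edges :: "(real^2) set \<Rightarrow> (real^2) set set \<Rightarrow> (real^2) set set" where
  "boundary_edges \<Omega> \<T> = {E. (\<exists>K\<in>\<T>. E edge_of K) \<and> E \<subseteq> frontier \<Omega>}"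

definition star :: "(real^2) set set \<Rightarrow> real^2 \<Rightarrow> (real^2) set set" where
  "star \<T> a = {K\<in>\<T>. a extreme_point_of K}"

definition patch :: "(real^2) set set \<Rightarrow> real^2 \<Rightarrow> (real^2) set" where
  "patch \<T> a = \<Union>(star \<T> a)"

definition h_vertex :: "(real^2) set set \<Rightarrow> real^2 \<Rightarrow> real" where
  "h_vertex \<T> a = (\<Sum>K\<in>star \<T> a. diameter K) / real (card (star \<T> a))"

text \<open>The piecewise constant mesh-size function (set to zero on the null set formed by the edges).\<close>

definition h_fun :: "(real^2) set set \<Rightarrow> real^2 \<Rightarrow> real" where
  "h_fun \<T> x = (\<Sum>K\<in>\<T>. diameter K * indicator (interior K) x)"

definition ball_diameter :: "(real^2) set \<Rightarrow> real" where
  "ball_diameter K = Sup {2 * r |r c. 0 \<le> r \<and> cball c r \<subseteq> K}"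

definition shape_regular :: "(real^2) set set set \<Rightarrow> bool" where
  "shape_regular \<F> \<longleftrightarrow> (\<exists>\<sigma>. \<forall>\<T>\<in>\<F>. \<forall>K\<in>\<T>. diameter K \<le> \<sigma> * ball_diameter K)"

definition locally_quasi_uniform :: "(real^2) set set set \<Rightarrow> bool" where
  "locally_quasi_uniform \<F> \<longleftrightarrow> (\<exists>\<zeta>\<ge>1. \<forall>\<T>\<in>\<F>. \<forall>a\<in>vertices \<T>. \<forall>K\<in>star \<T> a.
     1 / \<zeta> \<le> h_vertex \<T> a / diameter K \<and> h_vertex \<T> a / diameter K \<le> \<zeta>)"

text \<open>Integral with respect to arc length; it does not depend on the order in which the two end
  points of the segment are chosen.\<close>

definition edge_integral :: "(real^2) set \<Rightarrow> (real^2 \<Rightarrow> real) \<Rightarrow> real" where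
  "edge_integral E f = (let (p, q) = (SOME (p, q). E = closed_segment p q)
     in norm (q - p) * (LINT t|lebesgue_on {0..1}. f (linepath p q t)))"

text \<open>The boundary edges of a mesh form a partition of \<open>\<partial>\<Omega>\<close> up to finitely many points.\<close>

definition boundary_integral ::
  "(real^2) set \<Rightarrow> (real^2) set set \<Rightarrow> (real^2 \<Rightarrow> real) \<Rightarrow> real" where
  "boundary_integral \<Omega> \<T> f = (\<Sum>E\<in>boundary_edges \<Omega> \<T>. edge_integral E f)"


section \<open>The discrete problem\<close>

definition P1_on :: "(real^2) set \<Rightarrow> (real^2 \<Rightarrow> real) \<Rightarrow> bool" where
  "P1_on K v \<longleftrightarrow> (\<exists>c g. \<forall>x\<in>K. v x = c + g \<bullet> x)"

text \<open>Elements are represented by their continuous version on \<open>closure \<Omega>\<close>, so that their boundary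
  values are pointwise values; they are extended by zero, which makes \<open>\<lambda>_. 0\<close> the only
  representative of the zero element.\<close>

definition Vh :: "(real^2) set \<Rightarrow> (real^2) set set \<Rightarrow> (real^2 \<Rightarrow> real) set" where
  "Vh \<Omega> \<T> = {v. H1 \<Omega> v \<and> (\<forall>K\<in>\<T>. P1_on K v) \<and> (\<forall>x. x \<notin> closure \<Omega> \<longrightarrow> v x = 0)}"

definition neg_part :: "real \<Rightarrow> real" where
  "neg_part w = (\<bar>w\<bar> - w) / 2"

definition adv :: "(real^2) set \<Rightarrow> (real^2 \<Rightarrow> real^2) \<Rightarrow> (real^2 \<Rightarrow> real) \<Rightarrow> real^2 \<Rightarrow> real" where
  "adv \<Omega> b u x = b x \<bullet> weak_grad \<Omega> u x"

definition kappa :: "(real^2) set \<Rightarrow> (real^2 \<Rightarrow> real^2) \<Rightarrow> (real^2) set set \<Rightarrow> real^2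
    \<Rightarrow> (real^2 \<Rightarrow> real) \<Rightarrow> real^2 \<Rightarrow> real" where
  "kappa \<Omega> b \<T> a u x = adv \<Omega> b u x
     - 1 / measure lebesgue (patch \<T> a) * (LINT y|lebesgue_on (patch \<T> a). adv \<Omega> b u y)"

definition Sh :: "(real^2) set \<Rightarrow> (real^2 \<Rightarrow> real^2) \<Rightarrow> real \<Rightarrow> (real^2) set set
    \<Rightarrow> (real^2 \<Rightarrow> real) \<Rightarrow> (real^2 \<Rightarrow> real) \<Rightarrow> real" where
  "Sh \<Omega> b \<beta> \<T> u v = (\<Sum>a\<in>vertices \<T>.
     \<beta> * h_vertex \<T> a * L2_inner (patch \<T> a) (kappa \<Omega> b \<T> a u) (kappa \<Omega> b \<T> a v))"

definition Ah :: "(real^2) set \<Rightarrow> (real^2 \<Rightarrow> real^2) \<Rightarrow> (real^2 \<Rightarrow> real) \<Rightarrow> real \<Rightarrow> (real^2) set set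
    \<Rightarrow> (real^2 \<Rightarrow> real) \<Rightarrow> (real^2 \<Rightarrow> real) \<Rightarrow> real" where
  "Ah \<Omega> b \<mu> \<beta> \<T> u v = L2_inner \<Omega> (adv \<Omega> b u) v + L2_inner \<Omega> (\<lambda>x. \<mu> x * u x) v
     + boundary_integral \<Omega> \<T> (\<lambda>x. neg_part (b x \<bullet> outward_normal \<Omega> x) * u x * v x)
     + Sh \<Omega> b \<beta> \<T> u v"

definition LPSD_norm :: "(real^2) set \<Rightarrow> (real^2 \<Rightarrow> real^2) \<Rightarrow> real \<Rightarrow> real \<Rightarrow> (real^2) set set
    \<Rightarrow> (real^2 \<Rightarrow> real) \<Rightarrow> real" where
  "LPSD_norm \<Omega> b \<alpha> \<beta> \<T> v = sqrt ((L2_norm \<Omega> (\<lambda>x. sqrt (h_fun \<T> x) * adv \<Omega> b v x))\<^sup>2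
     + \<alpha> * (L2_norm \<Omega> v)\<^sup>2
     + (\<Sum>E\<in>boundary_edges \<Omega> \<T>.
          edge_integral E (\<lambda>x. \<bar>b x \<bullet> outward_normal \<Omega> x\<bar> / 2 * (v x)\<^sup>2))
     + Sh \<Omega> b \<beta> \<T> v v)"

text \<open>The requirement \<open>\<beta> \<sim> 1 / \<parallel>b\<parallel>\<close>, with the norm of \<open>W\<^sup>1\<^sub>\<infinity>\<close> on each patch and constants that are
  uniform over the family.  Multiplied out, it forces the patch norms to be nonzero.\<close>

definition stabilization_scaling ::
  "(real^2) set set set \<Rightarrow> (real^2 \<Rightarrow> real^2) \<Rightarrow> real \<Rightarrow> bool" where
  "stabilization_scaling \<F> b \<beta> \<longleftrightarrow> (\<exists>c\<^sub>1>0. \<exists>c\<^sub>2. \<forall>\<T>\<in>\<F>. \<forall>a\<in>vertices \<T>.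
     c\<^sub>1 \<le> \<beta> * W1inf_norm (interior (patch \<T> a)) b \<and>
     \<beta> * W1inf_norm (interior (patch \<T> a)) b \<le> c\<^sub>2)"

end

theory Submission
  imports Defs
begin

text \<open>Integrating \<open>(b \<bullet> \<nabla>u, u)\<close> by parts gives coercivity of the bilinear form in all parts of the norm
  except the streamline derivative.  That part is recovered from a corrector \<open>w\<close>, the nodal
  interpolant of \<open>h\<^sub>a\<close> times the mean of \<open>b \<bullet> \<nabla>u\<close> over the patch of \<open>a\<close>: on a triangle \<open>w\<close> is a convex
  combination of its nodal values and \<open>b \<bullet> \<nabla>u\<close> differs from each mean by the fluctuation \<open>\<kappa>\<^sub>a(u)\<close>, which
  the stabilization controls, so \<open>(b \<bullet> \<nabla>u, w)\<close> bounds the streamline term up to \<open>S\<^sub>h(u, u)\<close>.  Inverse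
  estimates bound every part of the norm of \<open>w\<close> by the streamline term of \<open>u\<close>, and \<open>v = u + \<delta>w\<close> with
  small \<open>\<delta>\<close> is the required test function.

  Since the coefficient \<open>b\<close> and the functions of \<open>Vh\<close> have only weak derivatives, the integration by
  parts tests the definition of the weak derivative with smooth cut-off functions of a triangle and
  passes to the limit; the contributions of interior edges cancel in pairs.  The same identity shows
  that continuous piecewise linear functions belong to \<open>H1\<close>.\<close>

section \<open>Smooth functions\<close>

text \<open>The mesh size times \<open>b \<bullet> \<nabla>u\<close> cannot itself be the test
  function: it jumps across edges. A continuous test function has one value per vertex, and with the
  patch mean as that value the error is what \<open>S\<close> measures. \<open>is_weak_deriv\<close>
  speaks only of smooth functions with compact support, so edge integrals must be produced from
  inside a triangle. A product of three cut-offs \<open>flat 0 ((n + 1) * l - 1)\<close>,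
  \<open>l\<close> a barycentric coordinate, tends to 1 inside while its gradient concentrates on
  the edges. On one triangle a function of \<open>Vh\<close> is affine, so a product rule with one
  smooth factor is enough. \<open>weak_deriv\<close> is a choice; uniqueness replaces it almost
  everywhere by piecewise gradients, which are bounded and linear in \<open>u\<close>. The constants
  are fixed in the order \<open>t\<close>, \<open>C\<close>, \<delta>: \<open>t\<close> lets the
  corrector terms of Young's inequality take half of the streamline term, and \<delta> lets the
  terms in \<open>u\<close> take half of the coercivity. They are built from the regularity
  constants, \<alpha>, \<beta>, bounds for \<open>b\<close> and \<mu> and a bound for the diameters,
  so they are the same for all meshes.\<close>

lemma Ck_Suc_iff:
  "Ck (Suc k) f \<longleftrightarrow> (\<forall>x. (f has_derivative (\<lambda>h. \<Sum>i\<in>UNIV. h $ i * partial i f x)) (at x))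
     \<and> (\<forall>i. Ck k (partial i f))"
proof
  assume "Ck (Suc k) f"
  then obtain f' where d: "\<And>x. (f has_derivative (\<lambda>h. \<Sum>i\<in>UNIV. h $ i * f' i x)) (at x)"
    and c: "\<And>i. Ck k (f' i)" by auto
  \<comment> \<open>The derivative at a point is unique, so the existential witness in
    \<open>Ck\<close> may be replaced by the canonical \<open>partial i f\<close>, with which later
    inductions work.\<close>
  have "partial i f x = f' i x" for i x
  proof -
    have "partial i f x = (\<Sum>j\<in>UNIV. axis i 1 $ j * f' j x)"
      unfolding partial_def using frechet_derivative_at[OF d[of x]] by metis
    also have "\<dots> = (\<Sum>j\<in>UNIV. if j = i then f' j x else 0)"
      by (rule sum.cong) (auto simp: axis_def)
    finally show ?thesis by simp
  qed
  then have "partial i f = f' i" for i by auto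
  with d c show "(\<forall>x. (f has_derivative (\<lambda>h. \<Sum>i\<in>UNIV. h $ i * partial i f x)) (at x))
     \<and> (\<forall>i. Ck k (partial i f))" by simp
qed auto

lemma Ck_continuous: "Ck k f \<Longrightarrow> continuous_on UNIV f"
  by (cases k) (auto intro: has_derivative_continuous_on has_derivative_at_withinI)

lemma Ck_SucD: "Ck (Suc k) f \<Longrightarrow> Ck k f"
proof (induction k arbitrary: f)
  case 0
  then show ?case using Ck_continuous[OF 0] by simp
next
  case (Suc k)
  then show ?case unfolding Ck_Suc_iff[of "Suc k"] Ck_Suc_iff[of k] by blast
qed

lemma Ck_const: "Ck k (\<lambda>x. c)"
proof (induction k arbitrary: c)
  case (Suc k)
  then show ?case
    by (auto intro!: exI[of _ "\<lambda>i x. 0"])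
qed auto

lemma Ck_add: "Ck k f \<Longrightarrow> Ck k g \<Longrightarrow> Ck k (\<lambda>x. f x + g x)"
proof (induction k arbitrary: f g)
  case (Suc k)
  have "((\<lambda>x. f x + g x) has_derivative (\<lambda>h. \<Sum>i\<in>UNIV. h $ i * (partial i f x + partial i g x))) (at x)" for x
    using has_derivative_add[of f _ "at x" g] Suc.prems[unfolded Ck_Suc_iff]
    by (simp add: sum.distrib distrib_left)
  moreover have "Ck k (\<lambda>x. partial i f x + partial i g x)" for i
    using Suc by (simp add: Ck_Suc_iff del: Ck.simps)
  ultimately show ?case by (auto intro!: exI[of _ "\<lambda>i x. partial i f x + partial i g x"])
qed (auto intro: continuous_on_add)

lemma Ck_mult: "Ck k f \<Longrightarrow> Ck k g \<Longrightarrow> Ck k (\<lambda>x. f x * g x)"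
proof (induction k arbitrary: f g)
  case (Suc k)
  have "((\<lambda>x. f x * g x) has_derivative (\<lambda>h. \<Sum>i\<in>UNIV. h $ i * (f x * partial i g x + partial i f x * g x))) (at x)" for x
  proof -
    have "(f has_derivative (\<lambda>h. \<Sum>i\<in>UNIV. h $ i * partial i f x)) (at x)"
      "(g has_derivative (\<lambda>h. \<Sum>i\<in>UNIV. h $ i * partial i g x)) (at x)"
      using Suc.prems[unfolded Ck_Suc_iff] by auto
    from has_derivative_mult[OF this] show ?thesis
      by (simp add: sum.distrib distrib_left sum_distrib_left sum_distrib_right mult_ac)
  qed
  \<comment> \<open>The product rule pairs undifferentiated factors, of class \<open>Suc k\<close>,
    with partial derivatives of class \<open>k\<close>; \<open>Ck_SucD\<close> lowers the former so
    that the induction hypothesis applies.\<close>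
  moreover have "Ck k (\<lambda>x. f x * partial i g x + partial i f x * g x)" for i
    using Suc Ck_SucD[OF Suc.prems(1)] Ck_SucD[OF Suc.prems(2)]
    by (intro Ck_add) (simp_all add: Ck_Suc_iff del: Ck.simps)
  ultimately show ?case by (auto intro!: exI[of _ "\<lambda>i x. f x * partial i g x + partial i f x * g x"])
qed (auto intro: continuous_on_mult)

text \<open>This family is closed under differentiation up to linear combinations, which gives smoothness by
  induction.\<close>

definition flat :: "nat \<Rightarrow> real \<Rightarrow> real" where
  "flat m t = (if t > 0 then exp (- 1 / t) / t ^ m else 0)"

lemma flat_nonneg: "0 \<le> flat m t"
  by (simp add: flat_def)

text \<open>One term of the series of \<open>exp (1 / t)\<close>, the one of index
  \<open>m + 2\<close>, already beats \<open>1 / t ^ m\<close> with two powers of \<open>t\<close>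
  to spare. The second power makes the difference quotient at 0 vanish.\<close>

lemma flat_le_square: "flat m t \<le> fact (m + 2) * t\<^sup>2"
proof (cases "t > 0")
  case True
  have "(1 / t) ^ (m + 2) / fact (m + 2) \<le> exp (1 / t)"
  proof -
    have "(1 / t) ^ (m + 2) /\<^sub>R fact (m + 2) \<le> exp (1 / t)"
      unfolding exp_def using True
        sum_le_suminf[OF summable_exp_generic[of "1 / t"], of "{m + 2}"] by simp
    then show ?thesis by (simp add: field_simps)
  qed
  moreover have "(0::real) < fact (m + 2)" by simp
  ultimately have "exp (- 1 / t) \<le> fact (m + 2) * t ^ (m + 2)"
    using True unfolding minus_divide_left[symmetric] exp_minus
    by (simp add: field_simps del: fact_Suc)
  then have "exp (- 1 / t) \<le> (fact (m + 2) * t\<^sup>2) * t ^ m"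
    by (simp only: power_add mult_ac)
  then show ?thesis using True by (simp only: flat_def if_True pos_divide_le_eq zero_less_power)
qed (simp add: flat_def)

lemma flat_has_derivative:
  "(flat m has_real_derivative (flat (m + 2) t - real m * flat (m + 1) t)) (at t)"
proof -
  consider "t > 0" | "t < 0" | "t = 0" by linarith
  then show ?thesis
  proof cases
    case 1
    have "((\<lambda>t. exp (- 1 / t) / t ^ m) has_real_derivative (flat (m + 2) t - real m * flat (m + 1) t)) (at t)"
      using 1
      by (auto intro!: derivative_eq_intros simp: flat_def)
         (cases m; simp add: divide_simps power2_eq_square; simp add: algebra_simps)
    then show ?thesis
      by (rule DERIV_cong_ev[THEN iffD1, rotated -1])
        (use 1 in \<open>auto simp: flat_def intro!: eventually_mono[OF eventually_nhds_in_open[of "{0<..}"]]\<close>)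
  next
    case 2
    have "((\<lambda>t. 0) has_real_derivative (flat (m + 2) t - real m * flat (m + 1) t)) (at t)"
      using 2 by (auto simp: flat_def)
    then show ?thesis
      by (rule DERIV_cong_ev[THEN iffD1, rotated -1])
        (use 2 in \<open>auto simp: flat_def intro!: eventually_mono[OF eventually_nhds_in_open[of "{..<0}"]]\<close>)
  next
    case 3
    \<comment> \<open>At the junction of the two branches the difference quotient is squeezed by a
      multiple of \<open>|y|\<close>.\<close>
    have "((\<lambda>y. (flat m y - flat m 0) / (y - 0)) \<longlongrightarrow> 0) (at 0)"
    proof (rule tendsto_rabs_zero_cancel, rule tendsto_sandwich)
      show "\<forall>\<^sub>F y in at 0. 0 \<le> \<bar>(flat m y - flat m 0) / (y - 0)\<bar>" by simp
      have "\<bar>(flat m y - flat m 0) / (y - 0)\<bar> \<le> fact (m + 2) * \<bar>y\<bar>" for y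
      proof (cases "y = 0")
        case False
        have "\<bar>flat m y\<bar> \<le> fact (m + 2) * \<bar>y\<bar> * \<bar>y\<bar>"
          using flat_le_square[of m y] flat_nonneg[of m y] by (simp only: mult.assoc abs_mult_self_eq) (simp add: power2_eq_square)
        then show ?thesis using False by (simp only: flat_def[of m 0] abs_divide) (simp add: pos_divide_le_eq)
      qed simp
      then show "\<forall>\<^sub>F y in at 0. \<bar>(flat m y - flat m 0) / (y - 0)\<bar> \<le> fact (m + 2) * \<bar>y\<bar>" by simp
      show "((\<lambda>y. fact (m + 2) * \<bar>y\<bar>) \<longlongrightarrow> 0) (at (0::real))"
        by (auto intro!: tendsto_eq_intros)
    qed simp
    then show ?thesis using 3
      by (simp add: has_field_derivative_iff flat_def[of _ 0])
  qed
qed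

lemma flat_continuous: "continuous_on S (flat m)"
  by (intro continuous_at_imp_continuous_on ballI DERIV_isCont[OF flat_has_derivative])

lemma flat_affine_has_derivative:
  "((\<lambda>x. flat m (g \<bullet> x + c)) has_derivative
     (\<lambda>h. \<Sum>i\<in>UNIV. h $ i * (g $ i * (flat (m + 2) (g \<bullet> x + c) - real m * flat (m + 1) (g \<bullet> x + c))))) (at x)"
proof -
  have "((\<lambda>x. g \<bullet> x + c) has_derivative (\<lambda>h. g \<bullet> h)) (at x)"
    by (auto intro!: derivative_eq_intros)
  from DERIV_compose_FDERIV[OF flat_has_derivative this]
  have "((\<lambda>x. flat m (g \<bullet> x + c)) has_derivative
     (\<lambda>h. (g \<bullet> h) * (flat (m + 2) (g \<bullet> x + c) - real m * flat (m + 1) (g \<bullet> x + c)))) (at x)" .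
  then show ?thesis
    by (simp add: inner_vec_def sum_distrib_right mult_ac)
qed

text \<open>Differentiation raises the index \<open>m\<close> to \<open>m + 1\<close> and
  \<open>m + 2\<close>, so the induction on \<open>k\<close> keeps \<open>m\<close>
  arbitrary.\<close>

lemma Ck_flat_affine: "Ck k (\<lambda>x. flat m (g \<bullet> x + c))"
proof (induction k arbitrary: m)
  case 0
  then show ?case
    by (auto intro!: continuous_on_compose2[OF flat_continuous[of UNIV m]] continuous_intros)
next
  case (Suc k)
  have "Ck k (\<lambda>x. g $ i * (flat (m + 2) (g \<bullet> x + c) + (- real m) * flat (m + 1) (g \<bullet> x + c)))" for i
    by (intro Ck_mult Ck_add Ck_const Suc.IH)
  then show ?case
    using flat_affine_has_derivative[of m g c]
    by (auto intro!: exI[of _ "\<lambda>i x. g $ i * (flat (m + 2) (g \<bullet> x + c) - real m * flat (m + 1) (g \<bullet> x + c))"])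
qed

lemma Ck_affine: "Ck k (\<lambda>x. g \<bullet> x + c)"
proof (cases k)
  case (Suc j)
  have "((\<lambda>x. g \<bullet> x + c) has_derivative (\<lambda>h. \<Sum>i\<in>UNIV. h $ i * g $ i)) (at x)" for x
  proof -
    have "((\<lambda>x. g \<bullet> x + c) has_derivative (\<lambda>h. g \<bullet> h)) (at x)"
      by (auto intro!: derivative_eq_intros)
    then show ?thesis by (simp add: inner_vec_def mult.commute)
  qed
  then show ?thesis using Suc Ck_const[of j] by (auto intro!: exI[of _ "\<lambda>i x. g $ i"])
qed (auto intro!: continuous_intros)

definition smooth :: "(real^'n \<Rightarrow> real) \<Rightarrow> bool" where
  "smooth f \<longleftrightarrow> (\<forall>k. Ck k f)"

lemma smoothD:
  assumes "smooth f"
  shows "(f has_derivative (\<lambda>h. \<Sum>i\<in>UNIV. h $ i * partial i f x)) (at x)"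
    "smooth (partial i f)" "continuous_on S f" "continuous_on S (partial i f)"
proof -
  show 1: "(f has_derivative (\<lambda>h. \<Sum>i\<in>UNIV. h $ i * partial i f x)) (at x)"
    using assms[unfolded smooth_def, rule_format, of "Suc 0", unfolded Ck_Suc_iff] by blast
  show 2: "smooth (partial i f)"
    unfolding smooth_def using assms[unfolded smooth_def, rule_format, of "Suc _", unfolded Ck_Suc_iff] by blast
  show "continuous_on S f" "continuous_on S (partial i f)"
    using assms 2 Ck_continuous continuous_on_subset subset_UNIV unfolding smooth_def by blast+
qed

lemma partial_eqI:
  assumes "(f has_derivative f') (at x)" shows "partial i f x = f' (axis i 1)"
  unfolding partial_def using frechet_derivative_at[OF assms] by simp

lemma smooth_mult: "smooth f \<Longrightarrow> smooth g \<Longrightarrow> smooth (\<lambda>x. f x * g x)"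
  by (simp add: smooth_def Ck_mult)

lemma partial_mult:
  assumes "smooth f" "smooth g"
  shows "partial i (\<lambda>x. f x * g x) x = f x * partial i g x + partial i f x * g x"
  using partial_eqI[OF has_derivative_mult[OF smoothD(1)[OF assms(1)] smoothD(1)[OF assms(2)]], of i x]
  by (simp add: axis_def if_distrib if_distribR cong: if_cong)

lemma partial_affine: "partial i (\<lambda>x. g \<bullet> x + c) x = g $ i"
  by (subst partial_eqI[of _ "\<lambda>h. g \<bullet> h"]) (auto intro!: derivative_eq_intros simp: inner_axis)

lemma partial_flat_affine: "partial i (\<lambda>x. flat 0 (g \<bullet> x + c)) x = g $ i * flat 2 (g \<bullet> x + c)"
  by (subst partial_eqI[OF flat_affine_has_derivative])
     (simp add: axis_def if_distrib if_distribR numeral_2_eq_2 cong: if_cong)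

lemma smooth_affine: "smooth (\<lambda>x. g \<bullet> x + c)" and smooth_flat_affine: "smooth (\<lambda>x. flat m (g \<bullet> x + c))"
  and smooth_const: "smooth (\<lambda>x. d)"
  by (simp_all add: smooth_def Ck_affine Ck_flat_affine Ck_const)

lemma flat0_le_1: "flat 0 t \<le> 1"
  by (simp add: flat_def)

lemma flat0_at_top: "(flat 0 \<longlongrightarrow> 1) at_top"
proof -
  have "((\<lambda>t::real. exp (- 1 / t)) \<longlongrightarrow> exp 0) at_top"
    by (intro tendsto_exp real_tendsto_divide_at_top[OF tendsto_const filterlim_ident])
  then show ?thesis
    by (rule filterlim_cong[THEN iffD1, rotated -1])
      (auto simp: flat_def intro!: eventually_mono[OF eventually_gt_at_top[of 0]])
qed

text \<open>All cut-offs below are \<open>flat 0\<close> of a large multiple of a quantity that is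
  positive inside the set, minus a fixed shift; this one limit gives their pointwise convergence to
  1.\<close>

lemma flat0_tendsto:
  assumes "t > 0" "r \<longlonglongrightarrow> t"
  shows "(\<lambda>n. flat 0 (real (Suc n) * r n - d)) \<longlonglongrightarrow> 1"
proof -
  have "filterlim (\<lambda>n. r n * real (Suc n)) at_top sequentially"
    by (rule filterlim_tendsto_pos_mult_at_top[OF assms(2,1)])
       (rule filterlim_compose[OF filterlim_real_sequentially filterlim_Suc])
  then have "filterlim (\<lambda>n. - d + real (Suc n) * r n) at_top sequentially"
    by (intro filterlim_tendsto_add_at_top[OF tendsto_const]) (simp add: mult.commute)
  from filterlim_compose[OF flat0_at_top this] show ?thesis by simp
qed

section \<open>Weak derivatives\<close>

text \<open>\<open>C\<close> is any set outside which the function vanishes, not its closed support,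
  so the property passes to products without closures.\<close>

definition supported_in :: "(real^'n) set \<Rightarrow> (real^'n \<Rightarrow> real) \<Rightarrow> bool" where
  "supported_in C \<phi> \<longleftrightarrow> (\<forall>x. x \<notin> C \<longrightarrow> \<phi> x = 0)"

lemma test_funI:
  assumes "smooth \<phi>" "supported_in C \<phi>" "compact C" "C \<subseteq> U"
  shows "test_fun U \<phi>"
proof -
  have "closure {x. \<phi> x \<noteq> 0} \<subseteq> C"
    using assms by (intro closure_minimal) (auto simp: supported_in_def compact_imp_closed)
  moreover have "compact (closure {x. \<phi> x \<noteq> 0})"
    using calculation assms(3) closed_closure compact_Int_closed by (metis inf.absorb_iff2)
  ultimately show ?thesis using assms by (auto simp: test_fun_def smooth_def)
qed

lemma test_funE:
  assumes "test_fun U \<phi>"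
  obtains C where "smooth \<phi>" "compact C" "C \<subseteq> U" "supported_in C \<phi>" "\<And>i. supported_in C (partial i \<phi>)"
proof
  let ?C = "closure {x. \<phi> x \<noteq> 0}"
  show "smooth \<phi>" "compact ?C" "?C \<subseteq> U" using assms by (auto simp: test_fun_def smooth_def)
  show "supported_in ?C \<phi>" using closure_subset[of "{x. \<phi> x \<noteq> 0}"] unfolding supported_in_def by blast
  show "supported_in ?C (partial i \<phi>)" for i
    unfolding supported_in_def
  proof (intro allI impI)
    fix x assume x: "x \<notin> ?C"
    \<comment> \<open>The complement of the closed support is open and \<phi> vanishes on all of
      it.\<close>
    have "(\<phi> has_derivative (\<lambda>h. 0)) (at x)"
    proof (rule has_derivative_transform_within_open[of "\<lambda>_. 0"])
      show "open (- ?C)" "x \<in> - ?C" using x by auto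
      show "0 = \<phi> y" if "y \<in> - ?C" for y
      proof -
        have "y \<notin> {x. \<phi> x \<noteq> 0}" using that closure_subset[of "{x. \<phi> x \<noteq> 0}"] by blast
        then show ?thesis by simp
      qed
    qed simp
    from partial_eqI[OF this] show "partial i \<phi> x = 0" by simp
  qed
qed

lemma L2_inner_restrict:
  assumes "U \<in> sets lebesgue"
  shows "L2_inner U f g = (LINT x|lebesgue. indicator U x * (f x * g x))"
  unfolding L2_inner_def using assms by (subst integral_restrict_space) auto

lemma integrable_lebesgue_on_iff:
  assumes "U \<in> sets lebesgue"
  shows "integrable (lebesgue_on U) f \<longleftrightarrow> integrable lebesgue (\<lambda>x. indicator U x * f x :: real)"
  using assms by (subst integrable_restrict_space) auto

lemma L2_inner_supported:
  assumes "supported_in C \<phi>" "C \<subseteq> U" "U \<in> sets lebesgue" "C \<in> sets lebesgue"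
  shows "L2_inner U f \<phi> = L2_inner C f \<phi>"
  using assms by (simp add: L2_inner_restrict)
    (intro Bochner_Integration.integral_cong, auto simp: supported_in_def indicator_def)

lemma integrable_supported:
  assumes "supported_in C \<phi>" "C \<subseteq> U" "U \<in> sets lebesgue" "C \<in> sets lebesgue"
  shows "integrable (lebesgue_on U) (\<lambda>x. f x * \<phi> x) \<longleftrightarrow> integrable (lebesgue_on C) (\<lambda>x. f x * \<phi> x)"
proof -
  have "(\<lambda>x. indicator U x * (f x * \<phi> x)) = (\<lambda>x. indicator C x * (f x * \<phi> x))"
    using assms by (auto simp: supported_in_def indicator_def fun_eq_iff)
  then show ?thesis using assms by (simp add: integrable_lebesgue_on_iff)
qed

lemma integrable_mult_continuous:
  assumes "compact C" "integrable (lebesgue_on C) f" "continuous_on C \<psi>"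
  shows "integrable (lebesgue_on C) (\<lambda>x. f x * \<psi> x :: real)"
proof -
  obtain B where B: "\<And>x. x \<in> C \<Longrightarrow> \<bar>\<psi> x\<bar> \<le> B"
    using compact_imp_bounded[OF compact_continuous_image[OF assms(3,1)]] by (auto simp: bounded_iff)
  have C: "C \<in> sets lebesgue" using assms(1) by (simp add: lmeasurable_compact fmeasurableD)
  have [measurable]: "\<psi> \<in> borel_measurable (lebesgue_on C)"
    using continuous_imp_measurable_on_sets_lebesgue[OF assms(3) C] .
  show ?thesis
  proof (rule Bochner_Integration.integrable_bound[of _ "\<lambda>x. B * f x"])
    show "AE x in lebesgue_on C. norm (f x * \<psi> x) \<le> norm (B * f x)"
      using B by (intro AE_I2) (fastforce simp: abs_mult mult.commute intro!: mult_right_mono)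
  qed (use assms(2) in auto)
qed

lemma integrable_test:
  assumes "loc_integrable U f" "open U" "supported_in C \<psi>" "compact C" "C \<subseteq> U" "continuous_on C \<psi>"
  shows "integrable (lebesgue_on U) (\<lambda>x. f x * \<psi> x)"
  using assms
  by (subst integrable_supported[of C])
     (auto simp: lmeasurable_compact fmeasurableD loc_integrable_def intro!: integrable_mult_continuous)

lemma partial_bound:
  assumes "test_fun U \<phi>"
  obtains B where "B \<ge> 0" "\<And>x. \<bar>partial i \<phi> x\<bar> \<le> B"
proof -
  obtain C where C: "smooth \<phi>" "compact C" "supported_in C (partial i \<phi>)"
    by (rule test_funE[OF assms]) blast
  have "bounded (partial i \<phi> ` C)"
    by (rule compact_imp_bounded[OF compact_continuous_image[OF smoothD(4)[OF C(1)] C(2)]])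
  then obtain B where B': "\<forall>y\<in>partial i \<phi> ` C. norm y \<le> B" unfolding bounded_iff by (rule exE)
  have B: "\<bar>partial i \<phi> x\<bar> \<le> B" if "x \<in> C" for x
    using bspec[OF B' imageI[OF that]] by simp
  have 1: "\<bar>partial i \<phi> x\<bar> \<le> max 0 B" for x
  proof (cases "x \<in> C")
    case True
    then show ?thesis using B[OF True] by linarith
  next
    case False
    then have "partial i \<phi> x = 0" using C(3) unfolding supported_in_def by blast
    then show ?thesis by simp
  qed
  show ?thesis by (rule that[OF _ 1]) simp
qed

text \<open>Integration by parts against the constant 1. By translation invariance the difference
  quotients in direction \<open>i\<close> have integral 0; the mean value theorem bounds them
  uniformly, and dominated convergence passes to the partial derivative.\<close>

lemma integral_partial_test:
  assumes "test_fun U \<phi>"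
  shows "(LINT x|lebesgue. partial i \<phi> x) = 0"
proof -
  obtain C where C: "smooth \<phi>" "compact C" "supported_in C \<phi>" "supported_in C (partial i \<phi>)"
    by (rule test_funE[OF assms]) blast
  obtain B where B: "B \<ge> 0" "\<And>x. \<bar>partial i \<phi> x\<bar> \<le> B" by (rule partial_bound[OF assms, of i]) blast
  obtain R where R: "\<And>x. x \<in> C \<Longrightarrow> norm x \<le> R"
    using compact_imp_bounded[OF C(2)] by (auto simp: bounded_iff)
  have [measurable]: "\<phi> \<in> borel_measurable borel" "partial i \<phi> \<in> borel_measurable borel"
    using smoothD(3,4)[OF C(1)] by (auto intro: borel_measurable_continuous_onI)
  define t where "t n = 1 / real (Suc n)" for n
  have t: "t n > 0" "t n \<le> 1" for n by (auto simp: t_def)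
  have t0: "t \<longlonglongrightarrow> 0" unfolding t_def by (rule LIMSEQ_Suc[OF lim_1_over_n])
  let ?e = "axis i 1 :: real^'a"
  define s where "s n x = (\<phi> (t n *\<^sub>R ?e + x) - \<phi> x) / t n" for n x
  have [measurable]: "s n \<in> borel_measurable borel" for n unfolding s_def by measurable
  have int_phi: "integrable lborel \<phi>"
  proof -
    have "integrable lborel (\<lambda>x. indicator C x *\<^sub>R \<phi> x)"
      using borel_integrable_compact[OF C(2) smoothD(3)[OF C(1)]] by (simp add: set_integrable_def if_distrib)
    moreover have "(\<lambda>x. indicator C x *\<^sub>R \<phi> x) = \<phi>"
      by (rule ext) (use C(3) in \<open>auto simp: supported_in_def indicator_def\<close>)
    ultimately show ?thesis by simp
  qed
  have s_zero: "integral\<^sup>L lborel (s n) = 0" for n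
  proof -
    have sh: "integrable lborel (\<lambda>x. \<phi> (t n *\<^sub>R ?e + x))" "(LINT x|lborel. \<phi> (t n *\<^sub>R ?e + x)) = integral\<^sup>L lborel \<phi>"
      using int_phi integral_distr[of "(+) (t n *\<^sub>R ?e)" lborel borel \<phi>]
        integrable_distr_eq[of "(+) (t n *\<^sub>R ?e)" lborel borel \<phi>]
      by (simp_all add: lborel_distr_plus)
    show ?thesis unfolding s_def using sh int_phi by simp
  qed
  have deriv: "((\<lambda>r. \<phi> (r *\<^sub>R ?e + x)) has_real_derivative partial i \<phi> (r *\<^sub>R ?e + x)) (at r)" for r x
  proof -
    have "((\<lambda>r. \<phi> (r *\<^sub>R ?e + x)) has_derivative
       (\<lambda>h. \<Sum>j\<in>UNIV. (h *\<^sub>R ?e) $ j * partial j \<phi> (r *\<^sub>R ?e + x))) (at r)"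
    proof (rule has_derivative_compose[OF _ smoothD(1)[OF C(1)]])
      show "((\<lambda>r. r *\<^sub>R ?e + x) has_derivative (\<lambda>h. h *\<^sub>R ?e)) (at r)"
        by (auto intro!: derivative_eq_intros)
    qed
    moreover have "(\<Sum>j\<in>UNIV. (h *\<^sub>R ?e) $ j * partial j \<phi> (r *\<^sub>R ?e + x)) = partial i \<phi> (r *\<^sub>R ?e + x) * h" for h
      by (simp add: axis_def if_distrib if_distribR cong: if_cong)
    ultimately show ?thesis by (simp add: has_field_derivative_def mult_commute_abs)
  qed
  \<comment> \<open>A step of length \<open>t n\<close>, at most 1, enlarges the support by at most
    1, hence the radius \<open>R + 1\<close>.\<close>
  have bound: "\<bar>s n x\<bar> \<le> B * indicator (cball 0 (R + 1)) x" for n x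
  proof (cases "norm x \<le> R + 1")
    case True
    obtain z where "\<phi> (t n *\<^sub>R ?e + x) - \<phi> (0 *\<^sub>R ?e + x) = (t n - 0) * partial i \<phi> (z *\<^sub>R ?e + x)"
      using MVT2[of 0 "t n" "\<lambda>r. \<phi> (r *\<^sub>R ?e + x)" "\<lambda>r. partial i \<phi> (r *\<^sub>R ?e + x)"] t deriv by blast
    then have "s n x = partial i \<phi> (z *\<^sub>R ?e + x)" using t(1)[of n] by (simp add: s_def)
    then show ?thesis using B True by simp
  next
    case False
    have "norm x \<le> norm (t n *\<^sub>R ?e + x) + norm (t n *\<^sub>R ?e)"
      by (metis add_diff_cancel_left' norm_triangle_ineq4 add.commute)
    then have "norm (t n *\<^sub>R ?e + x) > R" using False t[of n] by simp
    then have "t n *\<^sub>R ?e + x \<notin> C" "x \<notin> C" using R False by fastforce+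
    then show ?thesis using C(3) B by (simp add: s_def supported_in_def)
  qed
  have lim: "(\<lambda>n. s n x) \<longlonglongrightarrow> partial i \<phi> x" for x
  proof -
    have "((\<lambda>h. (\<phi> (h *\<^sub>R ?e + x) - \<phi> x) / h) \<longlongrightarrow> partial i \<phi> x) (at 0)"
      using deriv[where r=0 and x=x] by (simp add: has_field_derivative_iff)
    moreover have "filterlim t (at 0) sequentially"
      using t0 t(1) by (auto simp: filterlim_at intro!: always_eventually) (metis less_irrefl)
    ultimately show ?thesis unfolding s_def by (rule filterlim_compose)
  qed
  have "(\<lambda>n. integral\<^sup>L lborel (s n)) \<longlonglongrightarrow> integral\<^sup>L lborel (partial i \<phi>)"
  proof (rule integral_dominated_convergence[where w="\<lambda>x. B * indicator (cball 0 (R + 1)) x"])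
    show "integrable lborel (\<lambda>x. B * indicator (cball (0::real^'a) (R + 1)) x)"
      using borel_integrable_compact[OF compact_cball[of "0::real^'a" "R+1"] continuous_on_const[of _ B]]
      by (simp add: mult.commute)
  qed (use bound lim in auto)
  then have "integral\<^sup>L lborel (partial i \<phi>) = 0"
    using s_zero LIMSEQ_unique by (simp add: LIMSEQ_const_iff)
  then show ?thesis by (simp add: integral_completion)
qed

section \<open>Product rule, congruence and restriction for weak derivatives\<close>

lemma loc_integrable_continuous:
  assumes "continuous_on U f" "open U"
  shows "loc_integrable U f"
  unfolding loc_integrable_def
proof (intro allI impI)
  fix C assume C: "compact C \<and> C \<subseteq> U"
  then have "integrable (lebesgue_on C) (\<lambda>x. 1 * f x)"
    using continuous_on_subset[OF assms(1)]
    by (intro integrable_mult_continuous)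
       (auto simp: lmeasurable_compact finite_measure_lebesgue_on intro!: finite_measure.integrable_const)
  then show "integrable (lebesgue_on C) f" by simp
qed

lemma loc_integrable_mult:
  assumes "loc_integrable U f" "continuous_on U p"
  shows "loc_integrable U (\<lambda>x. f x * p x)"
  using assms continuous_on_subset unfolding loc_integrable_def by (blast intro: integrable_mult_continuous)

lemma is_weak_deriv_const:
  assumes "open U" shows "is_weak_deriv U i (\<lambda>_. c) (\<lambda>_. 0)"
  unfolding is_weak_deriv_def
proof (intro conjI allI impI)
  fix \<phi> assume t: "test_fun U \<phi>"
  obtain C where C: "C \<subseteq> U" "supported_in C (partial i \<phi>)" by (rule test_funE[OF t]) blast
  have "L2_inner U (\<lambda>_. c) (partial i \<phi>) = (LINT x|lebesgue. c * partial i \<phi> x)"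
  proof (subst L2_inner_restrict)
    have "(\<lambda>x. indicator U x * (c * partial i \<phi> x)) = (\<lambda>x. c * partial i \<phi> x)"
      using C by (auto simp: fun_eq_iff supported_in_def indicator_def)
    then show "(LINT x|lebesgue. indicator U x * (c * partial i \<phi> x)) = (LINT x|lebesgue. c * partial i \<phi> x)"
      by simp
  qed (use assms in auto)
  then show "L2_inner U (\<lambda>_. c) (partial i \<phi>) = - L2_inner U (\<lambda>_. 0) \<phi>"
    using integral_partial_test[OF t] by (simp add: L2_inner_def)
qed (auto intro!: loc_integrable_continuous assms)

text \<open>For a smooth factor no approximation is involved: the test function
  \<open>p * \<phi>\<close> is inserted into the definition for \<open>f\<close>, and
  \<open>partial_mult\<close> splits its derivative.\<close>

lemma is_weak_deriv_mult:
  assumes "open U" "is_weak_deriv U i f g" "smooth p"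
  shows "is_weak_deriv U i (\<lambda>x. f x * p x) (\<lambda>x. g x * p x + f x * partial i p x)"
  unfolding is_weak_deriv_def
proof (intro conjI allI impI)
  have f: "loc_integrable U f" and g: "loc_integrable U g" using assms(2) by (auto simp: is_weak_deriv_def)
  show "loc_integrable U (\<lambda>x. f x * p x)"
    by (rule loc_integrable_mult[OF f smoothD(3)[OF assms(3)]])
  show "loc_integrable U (\<lambda>x. g x * p x + f x * partial i p x)"
    using loc_integrable_mult[OF f smoothD(4)[OF assms(3), of U i]] loc_integrable_mult[OF g smoothD(3)[OF assms(3), of U]]
    unfolding loc_integrable_def by (intro allI impI Bochner_Integration.integrable_add) simp_all
  fix \<phi> assume t: "test_fun U \<phi>"
  obtain C where C: "smooth \<phi>" "compact C" "C \<subseteq> U" "supported_in C \<phi>" "supported_in C (partial i \<phi>)"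
    by (rule test_funE[OF t]) blast
  have pt: "test_fun U (\<lambda>x. p x * \<phi> x)"
    using C by (intro test_funI[OF smooth_mult[OF assms(3)]]) (auto simp: supported_in_def)
  note cont = smoothD(3,4)[OF assms(3)] smoothD(3,4)[OF C(1)]
  have i1: "integrable (lebesgue_on U) (\<lambda>x. f x * (p x * partial i \<phi> x))"
    using C by (intro integrable_test[OF f assms(1)]) (auto simp: supported_in_def intro!: continuous_intros cont)
  have i2: "integrable (lebesgue_on U) (\<lambda>x. f x * (partial i p x * \<phi> x))"
    using C by (intro integrable_test[OF f assms(1)]) (auto simp: supported_in_def intro!: continuous_intros cont)
  have i3: "integrable (lebesgue_on U) (\<lambda>x. g x * (p x * \<phi> x))"
    using C by (intro integrable_test[OF g assms(1)]) (auto simp: supported_in_def intro!: continuous_intros cont)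
  have "L2_inner U f (partial i (\<lambda>x. p x * \<phi> x)) = - L2_inner U g (\<lambda>x. p x * \<phi> x)"
    using assms(2) pt by (auto simp: is_weak_deriv_def)
  moreover have "L2_inner U f (partial i (\<lambda>x. p x * \<phi> x))
      = L2_inner U (\<lambda>x. f x * p x) (partial i \<phi>) + (LINT x|lebesgue_on U. f x * (partial i p x * \<phi> x))"
    using Bochner_Integration.integral_add[OF i1 i2] partial_mult[OF assms(3) C(1)]
    by (simp add: L2_inner_def distrib_left mult.assoc)
  moreover have "L2_inner U (\<lambda>x. g x * p x + f x * partial i p x) \<phi>
     = L2_inner U g (\<lambda>x. p x * \<phi> x) + (LINT x|lebesgue_on U. f x * (partial i p x * \<phi> x))"
    using Bochner_Integration.integral_add[OF i3 i2] by (simp add: L2_inner_def distrib_right mult.assoc)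
  ultimately show "L2_inner U (\<lambda>x. f x * p x) (partial i \<phi>) = - L2_inner U (\<lambda>x. g x * p x + f x * partial i p x) \<phi>"
    by simp
qed

text \<open>\<open>p\<close> is the constant 1 times \<open>p\<close>, so
  \<open>is_weak_deriv_const\<close> and the product rule recover the classical derivative.\<close>

lemma is_weak_deriv_smooth:
  assumes "open U" "smooth p" shows "is_weak_deriv U i p (partial i p)"
  using is_weak_deriv_mult[OF assms(1) is_weak_deriv_const[OF assms(1), of i 1] assms(2)] by simp

lemma is_weak_deriv_cong:
  assumes "is_weak_deriv U i f g" "\<And>x. x \<in> U \<Longrightarrow> f x = f' x" "\<And>x. x \<in> U \<Longrightarrow> g x = g' x"
  shows "is_weak_deriv U i f' g'"
proof -
  have l: "loc_integrable U h'" if "loc_integrable U h" "\<And>x. x \<in> U \<Longrightarrow> h x = h' x" for h h'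
    unfolding loc_integrable_def
  proof (intro allI impI)
    fix C assume C: "compact C \<and> C \<subseteq> U"
    then have "integrable (lebesgue_on C) h" using that(1) by (simp add: loc_integrable_def)
    moreover have "integrable (lebesgue_on C) h \<longleftrightarrow> integrable (lebesgue_on C) h'"
      using that(2) C by (intro Bochner_Integration.integrable_cong refl) auto
    ultimately show "integrable (lebesgue_on C) h'" by simp
  qed
  have "loc_integrable U f \<Longrightarrow> loc_integrable U f'" "loc_integrable U g \<Longrightarrow> loc_integrable U g'"
    using l assms(2,3) by simp_all
  moreover have "L2_inner U f \<psi> = L2_inner U f' \<psi>" "L2_inner U g \<psi> = L2_inner U g' \<psi>" for \<psi>
    using assms(2,3) by (auto simp: L2_inner_def intro!: Bochner_Integration.integral_cong)
  ultimately show ?thesis using assms(1) unfolding is_weak_deriv_def by simp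
qed

lemma is_weak_deriv_subset:
  assumes "is_weak_deriv U i f g" "V \<subseteq> U" "open V" "open U"
  shows "is_weak_deriv V i f g"
  unfolding is_weak_deriv_def
proof (intro conjI allI impI)
  show "loc_integrable V f" "loc_integrable V g"
    using assms(1,2) unfolding is_weak_deriv_def loc_integrable_def by auto
  fix \<phi> assume t: "test_fun V \<phi>"
  obtain C where C: "smooth \<phi>" "compact C" "C \<subseteq> V" "supported_in C \<phi>" "supported_in C (partial i \<phi>)"
    by (rule test_funE[OF t]) blast
  have "test_fun U \<phi>" using t assms(2) by (auto simp: test_fun_def)
  then have "L2_inner U f (partial i \<phi>) = - L2_inner U g \<phi>" using assms(1) by (auto simp: is_weak_deriv_def)
  moreover have "supported_in V \<phi>" "supported_in V (partial i \<phi>)"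
    using C by (auto simp: supported_in_def)
  ultimately show "L2_inner V f (partial i \<phi>) = - L2_inner V g \<phi>"
    using L2_inner_supported[of V _ U] assms by auto
qed


section \<open>Smooth bumps on boxes and the fundamental lemma of the calculus of variations\<close>

definition box_bump :: "nat \<Rightarrow> real^'n \<Rightarrow> real^'n \<Rightarrow> real^'n \<Rightarrow> real" where
  "box_bump n a b x = (\<Prod>i\<in>UNIV. flat 0 (real (Suc n) * (x $ i - a $ i)) * flat 0 (real (Suc n) * (b $ i - x $ i)))"

lemma smooth_prod: "(\<And>i. i \<in> I \<Longrightarrow> smooth (f i)) \<Longrightarrow> smooth (\<lambda>x. \<Prod>i\<in>I. f i x)"
  by (induction I rule: infinite_finite_induct) (auto intro: smooth_const smooth_mult)

lemma smooth_box_bump: "smooth (box_bump n a b)"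
proof -
  have "smooth (\<lambda>x. flat 0 (real (Suc n) * (x $ i - a $ i)))" for i
    using smooth_flat_affine[of 0 "real (Suc n) *\<^sub>R axis i 1" "- real (Suc n) * a $ i"]
    by (simp add: inner_axis' algebra_simps)
  moreover have "smooth (\<lambda>x. flat 0 (real (Suc n) * (b $ i - x $ i)))" for i
    using smooth_flat_affine[of 0 "- real (Suc n) *\<^sub>R axis i 1" "real (Suc n) * b $ i"]
    by (simp add: inner_axis' algebra_simps)
  ultimately show ?thesis
    unfolding box_bump_def by (intro smooth_prod smooth_mult)
qed

lemma box_bump_supported: "supported_in (cbox a b) (box_bump n a b)"
  unfolding supported_in_def
proof (intro allI impI)
  fix x assume "x \<notin> cbox a b"
  then obtain i where "x $ i < a $ i \<or> b $ i < x $ i"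
    by (auto simp: mem_box_cart not_le)
  then have "flat 0 (real (Suc n) * (x $ i - a $ i)) * flat 0 (real (Suc n) * (b $ i - x $ i)) = 0"
    by (auto simp: flat_def zero_less_mult_iff)
  then show "box_bump n a b x = 0"
    unfolding box_bump_def by (intro prod_zero) auto
qed

lemma box_bump_bounds: "0 \<le> box_bump n a b x" "box_bump n a b x \<le> 1"
  unfolding box_bump_def
  by (auto intro!: prod_nonneg prod_le_1 mult_nonneg_nonneg flat_nonneg mult_le_one flat0_le_1)

lemma box_bump_tendsto:
  assumes "x \<in> box a b"
  shows "(\<lambda>n. box_bump n a b x) \<longlonglongrightarrow> 1"
proof -
  have "(\<lambda>n. \<Prod>i\<in>UNIV. flat 0 (real (Suc n) * (x $ i - a $ i) - 0) * flat 0 (real (Suc n) * (b $ i - x $ i) - 0))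
     \<longlonglongrightarrow> (\<Prod>i\<in>(UNIV::'a set). 1 * 1)"
    using assms by (intro tendsto_prod tendsto_mult flat0_tendsto[OF _ tendsto_const]) (auto simp: mem_box_cart)
  then show ?thesis unfolding box_bump_def by simp
qed

lemma negligible_cbox_minus_box: "negligible (cbox a b - box a b)"
  by (simp add: negligible_frontier_interval)

text \<open>The bumps are admissible test functions, lie between 0 and 1 and tend to 1 on the open
  box; dominated convergence with bound \<open>|f|\<close> turns vanishing pairings into a vanishing
  integral.\<close>

lemma integral_cbox_zero:
  assumes "open U" "loc_integrable U f" "\<And>\<phi>. test_fun U \<phi> \<Longrightarrow> L2_inner U f \<phi> = 0" "cbox a b \<subseteq> U"
  shows "(LINT x|lebesgue_on (cbox a b). f x) = 0"
proof -
  have I: "integrable (lebesgue_on (cbox a b)) f"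
    using assms(2,4) by (auto simp: loc_integrable_def)
  have t: "test_fun U (box_bump n a b)" for n
    using smooth_box_bump box_bump_supported compact_cbox assms(4) by (rule test_funI)
  have z: "(LINT x|lebesgue_on (cbox a b). f x * box_bump n a b x) = 0" for n
    using assms(3)[OF t[of n]] L2_inner_supported[OF box_bump_supported assms(4)] assms(1)
    by (simp add: L2_inner_def)
  have "(\<lambda>n. LINT x|lebesgue_on (cbox a b). f x * box_bump n a b x) \<longlonglongrightarrow> (LINT x|lebesgue_on (cbox a b). f x)"
  proof (rule integral_dominated_convergence)
    show "f \<in> borel_measurable (lebesgue_on (cbox a b))" using I by auto
    show "(\<lambda>x. f x * box_bump n a b x) \<in> borel_measurable (lebesgue_on (cbox a b))" for n
      using integrable_mult_continuous[OF compact_cbox I smoothD(3)[OF smooth_box_bump]] by auto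
    show "integrable (lebesgue_on (cbox a b)) (\<lambda>x. \<bar>f x\<bar>)" using I by simp
    have "AE x in lebesgue. x \<notin> cbox a b - box a b"
      using negligible_cbox_minus_box[of a b] by (intro AE_not_in) (simp add: negligible_iff_null_sets)
    then show "AE x in lebesgue_on (cbox a b). (\<lambda>n. f x * box_bump n a b x) \<longlonglongrightarrow> f x"
      by (simp add: AE_restrict_space_iff, elim eventually_mono)
         (auto intro!: tendsto_eq_intros box_bump_tendsto)
    show "AE x in lebesgue_on (cbox a b). norm (f x * box_bump n a b x) \<le> \<bar>f x\<bar>" for n
      using box_bump_bounds[of n a b] by (auto simp: abs_mult intro!: mult_left_le)
  qed
  then show ?thesis using z by (simp add: LIMSEQ_const_iff)
qed

text \<open>By Lebesgue's differentiation theorem \<open>F\<close> is almost everywhere the limit of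
  its means over the cubes \<open>cbox x (x + h *\<^sub>R One)\<close>, and these means vanish once
  the cube lies in the given box.\<close>

lemma zero_on_cbox:
  assumes "open U" "loc_integrable U f" "\<And>\<phi>. test_fun U \<phi> \<Longrightarrow> L2_inner U f \<phi> = 0" "cbox a b \<subseteq> U"
  shows "negligible {x \<in> cbox a b. f x \<noteq> 0}"
proof -
  define F where "F x = (if x \<in> cbox a b then f x else 0)" for x
  have I: "f absolutely_integrable_on cbox a b"
    using assms(2,4) integrable_lebesgue_on_iff[of "cbox a b" f] by (simp add: loc_integrable_def set_integrable_def)
  have "F absolutely_integrable_on UNIV"
    using I absolutely_integrable_restrict_UNIV[of "cbox a b" f] unfolding F_def by simp
  then have FI: "F integrable_on cbox c d" for c d
    using integrable_on_subcbox[of F UNIV c d] by (auto simp: absolutely_integrable_on_def)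
  obtain N where N: "negligible N" and
    lim: "\<And>x e. x \<notin> N \<Longrightarrow> 0 < e \<Longrightarrow> \<exists>d>0. \<forall>h. 0 < h \<and> h < d \<longrightarrow>
       norm (integral (cbox x (x + h *\<^sub>R One)) F /\<^sub>R h ^ DIM(real^'a) - F x) < e"
    by (rule integrable_ccontinuous_explicit[OF FI]) blast
  have "F x = 0" if x: "x \<in> box a b" "x \<notin> N" for x
  proof (rule ccontr)
    assume nz: "F x \<noteq> 0"
    obtain d where d: "d > 0" and dd: "\<And>h. 0 < h \<and> h < d \<Longrightarrow>
       norm (integral (cbox x (x + h *\<^sub>R One)) F /\<^sub>R h ^ DIM(real^'a) - F x) < \<bar>F x\<bar>"
      using lim[OF x(2), of "\<bar>F x\<bar>"] nz by auto
    obtain r where r: "r > 0" "ball x r \<subseteq> box a b" using x(1) open_contains_ball open_box by blast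
    let ?s = "norm (One :: real^'a)"
    \<comment> \<open>The denominator makes \<open>h * norm One\<close> smaller than
      \<open>r\<close>, so the cube of side \<open>h\<close> at \<open>x\<close> stays inside the
      box.\<close>
    define h where "h = min (d / 2) (r / (2 * (?s + 1)))"
    have s: "?s \<ge> 0" by simp
    have h: "0 < h" "h < d" "h \<le> r / (2 * (?s + 1))" using d r s by (auto simp: h_def divide_pos_pos add_nonneg_pos)
    have hs: "h * ?s < r"
    proof -
      have "h * (2 * (?s + 1)) \<le> r" using h(3) s by (simp add: pos_le_divide_eq)
      moreover have "h * z < h * (2 * (z + 1))" if "0 \<le> z" for z :: real using mult_strict_left_mono[of z "2 * (z + 1)" h] h(1) that by simp
      from this[OF s] have "h * ?s < h * (2 * (?s + 1))" .
      ultimately show ?thesis by linarith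
    qed
    have "x + h *\<^sub>R One \<in> ball x r" using hs h by (simp add: dist_norm)
    then have "cbox x (x + h *\<^sub>R One) \<subseteq> box a b"
      using x(1) r(2) by (auto simp: mem_box subset_iff intro: less_le_trans le_less_trans)
    then have sub: "cbox x (x + h *\<^sub>R One) \<subseteq> cbox a b" using box_subset_cbox by blast
    have z: "(LINT x|lebesgue_on (cbox x (x + h *\<^sub>R One)). f x) = 0"
      using integral_cbox_zero[OF assms(1-3)] sub assms(4) by blast
    have "integrable (lebesgue_on (cbox x (x + h *\<^sub>R One))) f"
      using assms(2,4) sub by (auto simp: loc_integrable_def)
    then have "integral (cbox x (x + h *\<^sub>R One)) f = 0"
      using z lebesgue_integral_eq_integral by (metis lmeasurable_cbox fmeasurableD)
    moreover have "integral (cbox x (x + h *\<^sub>R One)) F = integral (cbox x (x + h *\<^sub>R One)) f"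
      using sub by (intro Henstock_Kurzweil_Integration.integral_cong) (auto simp: F_def)
    ultimately show False using dd[of h] h by simp
  qed
  then have "f x = 0" if "x \<in> box a b" "x \<notin> N" for x
    using that box_subset_cbox[of a b] unfolding F_def by (metis subsetD)
  then have "{x \<in> cbox a b. f x \<noteq> 0} \<subseteq> N \<union> (cbox a b - box a b)" by auto
  then show ?thesis
    using N negligible_cbox_minus_box negligible_Un negligible_subset by blast
qed

lemma fundamental_lemma:
  assumes "open U" "loc_integrable U f" "\<And>\<phi>. test_fun U \<phi> \<Longrightarrow> L2_inner U f \<phi> = 0"
  shows "negligible {x \<in> U. f x \<noteq> 0}"
proof -
  obtain D where D: "countable D" "\<And>X. X \<in> D \<Longrightarrow> X \<subseteq> U" "\<And>X. X \<in> D \<Longrightarrow> \<exists>a b. X = cbox a b" "\<Union>D = U"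
    by (rule open_countable_Union_open_cbox[OF assms(1)]) blast
  have "negligible (\<Union>X\<in>D. {x \<in> X. f x \<noteq> 0})"
  proof (rule negligible_countable_Union)
    fix Y assume "Y \<in> (\<lambda>X. {x \<in> X. f x \<noteq> 0}) ` D"
    then obtain X where X: "X \<in> D" "Y = {x \<in> X. f x \<noteq> 0}" by (rule imageE)
    obtain a b where "X = cbox a b" using D(3)[OF X(1)] by (elim exE)
    then show "negligible Y" using zero_on_cbox[OF assms, of a b] D(2)[OF X(1)] X(2) by simp
  qed (use D(1) in simp)
  moreover have "{x \<in> U. f x \<noteq> 0} = (\<Union>X\<in>D. {x \<in> X. f x \<noteq> 0})" using D(4) by auto
  ultimately show ?thesis by simp
qed

text \<open>Makes the \<open>SOME\<close> in \<open>weak_deriv\<close> harmless: every concrete weak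
  derivative agrees with the chosen one off a null set.\<close>

lemma is_weak_deriv_unique:
  assumes "open U" "is_weak_deriv U i f g" "is_weak_deriv U i f g'"
  shows "negligible {x \<in> U. g x \<noteq> g' x}"
proof -
  have l: "loc_integrable U g" "loc_integrable U g'" using assms by (auto simp: is_weak_deriv_def)
  have "negligible {x \<in> U. g x - g' x \<noteq> 0}"
  proof (rule fundamental_lemma[OF assms(1)])
    show "loc_integrable U (\<lambda>x. g x - g' x)" using l by (auto simp: loc_integrable_def)
    fix \<phi> assume t: "test_fun U \<phi>"
    obtain C where C: "smooth \<phi>" "compact C" "C \<subseteq> U" "supported_in C \<phi>" by (rule test_funE[OF t]) blast
    have "L2_inner U (\<lambda>x. g x - g' x) \<phi> = L2_inner U g \<phi> - L2_inner U g' \<phi>"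
      unfolding L2_inner_def left_diff_distrib
      by (intro Bochner_Integration.integral_diff integrable_test[OF l(1) assms(1) C(4,2,3) smoothD(3)[OF C(1)]]
        integrable_test[OF l(2) assms(1) C(4,2,3) smoothD(3)[OF C(1)]])
    then show "L2_inner U (\<lambda>x. g x - g' x) \<phi> = 0"
      using assms t by (simp add: is_weak_deriv_def)
  qed
  then show ?thesis by simp
qed

section \<open>The divergence theorem on a triangle\<close>

text \<open>The quarter turn counterclockwise: \<open>rot u \<bullet> v\<close> is the determinant
  of \<open>u\<close> and \<open>v\<close>, and \<open>rot (q - p)\<close> is normal to the segment
  from \<open>p\<close> to \<open>q\<close> and as long as it. Areas, orientations and edge normals
  are all expressed through it.\<close>

definition rot :: "real^2 \<Rightarrow> real^2" where
  "rot v = vector [- (v $ 2), v $ 1]"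

lemma rot_nth [simp]: "rot v $ 1 = - (v $ 2)" "rot v $ 2 = v $ 1"
  by (simp_all add: rot_def)

lemma rot_inner: "rot u \<bullet> v = u $ 1 * v $ 2 - u $ 2 * v $ 1"
  by (simp add: inner_vec_def sum_2)

lemma rot_scaleR_inner: "rot (c *\<^sub>R u) \<bullet> v = c * (rot u \<bullet> v)"
  by (simp add: rot_inner algebra_simps)

lemma rot_swap: "rot u \<bullet> v = - (rot v \<bullet> u)"
  by (simp add: rot_inner)

lemma rot_self [simp]: "rot u \<bullet> u = 0"
  by (simp add: rot_inner)

lemma norm_rot [simp]: "norm (rot u) = norm u"
  by (simp add: norm_vec_def L2_set_def sum_2)

lemma Basis_real2: "(Basis :: (real^2) set) = {axis 1 1, axis 2 1}"
  by (auto simp: Basis_vec_def UNIV_2)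

lemma prod_Basis_real2: "(\<Prod>b\<in>Basis. (w :: real^2) \<bullet> b) = w $ 1 * w $ 2"
  unfolding Basis_real2 by (subst prod.insert) (auto simp: axis_eq_axis inner_axis)

lemma box_Pair: "box (a, b) (c, d) = box a c \<times> box b (d :: real)" for a c :: real
  by (auto simp: box_def Basis_prod_def)

text \<open>Identifies the measure on \<open>real^2\<close> with the product measure on
  \<open>real \<times> real\<close>, where Fubini applies. A measure is recognized as
  \<open>lborel\<close> by its values on boxes.\<close>

lemma lborel_vector2: "distr lborel borel (\<lambda>z. vector [fst z, snd z] :: real^2) = lborel"
proof (rule lborel_eqI[symmetric])
  have cont: "continuous_on UNIV (\<lambda>z :: real \<times> real. vector [fst z, snd z] :: real^2)"
    by (subst continuous_on_componentwise) (auto simp: Basis_real2 inner_axis intro!: continuous_intros)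
  then have [measurable]: "(\<lambda>z :: real \<times> real. vector [fst z, snd z] :: real^2) \<in> borel_measurable borel"
    by (rule borel_measurable_continuous_onI)
  fix l u :: "real^2" assume le: "\<And>b. b \<in> Basis \<Longrightarrow> l \<bullet> b \<le> u \<bullet> b"
  have le': "l $ 1 \<le> u $ 1" "l $ 2 \<le> u $ 2"
    using le[of "axis 1 1"] le[of "axis 2 1"] by (auto simp: Basis_real2 inner_axis)
  have "(\<lambda>z :: real \<times> real. vector [fst z, snd z] :: real^2) -` box l u = box (l $ 1, l $ 2) (u $ 1, u $ 2)"
    by (auto simp: mem_box_cart forall_2 box_Pair)
  then have "emeasure (distr lborel borel (\<lambda>z. vector [fst z, snd z] :: real^2)) (box l u)
    = emeasure lborel (box (l $ 1, l $ 2) (u $ 1, u $ 2))"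
    by (subst emeasure_distr) auto
  also have "\<dots> = emeasure (lborel \<Otimes>\<^sub>M lborel) (box (l $ 1) (u $ 1) \<times> box (l $ 2) (u $ 2))"
    by (simp add: lborel_prod box_Pair)
  also have "\<dots> = ennreal (u $ 1 - l $ 1) * ennreal (u $ 2 - l $ 2)"
    using le' by (subst lborel.emeasure_pair_measure_Times) auto
  also have "\<dots> = ennreal (\<Prod>b\<in>Basis. (u - l) \<bullet> b)"
    using le' by (simp add: prod_Basis_real2 ennreal_mult)
  finally show "emeasure (distr lborel borel (\<lambda>z. vector [fst z, snd z] :: real^2)) (box l u)
    = ennreal (\<Prod>b\<in>Basis. (u - l) \<bullet> b)" .
qed simp

text \<open>The affine change of variables as an identity of measures, so that it serves every
  integrand at once; again only boxes are checked.\<close>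

lemma lborel_affine_image:
  fixes L :: "real^2 \<Rightarrow> real^2"
  assumes L: "linear L" and d: "det (matrix L) \<noteq> 0"
  shows "lborel = distr (density lborel (\<lambda>_. ennreal \<bar>det (matrix L)\<bar>)) borel (\<lambda>x. c + L x)"
proof (rule lborel_eqI)
  have [measurable]: "(\<lambda>x. c + L x) \<in> borel_measurable borel"
    using L by (intro borel_measurable_continuous_onI continuous_intros linear_continuous_on linear_conv_bounded_linear[THEN iffD1])
  have inj: "inj L" using det_nz_iff_inj[OF L] d by simp
  then have surj: "surj L" using linear_inj_imp_surj[OF L] by simp
  fix l u :: "real^2" assume le: "\<And>b. b \<in> Basis \<Longrightarrow> l \<bullet> b \<le> u \<bullet> b"
  define S where "S = (\<lambda>x. c + L x) -` box l u"
  have img: "L ` S = box (l - c) (u - c)"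
  proof -
    have "y \<in> L ` S" if "y \<in> box (l - c) (u - c)" for y
    proof -
      obtain x where "y = L x" using surj by (metis surjD)
      then show ?thesis using that by (auto simp: S_def mem_box_cart algebra_simps)
    qed
    then show ?thesis by (auto simp: S_def mem_box_cart algebra_simps)
  qed
  have "open S" unfolding S_def
    using L by (intro open_vimage open_box continuous_intros linear_continuous_on linear_conv_bounded_linear[THEN iffD1])
  have "S = inv L ` box (l - c) (u - c)"
    unfolding img[symmetric] using image_inv_f_f[OF inj] by simp
  moreover have "bounded_linear (inv L)"
    using inj_linear_imp_inv_linear[OF L inj] linear_conv_bounded_linear by blast
  ultimately have "bounded S" using bounded_linear_image[OF bounded_box] by simp
  then have fin: "emeasure lborel S < \<infinity>" by (rule emeasure_bounded_finite)
  have Sl: "S \<in> lmeasurable" using \<open>open S\<close> \<open>bounded S\<close> by (simp add: lmeasurable_open)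
  have [measurable]: "S \<in> sets borel" using \<open>open S\<close> by simp
  have "emeasure (distr (density lborel (\<lambda>_. ennreal \<bar>det (matrix L)\<bar>)) borel (\<lambda>x. c + L x)) (box l u)
     = ennreal \<bar>det (matrix L)\<bar> * emeasure lborel S"
    by (subst emeasure_distr) (auto simp: emeasure_density S_def[symmetric] nn_integral_cmult)
  also have "\<dots> = ennreal (\<bar>det (matrix L)\<bar> * measure lebesgue S)"
    using fin by (simp add: emeasure_eq_ennreal_measure ennreal_mult)
  also have "\<dots> = ennreal (measure lebesgue (L ` S))"
    by (simp add: measure_linear_image[OF L Sl])
  also have "\<dots> = emeasure lborel (box (l - c) (u - c))"
    unfolding img using emeasure_bounded_finite[OF bounded_box, of "l - c" "u - c"]
    by (subst emeasure_eq_ennreal_measure) (auto simp: less_top)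
  also have "\<dots> = ennreal (\<Prod>b\<in>Basis. (u - l) \<bullet> b)"
    using le by (subst emeasure_lborel_box) (auto simp: inner_diff_left)
  finally show "emeasure (distr (density lborel (\<lambda>_. ennreal \<bar>det (matrix L)\<bar>)) borel (\<lambda>x. c + L x)) (box l u)
     = ennreal (\<Prod>b\<in>Basis. (u - l) \<bullet> b)" .
qed simp

text \<open>The Jacobian of the coordinates along \<open>u\<close> and \<open>v\<close> is the
  determinant \<open>rot u \<bullet> v\<close>.\<close>

lemma integral_parallelogram_coords:
  fixes u v c :: "real^2"
  assumes F[measurable]: "F \<in> borel_measurable borel" and uv: "rot u \<bullet> v \<noteq> 0"
  shows "(LINT x|lborel. F x) = \<bar>rot u \<bullet> v\<bar> * (LINT z|lborel. F (c + fst z *\<^sub>R u + snd z *\<^sub>R v) :: real)"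
proof -
  define L where "L z = z $ 1 *\<^sub>R u + z $ 2 *\<^sub>R v" for z :: "real^2"
  have L: "linear L"
    by (rule linearI) (auto simp: L_def scaleR_add_left algebra_simps)
  have [measurable]: "(\<lambda>x. c + L x) \<in> borel_measurable borel"
    using L by (intro borel_measurable_continuous_onI continuous_intros linear_continuous_on linear_conv_bounded_linear[THEN iffD1])
  have det: "det (matrix L) = rot u \<bullet> v"
    by (simp add: det_2 matrix_def L_def rot_inner axis_def algebra_simps)
  have cont: "continuous_on UNIV (\<lambda>z :: real \<times> real. vector [fst z, snd z] :: real^2)"
    by (subst continuous_on_componentwise) (auto simp: Basis_real2 inner_axis intro!: continuous_intros)
  then have [measurable]: "(\<lambda>z :: real \<times> real. vector [fst z, snd z] :: real^2) \<in> borel_measurable borel"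
    by (rule borel_measurable_continuous_onI)
  have "(LINT x|lborel. F x) = (LINT x|distr (density lborel (\<lambda>_. ennreal \<bar>det (matrix L)\<bar>)) borel (\<lambda>x. c + L x). F x)"
    using det uv by (intro arg_cong[where f="\<lambda>M. integral\<^sup>L M F"] lborel_affine_image[OF L]) simp
  also have "\<dots> = \<bar>rot u \<bullet> v\<bar> * (LINT x|lborel. F (c + L x))"
    by (subst integral_distr) (auto simp: integral_density det)
  also have "(LINT x|lborel. F (c + L x)) = (LINT x|distr lborel borel (\<lambda>z. vector [fst z, snd z] :: real^2). F (c + L x))"
    unfolding lborel_vector2 ..
  also have "\<dots> = (LINT z|lborel. F (c + fst z *\<^sub>R u + snd z *\<^sub>R v))"
    by (subst integral_distr) (auto simp: L_def add.assoc)
  finally show ?thesis .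
qed

text \<open>The primitive \<open>flat 0\<close> rises from 0 to 1 on the half line, and
  \<open>flat 2\<close> vanishes for negative arguments.\<close>

lemma flat2_integral:
  shows "integrable lborel (flat 2)" "(LINT t|lborel. flat 2 t) = 1"
proof -
  have [measurable]: "flat 2 \<in> borel_measurable borel"
    by (rule borel_measurable_continuous_onI[OF flat_continuous])
  have d: "(flat 0 has_real_derivative flat 2 t) (at t)" for t
    using flat_has_derivative[of 0 t] by (simp add: numeral_2_eq_2)
  have "(\<integral>\<^sup>+t. ennreal (flat 2 t) * indicator {0..} t \<partial>lborel) = ennreal (1 - flat 0 0)"
    by (intro nn_integral_FTC_atLeast) (auto intro: d flat_nonneg flat0_at_top)
  also have "(\<lambda>t. ennreal (flat 2 t) * indicator {0..} t) = (\<lambda>t. ennreal (flat 2 t))"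
    by (auto simp: flat_def indicator_def)
  finally have n: "(\<integral>\<^sup>+t. ennreal (flat 2 t) \<partial>lborel) = 1" by (simp add: flat_def)
  then show "integrable lborel (flat 2)"
    by (intro integrableI_nonneg) (auto simp: flat_nonneg)
  show "(LINT t|lborel. flat 2 t) = 1"
    using n by (subst integral_eq_nn_integral) (auto simp: flat_nonneg)
qed

lemma flat2_shift_integral:
  shows "integrable lborel (\<lambda>t. flat 2 (t - 1))" "(LINT t|lborel. flat 2 (t - 1)) = 1"
  using lborel_integral_real_affine[of 1 "flat 2" "- 1"] lborel_integrable_real_affine[of "flat 2" 1 "- 1"] flat2_integral
  by simp_all

lemma integral_product_lborel:
  fixes f g :: "real \<Rightarrow> real"
  assumes "integrable lborel f" "integrable lborel g"
  shows "integrable lborel (\<lambda>z. f (fst z) * g (snd z))"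
    "(LINT z|lborel. f (fst z) * g (snd z)) = (LINT x|lborel. f x) * (LINT y|lborel. g y)"
proof -
  have [measurable]: "f \<in> borel_measurable borel" "g \<in> borel_measurable borel"
    using assms by (auto dest: borel_measurable_integrable)
  have I: "integrable (lborel \<Otimes>\<^sub>M lborel) (\<lambda>z. f (fst z) * g (snd z))"
  proof (rule lborel_pair.Fubini_integrable)
    show "integrable lborel (\<lambda>x. LINT y|lborel. norm (f (fst (x, y)) * g (snd (x, y))))"
      using assms by (simp add: abs_mult)
  qed (use assms in auto)
  then show "integrable lborel (\<lambda>z. f (fst z) * g (snd z))" by (simp add: lborel_prod)
  have "(LINT z|lborel. f (fst z) * g (snd z)) = (LINT z|(lborel \<Otimes>\<^sub>M lborel). f (fst z) * g (snd z))"
    by (simp add: lborel_prod)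
  also have "\<dots> = (\<integral>x. (\<integral>y. f x * g y \<partial>lborel) \<partial>lborel)"
    using lborel_pair.integral_fst'[OF I] by simp
  finally show "(LINT z|lborel. f (fst z) * g (snd z)) = (LINT x|lborel. f x) * (LINT y|lborel. g y)"
    by simp
qed


text \<open>A quotient of signed areas: the barycentric coordinate that belongs to the third vertex
  \<open>r\<close>, equal to 1 at \<open>r\<close> and to 0 on the line through \<open>p\<close> and
  \<open>q\<close>. The other two coordinates arise by cyclic permutation of the arguments.\<close>

definition bary :: "real^2 \<Rightarrow> real^2 \<Rightarrow> real^2 \<Rightarrow> real^2 \<Rightarrow> real" where
  "bary p q r x = (rot (q - p) \<bullet> (x - p)) / (rot (q - p) \<bullet> (r - p))"

text \<open>Twice the signed area does not depend on the vertex from which it is computed, so all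
  three coordinates share one denominator.\<close>

lemma rot_cycle: "rot (r - q) \<bullet> (p - q) = rot (q - p) \<bullet> (r - p)"
  by (simp add: rot_inner algebra_simps)

lemma bary_affine:
  "bary p q r x = (rot (q - p) /\<^sub>R (rot (q - p) \<bullet> (r - p))) \<bullet> x + (- (rot (q - p) \<bullet> p) / (rot (q - p) \<bullet> (r - p)))"
  by (simp add: bary_def inner_diff_right divide_inverse algebra_simps)

lemma bary_sum:
  assumes "rot (q - p) \<bullet> (r - p) \<noteq> 0"
  shows "bary p q r x + bary q r p x + bary r p q x = 1"
proof -
  have "rot (q - p) \<bullet> (x - p) + rot (r - q) \<bullet> (x - q) + rot (p - r) \<bullet> (x - r) = rot (q - p) \<bullet> (r - p)"
    by (simp add: rot_inner algebra_simps)
  then show ?thesis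
    using assms unfolding bary_def rot_cycle[of r q p] rot_cycle[of p r q] by (simp add: add_divide_distrib[symmetric])
qed

lemma bary_point:
  assumes "rot (q - p) \<bullet> (r - p) \<noteq> 0"
  shows "bary p q r x *\<^sub>R r + bary q r p x *\<^sub>R p + bary r p q x *\<^sub>R q = x"
proof -
  have "(rot (q - p) \<bullet> (x - p)) *\<^sub>R r + (rot (r - q) \<bullet> (x - q)) *\<^sub>R p + (rot (p - r) \<bullet> (x - r)) *\<^sub>R q
     = (rot (q - p) \<bullet> (r - p)) *\<^sub>R x"
    by (simp add: vec_eq_iff forall_2 rot_inner) algebra
  then have "(1 / (rot (q - p) \<bullet> (r - p))) *\<^sub>R ((rot (q - p) \<bullet> (x - p)) *\<^sub>R r + (rot (r - q) \<bullet> (x - q)) *\<^sub>R p + (rot (p - r) \<bullet> (x - r)) *\<^sub>R q)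
     = x"
    using assms by simp
  then show ?thesis
    unfolding bary_def rot_cycle[of r q p] rot_cycle[of p r q] scaleR_add_right scaleR_scaleR by simp
qed

text \<open>\<open>s\<close> measures the relative distance from the edge between \<open>p\<close>
  and \<open>q\<close>, and \<open>t\<close> runs along it: the coordinates suited to concentration
  on that edge.\<close>

lemma bary_param:
  assumes "rot (q - p) \<bullet> (r - p) \<noteq> 0"
  shows "bary p q r (p + s *\<^sub>R (r - p) + t *\<^sub>R (q - p)) = s"
    "bary r p q (p + s *\<^sub>R (r - p) + t *\<^sub>R (q - p)) = t"
    "bary q r p (p + s *\<^sub>R (r - p) + t *\<^sub>R (q - p)) = 1 - s - t"
proof -
  show 1: "bary p q r (p + s *\<^sub>R (r - p) + t *\<^sub>R (q - p)) = s"
    using assms unfolding bary_def by (simp add: inner_add_right)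
  have "rot (p - r) \<bullet> ((p + s *\<^sub>R (r - p) + t *\<^sub>R (q - p)) - r) = t * (rot (q - p) \<bullet> (r - p))"
    by (simp add: rot_inner algebra_simps)
  then show 2: "bary r p q (p + s *\<^sub>R (r - p) + t *\<^sub>R (q - p)) = t"
    using assms unfolding bary_def rot_cycle[of p r q] rot_cycle[of r q p] by simp
  show "bary q r p (p + s *\<^sub>R (r - p) + t *\<^sub>R (q - p)) = 1 - s - t"
    using bary_sum[OF assms, of "p + s *\<^sub>R (r - p) + t *\<^sub>R (q - p)"] 1 2 by linarith
qed

lemma triangle_eq:
  assumes "rot (q - p) \<bullet> (r - p) \<noteq> 0"
  shows "convex hull {p, q, r} = {x. 0 \<le> bary p q r x \<and> 0 \<le> bary q r p x \<and> 0 \<le> bary r p q x}"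
proof (intro set_eqI iffI)
  fix x assume "x \<in> convex hull {p, q, r}"
  then obtain u v w where uvw: "0 \<le> u" "0 \<le> v" "0 \<le> w" "u + v + w = 1" "x = u *\<^sub>R p + v *\<^sub>R q + w *\<^sub>R r"
    unfolding convex_hull_3 by blast
  have "x = p + w *\<^sub>R (r - p) + v *\<^sub>R (q - p)"
  proof -
    have "u = 1 - v - w" using uvw(4) by simp
    show ?thesis unfolding uvw(5) \<open>u = 1 - v - w\<close> by (simp add: algebra_simps)
  qed
  then show "x \<in> {x. 0 \<le> bary p q r x \<and> 0 \<le> bary q r p x \<and> 0 \<le> bary r p q x}"
    using bary_param[OF assms, of w v] uvw by simp
next
  fix x assume "x \<in> {x. 0 \<le> bary p q r x \<and> 0 \<le> bary q r p x \<and> 0 \<le> bary r p q x}"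
  then have pos: "0 \<le> bary p q r x" "0 \<le> bary q r p x" "0 \<le> bary r p q x" by auto
  show "x \<in> convex hull {p, q, r}"
  proof -
    have "bary q r p x + bary r p q x + bary p q r x = 1"
      "x = bary q r p x *\<^sub>R p + bary r p q x *\<^sub>R q + bary p q r x *\<^sub>R r"
      using bary_sum[OF assms, of x] bary_point[OF assms, of x] by (simp_all add: ac_simps)
    then show ?thesis using pos unfolding convex_hull_3 by blast
  qed
qed

lemma continuous_on_bary: "continuous_on S (bary p q r)"
  unfolding bary_def divide_inverse by (intro continuous_intros)

text \<open>The triangle lies in a closed half plane bounded by the line through \<open>p\<close>
  and \<open>q\<close>, and taking interiors is monotone.\<close>

lemma interior_bary_pos:
  assumes "rot (q - p) \<bullet> (r - p) \<noteq> 0" "x \<in> interior (convex hull {p, q, r})"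
  shows "bary p q r x > 0"
proof -
  let ?D = "rot (q - p) \<bullet> (r - p)"
  let ?a = "rot (q - p) /\<^sub>R ?D"
  have a: "?a \<noteq> 0" using assms(1) by (auto simp: inner_zero_left)
  have "convex hull {p, q, r} \<subseteq> {x. ?a \<bullet> x \<ge> (rot (q - p) \<bullet> p) / ?D}"
    unfolding triangle_eq[OF assms(1)] bary_affine[of p q r] by auto
  then have "x \<in> interior {x. ?a \<bullet> x \<ge> (rot (q - p) \<bullet> p) / ?D}"
    using assms(2) interior_mono by blast
  then show ?thesis
    unfolding interior_halfspace_ge[OF a] bary_affine[of p q r] by auto
qed

lemma interior_triangle:
  assumes "rot (q - p) \<bullet> (r - p) \<noteq> 0"
  shows "interior (convex hull {p, q, r}) = {x. 0 < bary p q r x \<and> 0 < bary q r p x \<and> 0 < bary r p q x}"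
proof
  have 1: "convex hull {p, q, r} = convex hull {q, r, p}" "convex hull {p, q, r} = convex hull {r, p, q}"
    by (auto simp: insert_commute)
  have D: "rot (r - q) \<bullet> (p - q) \<noteq> 0" "rot (p - r) \<bullet> (q - r) \<noteq> 0"
    using assms rot_cycle[of r q p] rot_cycle[of p r q] by auto
  show "interior (convex hull {p, q, r}) \<subseteq> {x. 0 < bary p q r x \<and> 0 < bary q r p x \<and> 0 < bary r p q x}"
    using interior_bary_pos[OF assms] interior_bary_pos[OF D(1)] interior_bary_pos[OF D(2)] 1 by auto
  have "open {x. 0 < bary p q r x \<and> 0 < bary q r p x \<and> 0 < bary r p q x}"
    by (intro open_Collect_conj open_Collect_less continuous_on_bary continuous_on_const)
  then show "{x. 0 < bary p q r x \<and> 0 < bary q r p x \<and> 0 < bary r p q x} \<subseteq> interior (convex hull {p, q, r})"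
    by (intro interior_maximal) (auto simp: triangle_eq[OF assms])
qed


text \<open>The term of the gradient of the cut-off function of a triangle that concentrates on the edge from
  \<open>p\<close> to \<open>q\<close>; \<open>flat 2\<close> is the derivative of \<open>flat 0\<close> and has integral 1.\<close>

definition edge_mollifier :: "nat \<Rightarrow> real^2 \<Rightarrow> real^2 \<Rightarrow> real^2 \<Rightarrow> real^2 \<Rightarrow> real" where
  "edge_mollifier n p q r x = real (Suc n) * flat 2 (real (Suc n) * bary p q r x - 1)
     * flat 0 (real (Suc n) * bary q r p x - 1) * flat 0 (real (Suc n) * bary r p q x - 1)"

text \<open>In coordinates along \<open>r - p\<close> and \<open>q - p\<close>, the first stretched
  by \<open>n + 1\<close>, the factor \<open>n + 1\<close> cancels against the Jacobian and the
  profile \<open>flat 2 (s - 1)\<close> no longer depends on \<open>n\<close>. In the limit the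
  point moves to the edge, the other two factors tend to 1, and the profile integrates to 1.\<close>

lemma edge_mollifier_limit:
  fixes f :: "real^2 \<Rightarrow> real"
  assumes D: "rot (q - p) \<bullet> (r - p) \<noteq> 0" and f: "continuous_on (convex hull {p, q, r}) f"
  shows "(\<lambda>n. LINT x|lebesgue_on (convex hull {p, q, r}). f x * edge_mollifier n p q r x)
    \<longlonglongrightarrow> \<bar>rot (q - p) \<bullet> (r - p)\<bar> * (LINT t|lebesgue_on {0..1}. f (linepath p q t))"
proof -
  let ?K = "convex hull {p, q, r}"
  have K: "compact ?K" by (simp add: finite_imp_compact_convex_hull)
  define F where "F x = (if x \<in> ?K then f x else 0)" for x
  have F: "F = (\<lambda>x. indicator ?K x *\<^sub>R f x)" by (auto simp: F_def)
  have [measurable]: "F \<in> borel_measurable borel"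
    unfolding F using K f by (intro borel_measurable_continuous_on_indicator) (auto simp: compact_imp_closed)
  have "bounded (f ` ?K)" using compact_imp_bounded[OF compact_continuous_image[OF f K]] .
  then obtain B where B: "\<forall>y\<in>f ` ?K. norm y \<le> B" unfolding bounded_iff by (rule exE)
  have FB: "\<bar>F x\<bar> \<le> \<bar>B\<bar>" for x
    using B unfolding F_def by (cases "x \<in> ?K") fastforce+
  have [measurable]: "flat m \<in> borel_measurable borel" for m
    by (rule borel_measurable_continuous_onI[OF flat_continuous])
  have [measurable]: "bary a b c \<in> borel_measurable borel" for a b c
    by (rule borel_measurable_continuous_onI[OF continuous_on_bary])
  have [measurable]: "edge_mollifier n p q r \<in> borel_measurable borel" for n
    unfolding edge_mollifier_def by measurable
  define X where "X n z = p + (fst z / real (Suc n)) *\<^sub>R (r - p) + snd z *\<^sub>R (q - p)" for n and z :: "real \<times> real"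
  have [measurable]: "X n \<in> borel_measurable borel" for n unfolding X_def by (intro borel_measurable_continuous_onI continuous_intros) auto
  define G where "G n z = F (X n z) * (flat 2 (fst z - 1) * flat 0 (real (Suc n) * (1 - snd z) - fst z - 1)
     * flat 0 (real (Suc n) * snd z - 1))" for n z
  have [measurable]: "(\<lambda>z :: real \<times> real. flat 2 (fst z - 1) * flat 0 (real (Suc n) * (1 - snd z) - fst z - 1)
     * flat 0 (real (Suc n) * snd z - 1)) \<in> borel_measurable borel" for n
    by (intro borel_measurable_continuous_onI continuous_on_mult continuous_on_compose2[OF flat_continuous[of UNIV]] continuous_intros)
       auto
  have Gm: "G n \<in> borel_measurable borel" for n unfolding G_def by measurable
  have step: "(LINT x|lebesgue_on ?K. f x * edge_mollifier n p q r x) = \<bar>rot (q - p) \<bullet> (r - p)\<bar> * (LINT z|lborel. G n z)" for n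
  proof -
    let ?N = "real (Suc n)"
    have cr: "rot ((r - p) /\<^sub>R ?N) \<bullet> (q - p) = - (rot (q - p) \<bullet> (r - p)) / ?N"
      unfolding rot_scaleR_inner rot_swap[of "r - p" "q - p"] by (simp add: divide_inverse)
    have "(LINT x|lebesgue_on ?K. f x * edge_mollifier n p q r x) = (LINT x|lebesgue. F x * edge_mollifier n p q r x)"
      unfolding F using K
      by (subst integral_restrict_space) (auto simp: mult.assoc lmeasurable_compact fmeasurableD)
    also have "\<dots> = (LINT x|lborel. F x * edge_mollifier n p q r x)"
      by (rule integral_completion) measurable
    also have "\<dots> = \<bar>rot ((r - p) /\<^sub>R ?N) \<bullet> (q - p)\<bar> *
       (LINT z|lborel. F (p + fst z *\<^sub>R ((r - p) /\<^sub>R ?N) + snd z *\<^sub>R (q - p))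
          * edge_mollifier n p q r (p + fst z *\<^sub>R ((r - p) /\<^sub>R ?N) + snd z *\<^sub>R (q - p)))"
    proof (rule integral_parallelogram_coords)
      show "rot ((r - p) /\<^sub>R ?N) \<bullet> (q - p) \<noteq> 0" unfolding cr using D by simp
    qed measurable
    also have "\<bar>rot ((r - p) /\<^sub>R ?N) \<bullet> (q - p)\<bar> = \<bar>rot (q - p) \<bullet> (r - p)\<bar> / ?N"
      unfolding cr by simp
    also have "(\<lambda>z. F (p + fst z *\<^sub>R ((r - p) /\<^sub>R ?N) + snd z *\<^sub>R (q - p))
          * edge_mollifier n p q r (p + fst z *\<^sub>R ((r - p) /\<^sub>R ?N) + snd z *\<^sub>R (q - p))) = (\<lambda>z. ?N * G n z)"
    proof
      fix z :: "real \<times> real"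
      have X: "p + fst z *\<^sub>R ((r - p) /\<^sub>R ?N) + snd z *\<^sub>R (q - p) = X n z"
        by (simp add: X_def divide_inverse)
      have N: "?N * (fst z / ?N) = fst z" "?N * (1 - fst z / ?N - snd z) = ?N * (1 - snd z) - fst z"
        by (simp_all add: field_simps)
      show "F (p + fst z *\<^sub>R ((r - p) /\<^sub>R ?N) + snd z *\<^sub>R (q - p))
          * edge_mollifier n p q r (p + fst z *\<^sub>R ((r - p) /\<^sub>R ?N) + snd z *\<^sub>R (q - p)) = ?N * G n z"
        unfolding X unfolding edge_mollifier_def G_def unfolding X_def bary_param[OF D] N by (simp only: mult_ac)
    qed
    also have "\<bar>rot (q - p) \<bullet> (r - p)\<bar> / ?N * (LINT z|lborel. ?N * G n z) = \<bar>rot (q - p) \<bullet> (r - p)\<bar> * (LINT z|lborel. G n z)"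
      by simp
    finally show ?thesis .
  qed
  define H where "H t = indicator {0..1} t *\<^sub>R f (linepath p q t)" for t
  have seg: "linepath p q t \<in> ?K" if "t \<in> {0..1}" for t
  proof -
    have "linepath p q t \<in> closed_segment p q" using that by (metis linepath_in_path)
    then show ?thesis
      using hull_mono[of "{p, q}" "{p, q, r}" convex] by (auto simp: segment_convex_hull)
  qed
  have cl: "continuous_on {0..1} (\<lambda>t. f (linepath p q t))"
    using seg by (intro continuous_on_compose2[OF f] continuous_on_linepath) auto
  have Hm[measurable]: "H \<in> borel_measurable borel" unfolding H_def
    by (intro borel_measurable_continuous_on_indicator cl) auto
  have Hint: "integrable lborel H"
    using borel_integrable_compact[OF compact_Icc cl] by (simp add: H_def[abs_def] set_integrable_def)
  \<comment> \<open>The bound is the profile in the first coordinate times a constant on the unit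
    interval in the second: where the profile is nonzero, the cut-offs make \<open>G\<close> vanish
    for the second coordinate outside that interval.\<close>
  have lim: "(\<lambda>n. LINT z|lborel. G n z) \<longlonglongrightarrow> (LINT z|lborel. flat 2 (fst z - 1) * H (snd z))"
  proof (rule integral_dominated_convergence[where w="\<lambda>z. flat 2 (fst z - 1) * (\<bar>B\<bar> * indicator {0..1} (snd z))"])
    show "integrable lborel (\<lambda>z. flat 2 (fst z - 1) * (\<bar>B\<bar> * indicator {0..1::real} (snd z)))"
      by (intro integral_product_lborel(1) flat2_shift_integral integrable_mult_right)
         (auto simp: integrable_indicator_iff)
    show "AE z in lborel. (\<lambda>n. G n z) \<longlonglongrightarrow> flat 2 (fst z - 1) * H (snd z)"
    proof -
      have *: "(\<lambda>n. G n (s, t)) \<longlonglongrightarrow> flat 2 (s - 1) * H t" if "t \<noteq> 0" "t \<noteq> 1" for s t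
      proof (cases "s > 1 \<and> 0 < t \<and> t < 1")
        case False
        then have "G n (s, t) = 0" for n
        proof -
          consider "s \<le> 1" | "s > 1" "t \<le> 0" | "s > 1" "t \<ge> 1" using False by linarith
          then show ?thesis
          proof cases
            case 2
            then have "real (Suc n) * t \<le> 0" by (simp add: mult_nonneg_nonpos)
            then show ?thesis by (simp add: G_def flat_def)
          next
            case 3
            then have "real (Suc n) * (1 - t) \<le> 0" by (intro mult_nonneg_nonpos) auto
            then show ?thesis using 3 by (simp add: G_def flat_def)
          qed (simp add: G_def flat_def)
        qed
        moreover have "flat 2 (s - 1) * H t = 0" using False that by (auto simp: flat_def H_def)
        ultimately have "G n (s, t) = flat 2 (s - 1) * H t" for n by metis
        then show ?thesis by (simp only: tendsto_const)
      next
        case True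
        have s0: "(\<lambda>n. s / real (Suc n)) \<longlonglongrightarrow> 0"
          by (rule LIMSEQ_Suc[OF lim_const_over_n])
        have Xl: "(\<lambda>n. X n (s, t)) \<longlonglongrightarrow> linepath p q t"
        proof -
          have "(\<lambda>n. X n (s, t)) \<longlonglongrightarrow> p + 0 *\<^sub>R (r - p) + t *\<^sub>R (q - p)"
            unfolding X_def fst_conv snd_conv by (intro tendsto_intros s0)
          then show ?thesis by (simp add: linepath_def algebra_simps)
        qed
        \<comment> \<open>For fixed \<open>s\<close> and \<open>t\<close> the point is eventually in
          the triangle, where \<open>F\<close> is the continuous function \<open>f\<close>.\<close>
        have "eventually (\<lambda>n. s / real (Suc n) < 1 - t) sequentially"
          using order_tendstoD(2)[OF s0, of "1 - t"] True by simp
        then have inK: "eventually (\<lambda>n. X n (s, t) \<in> ?K) sequentially"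
          by eventually_elim (use True in \<open>auto simp: X_def triangle_eq[OF D] bary_param[OF D]\<close>)
        have "(\<lambda>n. f (X n (s, t))) \<longlonglongrightarrow> f (linepath p q t)"
          using continuous_on_tendsto_compose[OF f Xl seg inK] True by simp
        then have Fl: "(\<lambda>n. F (X n (s, t))) \<longlonglongrightarrow> f (linepath p q t)"
          by (rule Lim_transform_eventually) (use inK in \<open>eventually_elim, simp add: F_def\<close>)
        have f1: "(\<lambda>n. flat 0 (real (Suc n) * (1 - t) - s - 1)) \<longlonglongrightarrow> 1"
          using flat0_tendsto[OF _ tendsto_const, of "1 - t" "s + 1"] True by (simp add: algebra_simps)
        have f2: "(\<lambda>n. flat 0 (real (Suc n) * t - 1)) \<longlonglongrightarrow> 1"
          using flat0_tendsto[OF _ tendsto_const, of t 1] True by simp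
        have "(\<lambda>n. G n (s, t)) \<longlonglongrightarrow> f (linepath p q t) * (flat 2 (s - 1) * 1 * 1)"
          unfolding G_def fst_conv snd_conv by (intro tendsto_mult Fl tendsto_const f1 f2)
        then show ?thesis using True by (simp add: H_def mult.commute)
      qed
      \<comment> \<open>The lines \<open>t = 0\<close> and \<open>t = 1\<close>, on which the limit
        may fail, are null sets.\<close>
      have "AE z :: real \<times> real in lborel. z \<bullet> (0, 1) \<noteq> c" for c
        by (rule AE_lborel_inner_neq) (simp add: Basis_prod_def)
      from this[of 0] this[of 1] have "AE z :: real \<times> real in lborel. snd z \<noteq> 0 \<and> snd z \<noteq> 1"
        by eventually_elim (simp add: inner_prod_def)
      then show ?thesis by eventually_elim (use * in \<open>metis prod.collapse\<close>)
    qed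
    show "AE z in lborel. norm (G n z) \<le> flat 2 (fst z - 1) * (\<bar>B\<bar> * indicator {0..1} (snd z))" for n
    proof (rule AE_I2)
      fix z :: "real \<times> real"
      show "norm (G n z) \<le> flat 2 (fst z - 1) * (\<bar>B\<bar> * indicator {0..1} (snd z))"
      proof (cases "fst z > 1 \<and> snd z \<in> {0..1}")
        case True
        have "\<bar>F (X n z)\<bar> * (flat 2 (fst z - 1) * flat 0 (real (Suc n) * (1 - snd z) - fst z - 1) * flat 0 (real (Suc n) * snd z - 1))
          \<le> \<bar>B\<bar> * (flat 2 (fst z - 1) * 1 * 1)"
          by (intro mult_mono FB flat0_le_1 mult_nonneg_nonneg flat_nonneg order_refl) auto
        then show ?thesis using True
          by (simp add: G_def abs_mult flat_nonneg mult_ac)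
      next
        case False
        then consider "fst z \<le> 1" | "fst z > 1" "snd z \<le> 0" | "fst z > 1" "snd z \<ge> 1" by (auto simp: not_le) linarith+
        then have "G n z = 0"
        proof cases
          case 2
          then have "real (Suc n) * snd z \<le> 0" by (simp add: mult_nonneg_nonpos)
          then show ?thesis by (simp add: G_def flat_def)
        next
          case 3
          then have "real (Suc n) * (1 - snd z) \<le> 0" by (intro mult_nonneg_nonpos) auto
          then show ?thesis using 3 by (simp add: G_def flat_def)
        qed (simp add: G_def flat_def)
        then show ?thesis by (simp add: flat_nonneg)
      qed
    qed
  qed (use integral_product_lborel(1)[OF flat2_shift_integral(1) Hint] Gm in \<open>auto dest: borel_measurable_integrable\<close>)
  have "(LINT z|lborel. flat 2 (fst z - 1) * H (snd z)) = (LINT t|lborel. H t)"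
    using integral_product_lborel(2)[OF flat2_shift_integral(1) Hint] flat2_shift_integral(2) by simp
  also have "\<dots> = (LINT t|lebesgue. H t)" by (rule integral_completion[symmetric]) simp
  also have "\<dots> = (LINT t|lebesgue_on {0..1}. f (linepath p q t))"
    unfolding H_def by (subst integral_restrict_space) auto
  finally show ?thesis unfolding step using lim by (intro tendsto_mult tendsto_const) simp
qed


text \<open>The shift by 1 makes the function vanish where the coordinate is at most
  \<open>1 / (n + 1)\<close>, so the product of the three cut-offs has compact support inside the
  open triangle.\<close>

definition bary_cut :: "nat \<Rightarrow> real^2 \<Rightarrow> real^2 \<Rightarrow> real^2 \<Rightarrow> real^2 \<Rightarrow> real" where
  "bary_cut n p q r x = flat 0 (real (Suc n) * bary p q r x - 1)"

lemma bary_cut_affine: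
  obtains g c where "bary_cut n p q r = (\<lambda>x. flat 0 (g \<bullet> x + c))"
    "g = (real (Suc n) / (rot (q - p) \<bullet> (r - p))) *\<^sub>R rot (q - p)"
    "\<And>x. g \<bullet> x + c = real (Suc n) * bary p q r x - 1"
proof
  let ?g = "(real (Suc n) / (rot (q - p) \<bullet> (r - p))) *\<^sub>R rot (q - p)"
  let ?c = "- real (Suc n) * (rot (q - p) \<bullet> p) / (rot (q - p) \<bullet> (r - p)) - 1"
  show *: "?g \<bullet> x + ?c = real (Suc n) * bary p q r x - 1" for x
    unfolding bary_affine by (simp add: inner_simps divide_inverse algebra_simps)
  show "bary_cut n p q r = (\<lambda>x. flat 0 (?g \<bullet> x + ?c))" unfolding bary_cut_def * ..
qed simp

lemma smooth_bary_cut: "smooth (bary_cut n p q r)"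
proof -
  obtain g c where 1: "bary_cut n p q r = (\<lambda>x. flat 0 (g \<bullet> x + c))" by (rule bary_cut_affine)
  show ?thesis unfolding 1 by (rule smooth_flat_affine)
qed

lemma partial_bary_cut: "partial i (bary_cut n p q r) x
   = rot (q - p) $ i / (rot (q - p) \<bullet> (r - p)) * (real (Suc n) * flat 2 (real (Suc n) * bary p q r x - 1))"
proof -
  obtain g c where 1: "bary_cut n p q r = (\<lambda>x. flat 0 (g \<bullet> x + c))"
    and 2: "g = (real (Suc n) / (rot (q - p) \<bullet> (r - p))) *\<^sub>R rot (q - p)"
    and 3: "\<And>x. g \<bullet> x + c = real (Suc n) * bary p q r x - 1" by (rule bary_cut_affine) blast
  show ?thesis unfolding 1 by (subst partial_flat_affine, subst 3) (simp add: 2)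
qed

lemma bary_cut_bounds: "0 \<le> bary_cut n p q r x" "bary_cut n p q r x \<le> 1"
  by (auto simp: bary_cut_def flat_nonneg flat0_le_1)

lemma bary_cut_tendsto: "bary p q r x > 0 \<Longrightarrow> (\<lambda>n. bary_cut n p q r x) \<longlonglongrightarrow> 1"
  unfolding bary_cut_def
  by (rule flat0_tendsto[where r="\<lambda>_. bary p q r x" and t="bary p q r x"]) auto

lemma bary_cut_zero: "bary p q r x < 1 / real (Suc n) \<Longrightarrow> bary_cut n p q r x = 0"
  by (auto simp: bary_cut_def flat_def field_simps)

lemma continuous_on_edge_mollifier: "continuous_on S (edge_mollifier n p q r)"
  unfolding edge_mollifier_def
  by (intro continuous_intros continuous_on_compose2[OF flat_continuous[of UNIV]] continuous_on_bary) auto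

lemma integrable_continuous_compact:
  fixes f :: "real^'n \<Rightarrow> real"
  assumes "compact C" "continuous_on C f" shows "integrable (lebesgue_on C) f"
proof -
  have "integrable (lebesgue_on C) (\<lambda>x. 1 * f x)"
    using assms
    by (intro integrable_mult_continuous)
       (auto simp: lmeasurable_compact finite_measure_lebesgue_on intro!: finite_measure.integrable_const)
  then show ?thesis by simp
qed

lemma AE_interior_convex:
  fixes K :: "(real^'n) set"
  assumes "convex K" "K \<in> sets lebesgue" shows "AE x in lebesgue_on K. x \<in> interior K"
proof -
  have "AE x in lebesgue. x \<notin> frontier K"
    using negligible_convex_frontier[OF assms(1)] by (intro AE_not_in) (simp add: negligible_iff_null_sets)
  then show ?thesis using assms
    by (simp add: AE_restrict_space_iff, elim eventually_mono) (use closure_subset in \<open>auto simp: frontier_def\<close>)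
qed

text \<open>The product of the three cut-offs is an admissible test function tending to 1 inside.
  With \<open>D\<close> the determinant, its gradient is a sum of three edge mollifiers with
  constant vectors \<open>rot (q - p) / D\<close> and cyclic ones. Each yields one edge integral
  with factor \<open>|D|\<close>, and \<open>|D| / D\<close> is the sign in the statement.\<close>

lemma triangle_green:
  fixes f g :: "real^2 \<Rightarrow> real"
  assumes D: "rot (q - p) \<bullet> (r - p) \<noteq> 0" and K: "K = convex hull {p, q, r}"
    and f: "continuous_on K f" and g: "integrable (lebesgue_on K) g" and w: "is_weak_deriv (interior K) i f g"
  shows "(LINT x|lebesgue_on K. g x) = - sgn (rot (q - p) \<bullet> (r - p)) *
    (rot (q - p) $ i * (LINT t|lebesgue_on {0..1}. f (linepath p q t))
     + rot (r - q) $ i * (LINT t|lebesgue_on {0..1}. f (linepath q r t))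
     + rot (p - r) $ i * (LINT t|lebesgue_on {0..1}. f (linepath r p t)))"
    (is "_ = - sgn ?D * (_ $ i * ?E p q + _ $ i * ?E q r + _ $ i * ?E r p)")
proof -
  have K2: "K = convex hull {q, r, p}" "K = convex hull {r, p, q}"
    using K by (auto simp: insert_commute)
  have D2: "rot (r - q) \<bullet> (p - q) = ?D" "rot (p - r) \<bullet> (q - r) = ?D"
    using rot_cycle[of r q p] rot_cycle[of p r q] by auto
  have cK: "compact K" unfolding K by (simp add: finite_imp_compact_convex_hull)
  then have Kl: "K \<in> sets lebesgue" by (simp add: lmeasurable_compact fmeasurableD)
  have fI: "integrable (lebesgue_on K) f" using integrable_continuous_compact[OF cK f] .
  define \<Phi> where "\<Phi> n x = bary_cut n p q r x * bary_cut n q r p x * bary_cut n r p q x" for n x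
  have sm: "smooth (\<Phi> n)" for n unfolding \<Phi>_def by (intro smooth_mult smooth_bary_cut)
  \<comment> \<open>A closed part of the triangle at positive distance from all edges; it carries
    the support of the cut-off.\<close>
  define C where "C n = {x. 1 / real (Suc n) \<le> bary p q r x \<and> 1 / real (Suc n) \<le> bary q r p x \<and> 1 / real (Suc n) \<le> bary r p q x}" for n
  have Ci: "C n \<subseteq> interior K" for n
  proof
    fix x assume "x \<in> C n"
    moreover have "0 < 1 / real (Suc n)" by simp
    ultimately show "x \<in> interior K"
      unfolding K interior_triangle[OF D] C_def mem_Collect_eq using less_le_trans by blast
  qed
  have "closed (C n)" for n unfolding C_def
    by (intro closed_Collect_conj closed_Collect_le continuous_on_bary continuous_on_const)
  moreover have "bounded (C n)" for n
    using bounded_subset[OF compact_imp_bounded[OF cK]] Ci interior_subset by (metis subset_trans)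
  ultimately have Cc: "compact (C n)" for n by (simp add: compact_eq_bounded_closed)
  have supp: "supported_in (C n) (\<Phi> n)" for n
    unfolding supported_in_def \<Phi>_def C_def using bary_cut_zero by (auto simp: not_le)
  have t: "test_fun (interior K) (\<Phi> n)" for n
    by (rule test_funI[OF sm supp Cc Ci])
  \<comment> \<open>Each term of the product rule differentiates one cut-off, which gives the peak
    \<open>flat 2\<close> at one edge times the cut-offs for the other two.\<close>
  have pd: "partial i (\<Phi> n) x = (rot (q - p) $ i / ?D) * edge_mollifier n p q r x
     + (rot (r - q) $ i / ?D) * edge_mollifier n q r p x + (rot (p - r) $ i / ?D) * edge_mollifier n r p q x" for n x
  proof -
    have \<Phi>: "\<Phi> n = (\<lambda>x. bary_cut n p q r x * bary_cut n q r p x * bary_cut n r p q x)"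
      by (simp add: \<Phi>_def[abs_def])
    have "partial i (\<Phi> n) x = bary_cut n p q r x * bary_cut n q r p x * partial i (bary_cut n r p q) x
      + (bary_cut n p q r x * partial i (bary_cut n q r p) x + partial i (bary_cut n p q r) x * bary_cut n q r p x) * bary_cut n r p q x"
      unfolding \<Phi>
      by (simp only: partial_mult[OF smooth_mult[OF smooth_bary_cut smooth_bary_cut] smooth_bary_cut] partial_mult[OF smooth_bary_cut smooth_bary_cut])
    then show ?thesis
      unfolding partial_bary_cut D2
      unfolding edge_mollifier_def bary_cut_def by (simp only: distrib_right distrib_left mult_ac add_ac)
  qed
  have intK: "L2_inner (interior K) h \<psi> = L2_inner K h \<psi>" if "supported_in (interior K) \<psi>" for h \<psi>
    using L2_inner_supported[OF that interior_subset Kl] by simp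
  have supp': "supported_in (interior K) (\<Phi> n)" "supported_in (interior K) (partial i (\<Phi> n))" for n
    by (rule test_funE[OF t[of n]]; auto simp: supported_in_def subset_iff)+
  have eq: "L2_inner K f (partial i (\<Phi> n)) = - L2_inner K g (\<Phi> n)" for n
    using w t[of n] intK[OF supp'(1)[of n]] intK[OF supp'(2)[of n]] unfolding is_weak_deriv_def by metis
  have emI: "integrable (lebesgue_on K) (\<lambda>x. f x * edge_mollifier n a b c x)" for n a b c
    by (rule integrable_mult_continuous[OF cK fI continuous_on_edge_mollifier])
  have lhs: "L2_inner K f (partial i (\<Phi> n)) =
       rot (q - p) $ i / ?D * (LINT x|lebesgue_on K. f x * edge_mollifier n p q r x)
     + rot (r - q) $ i / ?D * (LINT x|lebesgue_on K. f x * edge_mollifier n q r p x)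
     + rot (p - r) $ i / ?D * (LINT x|lebesgue_on K. f x * edge_mollifier n r p q x)" for n
  proof -
    have "L2_inner K f (partial i (\<Phi> n)) = (LINT x|lebesgue_on K. rot (q - p) $ i / ?D * (f x * edge_mollifier n p q r x)
     + rot (r - q) $ i / ?D * (f x * edge_mollifier n q r p x)
     + rot (p - r) $ i / ?D * (f x * edge_mollifier n r p q x))"
      unfolding L2_inner_def pd by (simp only: distrib_left mult_ac)
    also have "\<dots> = rot (q - p) $ i / ?D * (LINT x|lebesgue_on K. f x * edge_mollifier n p q r x)
     + rot (r - q) $ i / ?D * (LINT x|lebesgue_on K. f x * edge_mollifier n q r p x)
     + rot (p - r) $ i / ?D * (LINT x|lebesgue_on K. f x * edge_mollifier n r p q x)"
      by (subst Bochner_Integration.integral_add; (intro Bochner_Integration.integrable_add integrable_mult_right emI)?)+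
         (simp only: integral_mult_right_zero)
    finally show ?thesis .
  qed
  have "(\<lambda>n. L2_inner K f (partial i (\<Phi> n))) \<longlonglongrightarrow> rot (q - p) $ i / ?D * (\<bar>?D\<bar> * ?E p q)
     + rot (r - q) $ i / ?D * (\<bar>?D\<bar> * ?E q r) + rot (p - r) $ i / ?D * (\<bar>?D\<bar> * ?E r p)"
    unfolding lhs
    using edge_mollifier_limit[of q p r f] edge_mollifier_limit[of r q p f] edge_mollifier_limit[of p r q f] D D2 f
    unfolding K[symmetric] K2[symmetric] by (intro tendsto_intros) auto
  moreover have "(\<lambda>n. L2_inner K g (\<Phi> n)) \<longlonglongrightarrow> (LINT x|lebesgue_on K. g x)"
    unfolding L2_inner_def
  proof (rule integral_dominated_convergence)
    show "g \<in> borel_measurable (lebesgue_on K)" using g by auto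
    show "(\<lambda>x. g x * \<Phi> n x) \<in> borel_measurable (lebesgue_on K)" for n
      using integrable_mult_continuous[OF cK g smoothD(3)[OF sm]] by auto
    show "integrable (lebesgue_on K) (\<lambda>x. \<bar>g x\<bar>)" using g by simp
    have "convex K" unfolding K by simp
    from AE_interior_convex[OF this Kl] show "AE x in lebesgue_on K. (\<lambda>n. g x * \<Phi> n x) \<longlonglongrightarrow> g x"
    proof eventually_elim
      fix x assume "x \<in> interior K"
      then have "(\<lambda>n. g x * \<Phi> n x) \<longlonglongrightarrow> g x * (1 * 1 * 1)"
        unfolding K interior_triangle[OF D] \<Phi>_def by (intro tendsto_mult tendsto_const bary_cut_tendsto) auto
      then show "(\<lambda>n. g x * \<Phi> n x) \<longlonglongrightarrow> g x" by simp
    qed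
    have "0 \<le> \<Phi> n x" "\<Phi> n x \<le> 1" for n x
      unfolding \<Phi>_def by (auto intro!: mult_nonneg_nonneg mult_le_one bary_cut_bounds)
    then show "AE x in lebesgue_on K. norm (g x * \<Phi> n x) \<le> \<bar>g x\<bar>" for n
      by (auto simp: abs_mult intro!: mult_left_le)
  qed
  then have "(\<lambda>n. L2_inner K f (partial i (\<Phi> n))) \<longlonglongrightarrow> - (LINT x|lebesgue_on K. g x)"
    unfolding eq by (rule tendsto_minus)
  ultimately have "- (LINT x|lebesgue_on K. g x) = rot (q - p) $ i / ?D * (\<bar>?D\<bar> * ?E p q)
     + rot (r - q) $ i / ?D * (\<bar>?D\<bar> * ?E q r) + rot (p - r) $ i / ?D * (\<bar>?D\<bar> * ?E r p)"
    by (rule LIMSEQ_unique[rotated])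
  moreover have "\<bar>?D\<bar> = sgn ?D * ?D" by (simp add: abs_sgn)
  ultimately have "- (LINT x|lebesgue_on K. g x) = sgn ?D * (rot (q - p) $ i * ?E p q + rot (r - q) $ i * ?E q r + rot (p - r) $ i * ?E r p)"
    using D by (simp add: distrib_left mult_ac)
  then show ?thesis by simp
qed

section \<open>Polygonal domains and triangles\<close>

lemma borel_measurable_lebesgue_on_iff:
  fixes f :: "'a::euclidean_space \<Rightarrow> real"
  assumes "S \<in> sets lebesgue"
  shows "f \<in> borel_measurable (lebesgue_on S) \<longleftrightarrow> (\<lambda>x. indicator S x * f x) \<in> borel_measurable lebesgue"
  using assms by (subst borel_measurable_restrict_space_iff) (auto simp: mult.commute)

text \<open>Completeness of Lebesgue measure carries measurability along almost everywhere
  equality.\<close>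

lemma lebesgue_on_cong_AE:
  fixes f g :: "'a::euclidean_space \<Rightarrow> real"
  assumes S: "S \<in> sets lebesgue" and ae: "AE x in lebesgue_on S. f x = g x"
  shows "f \<in> borel_measurable (lebesgue_on S) \<longleftrightarrow> g \<in> borel_measurable (lebesgue_on S)"
    "integrable (lebesgue_on S) f \<longleftrightarrow> integrable (lebesgue_on S) g"
    "(LINT x|lebesgue_on S. f x) = (LINT x|lebesgue_on S. g x)"
proof -
  have ae': "AE x in lebesgue. indicator S x * f x = indicator S x * g x"
    using ae S by (simp add: AE_restrict_space_iff, elim eventually_mono) (auto simp: indicator_def)
  then have ae'': "AE x in lebesgue. indicator S x * g x = indicator S x * f x" by (rule eventually_mono) auto
  show m: "f \<in> borel_measurable (lebesgue_on S) \<longleftrightarrow> g \<in> borel_measurable (lebesgue_on S)"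
    unfolding borel_measurable_lebesgue_on_iff[OF S]
    by (rule iffI, erule borel_measurable_AE[OF _ ae'], erule borel_measurable_AE[OF _ ae''])
  show i: "integrable (lebesgue_on S) f \<longleftrightarrow> integrable (lebesgue_on S) g"
  proof (cases "f \<in> borel_measurable (lebesgue_on S)")
    case True
    with m show ?thesis by (intro integrable_cong_AE[OF _ _ ae]) simp_all
  next
    case False
    with m show ?thesis by (metis borel_measurable_integrable)
  qed
  show "(LINT x|lebesgue_on S. f x) = (LINT x|lebesgue_on S. g x)"
  proof (cases "integrable (lebesgue_on S) f")
    case True
    then show ?thesis using i ae by (intro integral_cong_AE) auto
  \<comment> \<open>If neither function is integrable, both integrals have the default value
    0.\<close>
  qed (use i in \<open>simp add: not_integrable_integral_eq\<close>)
qed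

lemma AE_lebesgue_on_negligible:
  assumes "S \<in> sets lebesgue" "negligible N" "\<And>x. x \<in> S \<Longrightarrow> x \<notin> N \<Longrightarrow> P x"
  shows "AE x in lebesgue_on S. P x"
proof -
  have "AE x in lebesgue. x \<notin> N" using assms(2) by (intro AE_not_in) (simp add: negligible_iff_null_sets)
  then show ?thesis using assms(1,3) by (simp add: AE_restrict_space_iff, elim eventually_mono) auto
qed

text \<open>A boundary curve separates the plane, and the connected set \<open>\<Omega>\<close> lies on one side of it, so points on
  the other side keep a boundary point out of the interior of the closure.\<close>

lemma interior_closure_polygonal:
  assumes "polygonal_domain \<Omega>"
  shows "interior (closure \<Omega>) = \<Omega>"
proof
  have op: "open \<Omega>" and con: "connected \<Omega>" using assms by (auto simp: polygonal_domain_def)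
  obtain \<J> where J: "\<forall>J\<in>\<J>. closed_polygon J" "frontier \<Omega> = \<Union>\<J>"
    using assms by (auto simp: polygonal_domain_def)
  show "\<Omega> \<subseteq> interior (closure \<Omega>)" using op closure_subset by (rule interior_maximal[rotated])
  show "interior (closure \<Omega>) \<subseteq> \<Omega>"
  proof (rule ccontr)
    assume "\<not> interior (closure \<Omega>) \<subseteq> \<Omega>"
    then obtain x where x: "x \<in> interior (closure \<Omega>)" "x \<notin> \<Omega>" by auto
    then have "x \<in> frontier \<Omega>" using op interior_subset by (auto simp: frontier_def interior_open)
    then obtain J p where p: "J \<in> \<J>" "x \<in> path_image p" "simple_path p" "pathfinish p = pathstart p" "path_image p = J"
      using J by (auto simp: closed_polygon_def)
    \<comment> \<open>\<open>Jordan_curve\<close> lives in the complex plane; \<open>c\<close> and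
      \<open>d\<close> are mutually inverse linear identifications with
      \<open>real^2\<close>.\<close>
    define c where "c y = Complex (y $ 1) (y $ 2)" for y :: "real^2"
    define d where "d z = (vector [Re z, Im z] :: real^2)" for z
    have dc: "d (c y) = y" and cd: "c (d z) = z" for y z
      by (simp_all add: c_def d_def vec_eq_iff forall_2 complex_eq_iff)
    have lc: "linear c" by (rule linearI) (auto simp: c_def complex_eq_iff)
    have ld: "linear d" by (rule linearI) (auto simp: d_def vec_eq_iff forall_2)
    have inj: "inj c" by (metis dc injI)
    have contd: "continuous_on S d" for S using ld linear_continuous_on linear_conv_bounded_linear by blast
    have contc: "continuous_on S c" for S using lc linear_continuous_on linear_conv_bounded_linear by blast
    have sp: "simple_path (c \<circ> p)" using simple_path_linear_image_eq[OF lc inj] p(3) by blast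
    have cl: "pathfinish (c \<circ> p) = pathstart (c \<circ> p)" using p(4) by (simp add: pathfinish_compose pathstart_compose)
    have im: "path_image (c \<circ> p) = c ` J" using p(5) by (simp add: path_image_compose)
    obtain A B where AB: "open A" "connected A" "open B" "connected B" "A \<inter> B = {}" "A \<union> B = - c ` J"
        "frontier A = c ` J" "frontier B = c ` J"
      by (rule Jordan_curve[OF sp cl]) (auto simp: im)
    have "J \<inter> \<Omega> = {}" using p(1) J(2) op by (auto simp: frontier_def interior_open)
    then have sub: "c ` \<Omega> \<subseteq> A \<union> B" unfolding AB(6) using inj by (auto dest: injD)
    have "connected (c ` \<Omega>)" using con contc by (intro connected_continuous_image)
    then have "c ` \<Omega> \<subseteq> A \<or> c ` \<Omega> \<subseteq> B"
      using connectedD[of "c ` \<Omega>" A B] AB(1,3,5) sub by blast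
    then obtain A' B' where AB': "c ` \<Omega> \<subseteq> A'" "open B'" "A' \<inter> B' = {}" "frontier B' = c ` J"
    proof
      assume "c ` \<Omega> \<subseteq> A" then show ?thesis using AB by (intro that[of A B]) auto
    next
      assume "c ` \<Omega> \<subseteq> B" then show ?thesis using AB by (intro that[of B A]) auto
    qed
    have "c x \<in> closure B'" using p AB'(4) by (auto simp: frontier_def)
    then have "x \<in> d ` closure B'" using dc by (metis imageI)
    moreover have "d ` closure B' \<subseteq> closure (d ` B')"
      by (rule image_closure_subset[OF contd closed_closure closure_subset])
    ultimately have xcl: "x \<in> closure (d ` B')" by blast
    have "d ` B' = c -` B'" using dc cd by (auto simp: image_iff) metis
    moreover have "open (c -` B')" using AB'(2) contc[of UNIV] by (simp add: open_vimage)
    ultimately have opB: "open (d ` B')" by simp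
    \<comment> \<open>\<open>x\<close> is in the closure of the open side that \<Omega> avoids, so
      its neighbourhood \<open>interior (closure \<Omega>)\<close> meets that side in an open set,
      and by density so does \<Omega>.\<close>
    have "interior (closure \<Omega>) \<inter> d ` B' \<noteq> {}"
      using xcl x(1) open_Int_closure_eq_empty[OF open_interior, of "closure \<Omega>" "d ` B'"] by blast
    then have "(interior (closure \<Omega>) \<inter> d ` B') \<inter> \<Omega> \<noteq> {}"
      using open_Int_closure_eq_empty[of "interior (closure \<Omega>) \<inter> d ` B'" \<Omega>] opB interior_subset by blast
    then obtain y where "y \<in> \<Omega>" "y \<in> d ` B'" by auto
    then have "c y \<in> A'" "c y \<in> B'" using AB'(1) cd by auto
    then show False using AB'(3) by auto
  qed
qed

text \<open>The vertices are listed in an order, but the orientation is left free: the determinant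
  is only nonzero. Signs are taken up later by \<open>side\<close>.\<close>

definition triangle :: "real^2 \<Rightarrow> real^2 \<Rightarrow> real^2 \<Rightarrow> (real^2) set \<Rightarrow> bool" where
  "triangle p q r K \<longleftrightarrow> K = convex hull {p, q, r} \<and> rot (q - p) \<bullet> (r - p) \<noteq> 0"

lemma triangle_rotate: "triangle p q r K \<Longrightarrow> triangle q r p K"
  unfolding triangle_def using rot_cycle[of r q p] by (auto simp: insert_commute)

lemma triangle_swap: "triangle p q r K \<Longrightarrow> triangle q p r K"
  unfolding triangle_def by (auto simp: insert_commute rot_inner algebra_simps)

lemma triangle_distinct: "triangle p q r K \<Longrightarrow> p \<noteq> q \<and> q \<noteq> r \<and> p \<noteq> r"
  by (auto simp: triangle_def rot_inner)

text \<open>Collinear vertices would lie in a line, of affine dimension 1, against the affine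
  independence of three points.\<close>

lemma simplex_tri:
  fixes K :: "(real^2) set"
  assumes "2 simplex K" obtains p q r where "triangle p q r K"
proof -
  obtain C where C: "\<not> affine_dependent C" "card C = 3" "K = convex hull C"
    using assms by (auto simp: simplex_def)
  obtain p q r where pqr: "C = {p, q, r}" "p \<noteq> q" "q \<noteq> r" "p \<noteq> r"
    using C(2) by (auto simp: card_3_iff)
  have "rot (q - p) \<bullet> (r - p) \<noteq> 0"
  proof
    assume z: "rot (q - p) \<bullet> (r - p) = 0"
    have nz: "rot (q - p) \<noteq> 0" using pqr(2) norm_rot[of "q - p"] by (metis norm_eq_zero right_minus_eq)
    have "C \<subseteq> {x. rot (q - p) \<bullet> x = rot (q - p) \<bullet> p}"
      using z rot_self[of "q - p"] unfolding pqr(1) by (auto simp: inner_diff_right simp del: rot_self)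
    then have "aff_dim C \<le> aff_dim {x. rot (q - p) \<bullet> x = rot (q - p) \<bullet> p}" by (rule aff_dim_subset)
    also have "\<dots> = 1" using aff_dim_hyperplane[OF nz] by simp
    finally show False using aff_dim_affine_independent[OF C(1)] C(2) by simp
  qed
  then show ?thesis using that C pqr by (auto simp: triangle_def)
qed

lemma triangle_independent:
  assumes "triangle p q r K" shows "\<not> affine_dependent {p, q, r}"
proof -
  let ?D = "rot (q - p) \<bullet> (r - p)"
  have D: "?D \<noteq> 0" using assms by (simp add: triangle_def)
  have d: "distinct [p, q, r]" using triangle_distinct[OF assms] by simp
  have ne: "a \<notin> affine hull {b, c}" if h: "triangle b c a K" for a b c
  proof
    assume "a \<in> affine hull {b, c}"
    then obtain u v where uv: "u + v = 1" "a = u *\<^sub>R b + v *\<^sub>R c" by (auto simp: affine_hull_2)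
    then have u: "u = 1 - v" by simp
    have "a - b = v *\<^sub>R (c - b)" unfolding uv(2) u by (simp add: algebra_simps)
    then have "rot (c - b) \<bullet> (a - b) = 0" by simp
    then show False using h by (simp add: triangle_def)
  qed
  have "p \<notin> affine hull {q, r}" "q \<notin> affine hull {r, p}" "r \<notin> affine hull {p, q}"
    using ne[of q r p] ne[of r p q] ne[of p q r] assms triangle_rotate by blast+
  then show ?thesis using d unfolding affine_dependent_def
    by (auto simp: insert_Diff_if insert_commute)
qed

lemma triangle_extreme:
  assumes "triangle p q r K" shows "a extreme_point_of K \<longleftrightarrow> a \<in> {p, q, r}"
  using assms extreme_point_of_convex_hull_affine_independent[OF triangle_independent[OF assms]] by (simp add: triangle_def)

lemma triangle_edge:
  assumes t: "triangle p q r K"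
  shows "E edge_of K \<longleftrightarrow> E = closed_segment p q \<or> E = closed_segment q r \<or> E = closed_segment r p"
proof
  note ind = triangle_independent[OF t]
  have dist: "p \<noteq> q" "q \<noteq> r" "p \<noteq> r" using triangle_distinct[OF t] by auto
  assume "E edge_of K"
  then obtain c where c: "c \<subseteq> {p, q, r}" "E = convex hull c" "aff_dim E = 1"
    using t face_of_convex_hull_affine_independent[OF ind] unfolding edge_of_def triangle_def by auto
  have "\<not> affine_dependent c" using affine_independent_subset[OF ind c(1)] .
  then have card: "card c = 2" using aff_dim_affine_independent[of c] c(2,3) by (simp add: aff_dim_convex_hull)
  then obtain a b where ab: "c = {a, b}" "a \<noteq> b" by (auto simp: card_2_iff)
  then have "a \<in> {p, q, r}" "b \<in> {p, q, r}" using c(1) by blast+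
  then have "{a, b} = {p, q} \<or> {a, b} = {q, r} \<or> {a, b} = {r, p}" using ab(2) by fast
  then show "E = closed_segment p q \<or> E = closed_segment q r \<or> E = closed_segment r p"
    unfolding segment_convex_hull c(2) ab(1) by metis
next
  note ind = triangle_independent[OF t]
  have e: "closed_segment a b edge_of K" if "{a, b} \<subseteq> {p, q, r}" "a \<noteq> b" for a b
  proof -
    have "convex hull {a, b} face_of convex hull {p, q, r}"
      using face_of_convex_hull_affine_independent[OF ind] that(1) by blast
    moreover have "aff_dim (convex hull {a, b}) = 1" using that(2) by (simp add: aff_dim_convex_hull aff_dim_2)
    ultimately show ?thesis using t unfolding edge_of_def triangle_def segment_convex_hull by simp
  qed
  assume "E = closed_segment p q \<or> E = closed_segment q r \<or> E = closed_segment r p"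
  then show "E edge_of K" using e triangle_distinct[OF t] by auto
qed

text \<open>However the end points of an edge are chosen, the triangle can be renamed so that they
  become its first two vertices; this absorbs the choice made in
  \<open>edge_integral\<close>.\<close>

lemma edge_tri:
  assumes t: "triangle p q r K" and e: "closed_segment a b edge_of K"
  obtains c where "triangle a b c K"
proof -
  have "closed_segment a b = closed_segment p q \<or> closed_segment a b = closed_segment q r \<or> closed_segment a b = closed_segment r p"
    using triangle_edge[OF t] e by blast
  then have *: "{a, b} = {p, q} \<or> {a, b} = {q, r} \<or> {a, b} = {r, p}"
    unfolding closed_segment_eq .
  have "triangle p q r K" "triangle q r p K" "triangle r p q K" "triangle q p r K" "triangle r q p K" "triangle p r q K"
    using t triangle_rotate triangle_swap by blast+
  with * have "\<exists>c. triangle a b c K" unfolding doubleton_eq_iff by metis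
  then show ?thesis using that by blast
qed

text \<open>Strictly between \<open>p\<close> and \<open>q\<close> the other two barycentric
  coordinates are positive, so nearby membership is decided by the sign of the coordinate of
  \<open>r\<close> alone.\<close>

lemma triangle_near_edge:
  assumes t: "triangle p q r K" and s: "0 < s" "s < 1"
  obtains \<rho> where "\<rho> > 0"
    "\<And>y. y \<in> ball (linepath p q s) \<rho> \<Longrightarrow> y \<in> K \<longleftrightarrow> 0 \<le> sgn (rot (q - p) \<bullet> (r - p)) * (rot (q - p) \<bullet> (y - linepath p q s))"
    "\<And>y. y \<in> ball (linepath p q s) \<rho> \<Longrightarrow> y \<in> interior K \<longleftrightarrow> 0 < sgn (rot (q - p) \<bullet> (r - p)) * (rot (q - p) \<bullet> (y - linepath p q s))"
proof -
  let ?D = "rot (q - p) \<bullet> (r - p)" and ?x = "linepath p q s"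
  have D: "?D \<noteq> 0" and K: "K = convex hull {p, q, r}" using t by (auto simp: triangle_def)
  have x: "?x = p + 0 *\<^sub>R (r - p) + s *\<^sub>R (q - p)" by (simp add: linepath_def algebra_simps)
  have b: "bary q r p ?x = 1 - s" "bary r p q ?x = s" unfolding x bary_param[OF D] by auto
  have "open {y. 0 < bary q r p y \<and> 0 < bary r p q y}"
    by (intro open_Collect_conj open_Collect_less continuous_on_bary continuous_on_const)
  moreover have "?x \<in> {y. 0 < bary q r p y \<and> 0 < bary r p q y}" using b s by simp
  ultimately obtain \<rho> where \<rho>: "\<rho> > 0" "ball ?x \<rho> \<subseteq> {y. 0 < bary q r p y \<and> 0 < bary r p q y}"
    using open_contains_ball by blast
  have bry: "bary p q r y = (rot (q - p) \<bullet> (y - ?x)) / ?D" for y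
  proof -
    have "rot (q - p) \<bullet> (?x - p) = 0"
    proof -
      have "?x - p = s *\<^sub>R (q - p)" unfolding x by simp
      then show ?thesis by simp
    qed
    then show ?thesis by (simp add: bary_def inner_diff_right)
  qed
  have sg: "0 \<le> bary p q r y \<longleftrightarrow> 0 \<le> sgn ?D * (rot (q - p) \<bullet> (y - ?x))"
    "0 < bary p q r y \<longleftrightarrow> 0 < sgn ?D * (rot (q - p) \<bullet> (y - ?x))" for y
    unfolding bry using D by (auto simp: sgn_if zero_le_divide_iff zero_less_divide_iff)
  show ?thesis
  proof (rule that[OF \<rho>(1)])
    fix y assume "y \<in> ball ?x \<rho>"
    then have "0 < bary q r p y" "0 < bary r p q y" using \<rho>(2) by auto
    note b = this
    show "y \<in> K \<longleftrightarrow> 0 \<le> sgn ?D * (rot (q - p) \<bullet> (y - ?x))"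
      unfolding sg[symmetric] K triangle_eq[OF D] using b by auto
    show "y \<in> interior K \<longleftrightarrow> 0 < sgn ?D * (rot (q - p) \<bullet> (y - ?x))"
      unfolding sg[symmetric] K interior_triangle[OF D] using b by auto
  qed
qed

text \<open>The argument is in the uniqueness: for different unit vectors \<open>m\<close> and
  \<open>n\<close>, a step from \<open>x\<close> in direction \<open>m - n\<close> is inward with
  respect to \<open>n\<close> and outward with respect to \<open>m\<close>.\<close>

lemma outward_normal_eq:
  assumes "norm n = 1" "\<rho> > 0" "\<Omega> \<inter> ball x \<rho> = {y \<in> ball x \<rho>. (y - x) \<bullet> n < 0}"
  shows "outward_normal \<Omega> x = n"
  unfolding outward_normal_def
proof (rule the_equality)
  show "norm n = 1 \<and> (\<exists>r>0. \<Omega> \<inter> ball x r = {y \<in> ball x r. (y - x) \<bullet> n < 0})" using assms by blast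
  fix m assume m: "norm m = 1 \<and> (\<exists>r>0. \<Omega> \<inter> ball x r = {y \<in> ball x r. (y - x) \<bullet> m < 0})"
  then obtain r where r: "r > 0" "\<Omega> \<inter> ball x r = {y \<in> ball x r. (y - x) \<bullet> m < 0}" by auto
  show "m = n"
  proof (rule ccontr)
    assume ne: "m \<noteq> n"
    \<comment> \<open>Scaled so that \<open>y\<close> has distance \<open>min r \<rho> / 2\<close>
      from \<open>x\<close> and lies in both balls.\<close>
    define e where "e = min r \<rho> / (2 * norm (m - n))"
    have nz: "norm (m - n) > 0" using ne by simp
    have e: "e > 0" using nz r assms by (simp add: e_def)
    define y where "y = x + e *\<^sub>R (m - n)"
    have "dist x y = min r \<rho> / 2" using nz e r(1) assms(2) by (simp add: y_def dist_norm e_def)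
    then have yb: "y \<in> ball x r" "y \<in> ball x \<rho>" using r assms(2) by auto
    have mm: "m \<bullet> m = 1" "n \<bullet> n = 1" using m assms(1) by (simp_all add: dot_square_norm)
    have "(m - n) \<bullet> (m - n) > 0" using ne by simp
    then have mn: "m \<bullet> n < 1" using mm by (simp add: inner_diff inner_commute)
    have "(y - x) \<bullet> n < 0" "\<not> (y - x) \<bullet> m < 0"
      using e mn mm by (simp_all add: y_def inner_diff_left inner_diff_right mult_less_0_iff inner_commute not_less)
    then have "y \<in> \<Omega>" "y \<notin> \<Omega>" using assms(3) r(2) yb by blast+
    then show False by simp
  qed
qed

section \<open>The divergence theorem on a mesh\<close>

text \<open>Defined from the set and two points, without the third vertex, because the ends of an
  edge come from a choice. The sign makes \<open>side K p q *\<^sub>R rot (q - p)\<close> point out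
  of a triangle \<open>K\<close> with that edge.\<close>

definition side :: "(real^2) set \<Rightarrow> real^2 \<Rightarrow> real^2 \<Rightarrow> real" where
  "side K p q = (if K \<subseteq> {y. 0 \<le> rot (q - p) \<bullet> (y - p)} then - 1 else 1)"

lemma side_tri:
  assumes t: "triangle p q r K" shows "side K p q = - sgn (rot (q - p) \<bullet> (r - p))"
proof -
  let ?D = "rot (q - p) \<bullet> (r - p)"
  have D: "?D \<noteq> 0" and K: "K = convex hull {p, q, r}" using t by (auto simp: triangle_def)
  show ?thesis
  proof (cases "?D > 0")
    case True
    have "0 \<le> rot (q - p) \<bullet> (y - p)" if "y \<in> K" for y
      using that True unfolding K triangle_eq[OF D] by (auto simp: bary_def zero_le_divide_iff)
    then have "K \<subseteq> {y. 0 \<le> rot (q - p) \<bullet> (y - p)}" by blast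
    then show ?thesis using True by (simp add: side_def)
  next
    case False
    have "r \<in> K" unfolding K by (simp add: hull_inc)
    then have "\<not> K \<subseteq> {y. 0 \<le> rot (q - p) \<bullet> (y - p)}" using False D by auto
    then show ?thesis using False D by (simp add: side_def)
  qed
qed

lemma side_swap: "triangle p q r K \<Longrightarrow> side K q p = - side K p q"
  using side_tri[of p q r K] side_tri[OF triangle_swap, of p q r K]
  by (simp add: rot_inner sgn_minus[symmetric] algebra_simps)

lemma integral_linepath_reverse:
  assumes "continuous_on (closed_segment p q) f"
  shows "(LINT t|lebesgue_on {0..1}. f (linepath q p t)) = (LINT t|lebesgue_on {0..1}. f (linepath p q t) :: real)"
proof -
  have lb: "(LINT t|lebesgue_on {0..1}. h t) = (LINT t|lborel. indicator {0..1} t *\<^sub>R h t)"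
    if "continuous_on {0..1} h" for h :: "real \<Rightarrow> real"
  proof -
    have m: "(\<lambda>t. indicator {0..1} t *\<^sub>R h t) \<in> borel_measurable borel"
      using that by (intro borel_measurable_continuous_on_indicator) auto
    have "(LINT t|lebesgue_on {0..1}. h t) = (LINT t|lebesgue. indicator {0..1} t *\<^sub>R h t)"
      by (subst integral_restrict_space) auto
    also have "\<dots> = (LINT t|lborel. indicator {0..1} t *\<^sub>R h t)"
      by (rule integral_completion) (use m in simp)
    finally show ?thesis .
  qed
  have seg: "linepath a b t \<in> closed_segment a b" if "t \<in> {0..1}" for a b :: 'a and t
    using that by (metis linepath_in_path)
  have c1: "continuous_on {0..1} (\<lambda>t. f (linepath p q t))"
    using seg by (intro continuous_on_compose2[OF assms] continuous_on_linepath) auto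
  have c2: "continuous_on {0..1} (\<lambda>t. f (linepath q p t))"
    using seg[of _ q p] by (intro continuous_on_compose2[OF assms] continuous_on_linepath) (auto simp: closed_segment_commute)
  have "(LINT t|lborel. indicator {0..1} t *\<^sub>R f (linepath p q t))
     = (LINT t|lborel. indicator {0..1} (1 + - 1 * t) *\<^sub>R f (linepath p q (1 + - 1 * t)))"
    by (subst lborel_integral_real_affine[of "-1" _ 1]) simp_all
  also have "(\<lambda>t. indicator {0..1} (1 + - 1 * t) *\<^sub>R f (linepath p q (1 + - 1 * t)))
     = (\<lambda>t. indicator {0..1} t *\<^sub>R f (linepath q p t))"
    by (auto simp: fun_eq_iff indicator_def linepath_def add.commute)
  finally show ?thesis unfolding lb[OF c1] lb[OF c2] by simp
qed

text \<open>The choice hidden in \<open>edge_integral\<close>, named so that all triangles at an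
  edge share one pair of end points.\<close>

definition edge_ends :: "(real^2) set \<Rightarrow> (real^2) \<times> (real^2)" where
  "edge_ends E = (SOME (p, q). E = closed_segment p q)"

lemma edge_ends:
  assumes "edge_ends (closed_segment a b) = (p, q)" shows "closed_segment p q = closed_segment a b"
proof -
  have "case edge_ends (closed_segment a b) of (p, q) \<Rightarrow> closed_segment a b = closed_segment p q"
    unfolding edge_ends_def by (rule someI[of _ "(a, b)"]) simp
  then show ?thesis using assms by simp
qed

text \<open>The integral over \<open>E\<close> of \<open>f\<close> times component \<open>i\<close>
  of the outer unit normal of \<open>K\<close>. No normalization appears because
  \<open>rot (q - p)\<close> already contains the length of the edge.\<close>

definition flux :: "(real^2 \<Rightarrow> real) \<Rightarrow> 2 \<Rightarrow> (real^2) set \<Rightarrow> (real^2) set \<Rightarrow> real" where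
  "flux f i K E = (case edge_ends E of (p, q) \<Rightarrow>
     side K p q * rot (q - p) $ i * (LINT t|lebesgue_on {0..1}. f (linepath p q t)))"

lemma rot_minus: "rot (- v) = - rot v"
  by (simp add: vec_eq_iff forall_2)

text \<open>Reversing the edge changes the sign of both \<open>side\<close> and
  \<open>rot (q - p)\<close> and leaves the line integral unchanged, so the choice of end points
  does not matter.\<close>

lemma flux_segment:
  assumes t: "triangle p q r K" and f: "continuous_on K f"
  shows "flux f i K (closed_segment p q) = side K p q * rot (q - p) $ i * (LINT t|lebesgue_on {0..1}. f (linepath p q t))"
proof -
  obtain a b where ab: "edge_ends (closed_segment p q) = (a, b)" by fastforce
  then have "{a, b} = {p, q}" using edge_ends[OF ab] by (simp add: closed_segment_eq)
  then have "a = p \<and> b = q \<or> a = q \<and> b = p" by (auto simp: doubleton_eq_iff)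
  moreover have "closed_segment p q \<subseteq> K"
    using t triangle_edge[OF t] edge_of_imp_subset by blast
  then have c: "continuous_on (closed_segment p q) f" using f continuous_on_subset by blast
  moreover have "rot (p - q) $ i = - rot (q - p) $ i" using rot_minus[of "q - p"] by simp
  ultimately show ?thesis
    unfolding flux_def ab using side_swap[OF t] integral_linepath_reverse[OF c] by auto
qed

lemma triangle_flux:
  assumes t: "triangle p q r K" and f: "continuous_on K f" and g: "integrable (lebesgue_on K) g"
    and w: "is_weak_deriv (interior K) i f g"
  shows "(LINT x|lebesgue_on K. g x) = (\<Sum>E | E edge_of K. flux f i K E)"
proof -
  have D: "rot (q - p) \<bullet> (r - p) \<noteq> 0" and K: "K = convex hull {p, q, r}" using t by (auto simp: triangle_def)
  note t2 = triangle_rotate[OF t] note t3 = triangle_rotate[OF t2]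
  have D2: "rot (r - q) \<bullet> (p - q) = rot (q - p) \<bullet> (r - p)" "rot (p - r) \<bullet> (q - r) = rot (q - p) \<bullet> (r - p)"
    using rot_cycle[of r q p] rot_cycle[of p r q] by auto
  have "{E. E edge_of K} = {closed_segment p q, closed_segment q r, closed_segment r p}"
    using triangle_edge[OF t] by auto
  moreover have "closed_segment p q \<noteq> closed_segment q r" "closed_segment p q \<noteq> closed_segment r p"
    "closed_segment q r \<noteq> closed_segment r p"
    using triangle_distinct[OF t] unfolding closed_segment_eq by (auto simp: doubleton_eq_iff)
  ultimately have "(\<Sum>E | E edge_of K. flux f i K E) =
     flux f i K (closed_segment p q) + flux f i K (closed_segment q r) + flux f i K (closed_segment r p)"
    by simp
  also have "\<dots> = (LINT x|lebesgue_on K. g x)"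
    unfolding flux_segment[OF t f] flux_segment[OF t2 f] flux_segment[OF t3 f] side_tri[OF t] side_tri[OF t2] side_tri[OF t3]
      triangle_green[OF D K f g w] D2
    by (simp add: distrib_left mult.assoc)
  finally show ?thesis by simp
qed

section \<open>Interior and boundary edges of a mesh\<close>

locale mesh =
  fixes \<Omega> :: "(real^2) set" and \<T> :: "(real^2) set set"
  assumes poly: "polygonal_domain \<Omega>" and mesh: "mesh_of \<Omega> \<T>"
begin

lemma finite_mesh: "finite \<T>"
  and Union_mesh: "\<Union>\<T> = closure \<Omega>"
  and faces: "K \<in> \<T> \<Longrightarrow> K' \<in> \<T> \<Longrightarrow> K \<inter> K' face_of K"
  using mesh by (auto simp: mesh_of_def triangulation_def)

lemma mesh_tri: assumes "K \<in> \<T>" obtains p q r where "triangle p q r K"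
  using simplex_tri mesh assms unfolding mesh_of_def by metis

lemma mesh_subset: "K \<in> \<T> \<Longrightarrow> K \<subseteq> closure \<Omega>"
  using Union_mesh by auto

lemma interior_mesh_subset: "K \<in> \<T> \<Longrightarrow> interior K \<subseteq> \<Omega>"
  using interior_mono[OF mesh_subset] interior_closure_polygonal[OF poly] by metis

lemma open_domain: "open \<Omega>"
  using poly by (simp add: polygonal_domain_def)

lemma mesh_compact: assumes "K \<in> \<T>" shows "compact K"
proof -
  obtain p q r where "triangle p q r K" by (rule mesh_tri[OF assms])
  then show ?thesis by (simp add: triangle_def finite_imp_compact_convex_hull)
qed

lemma mesh_convex: assumes "K \<in> \<T>" shows "convex K"
proof -
  obtain p q r where "triangle p q r K" by (rule mesh_tri[OF assms])
  then show ?thesis by (simp add: triangle_def)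
qed

lemma mesh_sets [simp]: "K \<in> \<T> \<Longrightarrow> K \<in> sets lebesgue"
  using mesh_compact by (simp add: lmeasurable_compact fmeasurableD)

lemma compact_closure_domain: "compact (closure \<Omega>)"
  using Union_mesh compact_Union[OF finite_mesh] mesh_compact by simp

text \<open>The intersection is a face of each triangle, and a face that meets the relative interior
  is the whole triangle; this is applied in both directions.\<close>

lemma mesh_subset_of_interior_Int:
  assumes "K \<in> \<T>" "K' \<in> \<T>" "interior K \<inter> K' \<noteq> {}" shows "K = K'"
proof -
  have sub: "A \<subseteq> B" if "A \<in> \<T>" "B \<in> \<T>" "interior A \<inter> B \<noteq> {}" for A B
  proof -
    have "(A \<inter> B) \<inter> rel_interior A \<noteq> {}"
      using that(3) interior_subset_rel_interior[of A] interior_subset[of A] by blast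
    from subset_of_face_of[OF faces[OF that(1,2)] order_refl this] show ?thesis by blast
  qed
  have "K \<subseteq> K'" using sub assms by blast
  then have "interior K \<subseteq> interior K'" by (rule interior_mono)
  then have "interior K' \<inter> K \<noteq> {}" using assms(3) interior_subset by blast
  then show ?thesis using sub[OF assms(2,1)] \<open>K \<subseteq> K'\<close> by blast
qed

lemma AE_interior_mesh: "AE x in lebesgue_on (closure \<Omega>). \<exists>K\<in>\<T>. x \<in> interior K"
proof (rule AE_lebesgue_on_negligible[where N="\<Union>K\<in>\<T>. frontier K"])
  show "negligible (\<Union>K\<in>\<T>. frontier K)"
    using finite_mesh mesh_convex by (intro negligible_Union) (auto intro: negligible_convex_frontier)
  fix x assume x: "x \<in> closure \<Omega>" "x \<notin> (\<Union>K\<in>\<T>. frontier K)"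
  then obtain K where "K \<in> \<T>" "x \<in> K" using Union_mesh by auto
  then show "\<exists>K\<in>\<T>. x \<in> interior K" using x(2) closure_subset by (auto simp: frontier_def)
qed simp

lemma AE_closure_domain: "(AE x in lebesgue_on (closure \<Omega>). x \<in> \<Omega>)"
  using AE_interior_mesh by eventually_elim (use interior_mesh_subset in auto)

lemma integrable_on_mesh_subset:
  assumes "integrable (lebesgue_on S) h" "T \<subseteq> S" "T \<in> sets lebesgue" "S \<in> sets lebesgue"
  shows "integrable (lebesgue_on T) (h :: real^2 \<Rightarrow> real)"
proof -
  have "integrable lebesgue (\<lambda>x. indicator T x *\<^sub>R (indicator S x * h x))"
    using assms by (intro integrable_mult_indicator) (simp_all add: integrable_lebesgue_on_iff)
  moreover have "(\<lambda>x. indicator T x *\<^sub>R (indicator S x * h x)) = (\<lambda>x. indicator T x * h x)"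
    by (rule ext) (use assms(2) in \<open>auto simp: indicator_def\<close>)
  ultimately show ?thesis using assms by (simp add: integrable_lebesgue_on_iff)
qed

text \<open>Off the null set of all triangle boundaries a point lies in at most one triangle, so the
  indicator of the union is the sum of the indicators.\<close>

lemma integral_submesh:
  fixes h :: "real^2 \<Rightarrow> real"
  assumes S: "\<S> \<subseteq> \<T>" and h: "integrable (lebesgue_on (closure \<Omega>)) h"
  shows "(LINT x|lebesgue_on (\<Union>\<S>). h x) = (\<Sum>K\<in>\<S>. LINT x|lebesgue_on K. h x)"
proof -
  have fin: "finite \<S>" using S finite_mesh finite_subset by blast
  have sets: "K \<in> sets lebesgue" if "K \<in> \<S>" for K using that S by auto
  have US: "\<Union>\<S> \<in> sets lebesgue" using fin sets by (intro sets.finite_Union) auto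
  have I: "integrable lebesgue (\<lambda>x. indicator K x * h x)" if "K \<in> \<S>" for K
    using integrable_on_mesh_subset[OF h, of K] that S mesh_subset sets[OF that] by (auto simp: integrable_lebesgue_on_iff)
  have "(LINT x|lebesgue_on (\<Union>\<S>). h x) = (LINT x|lebesgue. indicator (\<Union>\<S>) x * h x)"
    using US by (subst integral_restrict_space) auto
  also have "\<dots> = (LINT x|lebesgue. (\<Sum>K\<in>\<S>. indicator K x * h x))"
  proof -
    have "negligible (\<Union>K\<in>\<T>. frontier K)"
      using finite_mesh mesh_convex by (intro negligible_Union) (auto intro: negligible_convex_frontier)
    then have "AE x in lebesgue. x \<notin> (\<Union>K\<in>\<T>. frontier K)" by (intro AE_not_in) (simp add: negligible_iff_null_sets)
    then have ae: "AE x in lebesgue. indicator (\<Union>\<S>) x * h x = (\<Sum>K\<in>\<S>. indicator K x * h x)"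
    proof eventually_elim
      fix x assume x: "x \<notin> (\<Union>K\<in>\<T>. frontier K)"
      show "indicator (\<Union>\<S>) x * h x = (\<Sum>K\<in>\<S>. indicator K x * h x)"
      proof (cases "x \<in> \<Union>\<S>")
        case True
        then obtain K where K: "K \<in> \<S>" "x \<in> K" by auto
        then have xi: "x \<in> interior K" using x S closure_subset by (auto simp: frontier_def)
        have "indicator K' x * h x = (if K' = K then h x else 0)" if "K' \<in> \<S>" for K'
          using mesh_subset_of_interior_Int[of K K'] that K(1) S xi interior_subset by (auto simp: indicator_def)
        then have "(\<Sum>K'\<in>\<S>. indicator K' x * h x) = (\<Sum>K'\<in>\<S>. if K' = K then h x else 0)"
          by (intro sum.cong) auto
        then show ?thesis using True K(1) fin by simp
      next
        case False
        then show ?thesis by (auto intro!: sum.neutral)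
      qed
    qed
    show ?thesis
      by (rule lebesgue_on_cong_AE(3)[of UNIV, unfolded lebesgue_on_UNIV_eq, OF _ ae]) simp
  qed
  also have "\<dots> = (\<Sum>K\<in>\<S>. LINT x|lebesgue. indicator K x * h x)"
    using I by (intro Bochner_Integration.integral_sum) auto
  also have "\<dots> = (\<Sum>K\<in>\<S>. LINT x|lebesgue_on K. h x)"
    using sets by (intro sum.cong refl) (subst integral_restrict_space; simp)
  finally show ?thesis .
qed

lemmas integral_mesh = integral_submesh[OF order_refl, unfolded Union_mesh]


text \<open>With both triangles on the same side, a point slightly off the midpoint of the edge
  along its normal would be interior to both.\<close>

lemma opposite_sides:
  assumes K: "K \<in> \<T>" "K' \<in> \<T>" "K \<noteq> K'" and t: "triangle p q r K" and t': "triangle p q r' K'"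
  shows "side K' p q = - side K p q"
proof (rule ccontr)
  assume "side K' p q \<noteq> - side K p q"
  then have same: "sgn (rot (q - p) \<bullet> (r' - p)) = sgn (rot (q - p) \<bullet> (r - p))"
    using t t' unfolding side_tri[OF t] side_tri[OF t'] by (auto simp: triangle_def sgn_if split: if_splits)
  have half: "0 < (1/2 :: real)" "(1/2 :: real) < 1" by auto
  let ?x = "linepath p q (1/2)" and ?s = "sgn (rot (q - p) \<bullet> (r - p))"
  obtain \<rho> where \<rho>: "\<rho> > 0"
    "\<And>y. y \<in> ball ?x \<rho> \<Longrightarrow> y \<in> interior K \<longleftrightarrow> 0 < ?s * (rot (q - p) \<bullet> (y - ?x))"
    by (rule triangle_near_edge[OF t half]) blast
  obtain \<rho>' where \<rho>': "\<rho>' > 0"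
    "\<And>y. y \<in> ball ?x \<rho>' \<Longrightarrow> y \<in> interior K' \<longleftrightarrow> 0 < ?s * (rot (q - p) \<bullet> (y - ?x))"
    by (rule triangle_near_edge[OF t' half]) (use same in auto)
  have nz: "norm (q - p) > 0" using triangle_distinct[OF t] by auto
  define e where "e = min \<rho> \<rho>' / (2 * norm (q - p))"
  have e: "e > 0" using nz \<rho>(1) \<rho>'(1) by (simp add: e_def)
  define y where "y = ?x + (e * ?s) *\<^sub>R rot (q - p)"
  have s1: "\<bar>?s\<bar> = 1" "?s * ?s = 1" using t by (auto simp: triangle_def sgn_if)
  have "dist ?x y = min \<rho> \<rho>' / 2" using nz e s1(1) \<rho>(1) \<rho>'(1) by (simp add: y_def dist_norm abs_mult e_def)
  then have yb: "y \<in> ball ?x \<rho>" "y \<in> ball ?x \<rho>'" using \<rho>(1) \<rho>'(1) by auto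
  have "?s * (rot (q - p) \<bullet> (y - ?x)) = e * (?s * ?s) * (norm (q - p))\<^sup>2"
    by (simp add: y_def dot_square_norm del: sgn_mult_self_eq)
  then have "0 < ?s * (rot (q - p) \<bullet> (y - ?x))" using s1(2) e nz by simp
  then have "y \<in> interior K" "y \<in> interior K'" using \<rho>(2)[OF yb(1)] \<rho>'(2)[OF yb(2)] by auto
  then show False using mesh_subset_of_interior_Int[OF K(1,2)] K(3) interior_subset by blast
qed

text \<open>The half discs on opposite sides fill a ball inside the closure of \<Omega>;
  \<open>interior_closure_polygonal\<close> turns this into membership in \<Omega>.\<close>

lemma shared_edge_interior:
  assumes K: "K \<in> \<T>" "K' \<in> \<T>" "K \<noteq> K'" and t: "triangle p q r K" and t': "triangle p q r' K'" and s: "0 < s" "s < 1"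
  shows "linepath p q s \<in> \<Omega>"
proof -
  let ?x = "linepath p q s" and ?s = "sgn (rot (q - p) \<bullet> (r - p))" and ?s' = "sgn (rot (q - p) \<bullet> (r' - p))"
  obtain \<rho> where \<rho>: "\<rho> > 0" "\<And>y. y \<in> ball ?x \<rho> \<Longrightarrow> y \<in> K \<longleftrightarrow> 0 \<le> ?s * (rot (q - p) \<bullet> (y - ?x))"
    by (rule triangle_near_edge[OF t s]) blast
  obtain \<rho>' where \<rho>': "\<rho>' > 0" "\<And>y. y \<in> ball ?x \<rho>' \<Longrightarrow> y \<in> K' \<longleftrightarrow> 0 \<le> ?s' * (rot (q - p) \<bullet> (y - ?x))"
    by (rule triangle_near_edge[OF t' s]) blast
  have opp: "?s' = - ?s" using opposite_sides[OF K t t'] unfolding side_tri[OF t] side_tri[OF t'] by simp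
  have "ball ?x (min \<rho> \<rho>') \<subseteq> closure \<Omega>"
  proof
    fix y assume "y \<in> ball ?x (min \<rho> \<rho>')"
    then have "y \<in> K \<or> y \<in> K'" using \<rho>(2)[of y] \<rho>'(2)[of y] unfolding opp by auto
    then show "y \<in> closure \<Omega>" using K mesh_subset by blast
  qed
  then have "?x \<in> interior (closure \<Omega>)"
    using \<rho>(1) \<rho>'(1) by (intro interiorI[of "ball ?x (min \<rho> \<rho>')"]) auto
  then show ?thesis using interior_closure_polygonal[OF poly] by simp
qed

text \<open>By the face-to-face condition no other triangle passes through a point strictly inside
  the edge, so near that point \<Omega> is the interior of \<open>K\<close>, which is half of a
  disc.\<close>

lemma unshared_edge:
  assumes K: "K \<in> \<T>" and t: "triangle p q r K" and s: "0 < s" "s < 1"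
    and un: "\<And>K'. K' \<in> \<T> \<Longrightarrow> closed_segment p q edge_of K' \<Longrightarrow> K' = K"
  obtains \<rho> where "\<rho> > 0" "\<Omega> \<inter> ball (linepath p q s) \<rho> = {y \<in> ball (linepath p q s) \<rho>. side K p q * (rot (q - p) \<bullet> (y - linepath p q s)) < 0}"
    "linepath p q s \<in> frontier \<Omega>"
proof -
  let ?x = "linepath p q s" and ?s = "sgn (rot (q - p) \<bullet> (r - p))"
  have pq: "p \<noteq> q" using triangle_distinct[OF t] by auto
  have xo: "?x \<in> open_segment p q" using s pq unfolding in_segment linepath_def by blast
  have E: "closed_segment p q edge_of K" using triangle_edge[OF t] by blast
  have xK: "?x \<in> K" using xo E edge_of_imp_subset open_closed_segment by blast
  have only: "K' = K" if K': "K' \<in> \<T>" "?x \<in> K'" for K'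
  proof -
    define F where "F = K \<inter> K'"
    have F: "F face_of K" "F face_of K'" using faces[OF K K'(1)] faces[OF K'(1) K] by (auto simp: F_def Int_commute)
    \<comment> \<open>The common face contains a relative interior point of the edge, hence the
      whole edge; its vertex set is then \<open>{p, q}\<close> or all of
      \<open>{p, q, r}\<close>.\<close>
    have "closed_segment p q \<subseteq> F"
    proof (rule subset_of_face_of[OF F(1) edge_of_imp_subset[OF E]])
      show "F \<inter> rel_interior (closed_segment p q) \<noteq> {}"
        using xo xK K' pq by (auto simp: F_def rel_interior_closed_segment)
    qed
    then have pqF: "p \<in> F" "q \<in> F" by auto
    obtain c where c: "c \<subseteq> {p, q, r}" "F = convex hull c"
      using F(1) face_of_convex_hull_affine_independent[OF triangle_independent[OF t]] t by (auto simp: triangle_def)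
    have "p \<in> c \<and> q \<in> c"
    proof -
      have "a \<in> c" if "a \<in> F" "a \<in> {p, q}" for a
      proof -
        have "a extreme_point_of K" using triangle_extreme[OF t] that(2) by auto
        then have "a extreme_point_of F" using that(1) F(1) extreme_point_of_face by blast
        then show ?thesis unfolding c(2) using extreme_point_of_convex_hull by blast
      qed
      then show ?thesis using pqF by blast
    qed
    then have "c = {p, q} \<or> c = {p, q, r}" using c(1) by blast
    then show "K' = K"
    proof
      assume "c = {p, q}"
      then have "F = closed_segment p q" using c(2) by (simp add: segment_convex_hull)
      then have "closed_segment p q edge_of K'" using F(2) E by (auto simp: edge_of_def)
      then show ?thesis using un K'(1) by blast
    next
      assume "c = {p, q, r}"
      then have "F = K" using c(2) t by (simp add: triangle_def)
      moreover obtain z where "z \<in> interior K"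
      proof -
        obtain \<rho> where "\<rho> > 0" "\<And>y. y \<in> ball ?x \<rho> \<Longrightarrow> y \<in> interior K \<longleftrightarrow> 0 < ?s * (rot (q - p) \<bullet> (y - ?x))"
          by (rule triangle_near_edge[OF t s]) blast
        have "interior K \<noteq> {}"
          using t aff_dim_affine_independent[OF triangle_independent[OF t]] triangle_distinct[OF t]
          by (auto simp: triangle_def aff_dim_convex_hull interior_rel_interior_gen rel_interior_eq_empty)
        then show ?thesis using that by blast
      qed
      ultimately have "interior K \<inter> K' \<noteq> {}" using interior_subset unfolding F_def by blast
      then show ?thesis using mesh_subset_of_interior_Int[OF K K'(1)] by simp
    qed
  qed
  obtain \<rho>1 where \<rho>1: "\<rho>1 > 0" "\<And>y. y \<in> ball ?x \<rho>1 \<Longrightarrow> y \<in> interior K \<longleftrightarrow> 0 < ?s * (rot (q - p) \<bullet> (y - ?x))"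
    by (rule triangle_near_edge[OF t s]) blast
  \<comment> \<open>Finitely many closed triangles that miss the point leave a ball around it
    free.\<close>
  have "closed (\<Union>(\<T> - {K}))" using finite_mesh mesh_compact by (intro closed_Union) (auto intro: compact_imp_closed)
  moreover have "?x \<notin> \<Union>(\<T> - {K})" using only by blast
  ultimately have "open (- \<Union>(\<T> - {K}))" "?x \<in> - \<Union>(\<T> - {K})" by auto
  then obtain \<rho>2 where \<rho>2: "\<rho>2 > 0" "ball ?x \<rho>2 \<subseteq> - \<Union>(\<T> - {K})"
    by (rule openE)
  let ?\<rho> = "min \<rho>1 \<rho>2"
  have sub: "\<Omega> \<inter> ball ?x ?\<rho> \<subseteq> K"
  proof
    fix y assume y: "y \<in> \<Omega> \<inter> ball ?x ?\<rho>"
    then obtain K' where "K' \<in> \<T>" "y \<in> K'" using Union_mesh closure_subset by blast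
    then show "y \<in> K" using y \<rho>2(2) by auto
  qed
  have "\<Omega> \<inter> ball ?x ?\<rho> \<subseteq> interior K"
    by (rule interior_maximal[OF sub]) (use open_domain in auto)
  then have eq: "y \<in> \<Omega> \<longleftrightarrow> 0 < ?s * (rot (q - p) \<bullet> (y - ?x))" if "y \<in> ball ?x ?\<rho>" for y
    using \<rho>1(2)[of y] that interior_mesh_subset[OF K] by auto
  show ?thesis
  proof (rule that)
    show "?\<rho> > 0" using \<rho>1(1) \<rho>2(1) by simp
    show "\<Omega> \<inter> ball ?x ?\<rho> = {y \<in> ball ?x ?\<rho>. side K p q * (rot (q - p) \<bullet> (y - ?x)) < 0}"
      unfolding side_tri[OF t] using eq by auto
    have "?x \<notin> \<Omega>" using eq[of ?x] \<rho>1(1) \<rho>2(1) by simp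
    then show "?x \<in> frontier \<Omega>" using xK mesh_subset[OF K] open_domain by (auto simp: frontier_def interior_open)
  qed
qed


lemma boundary_edge_unique:
  assumes K: "K \<in> \<T>" and t: "triangle p q r K" and E: "closed_segment p q \<in> boundary_edges \<Omega> \<T>"
    and K': "K' \<in> \<T>" "closed_segment p q edge_of K'"
  shows "K' = K"
proof (rule ccontr)
  assume ne: "K' \<noteq> K"
  obtain p' q' r' where "triangle p' q' r' K'" using K'(1) by (rule mesh_tri)
  from edge_tri[OF this K'(2)] obtain c where c: "triangle p q c K'" .
  have "linepath p q (1/2) \<in> \<Omega>"
    by (rule shared_edge_interior[OF K K'(1) ne[symmetric] t c]) auto
  moreover have "linepath p q (1/2) \<in> closed_segment p q" by (rule linepath_in_path) auto
  then have "linepath p q (1/2) \<in> frontier \<Omega>" using E by (auto simp: boundary_edges_def)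
  ultimately show False using open_domain by (auto simp: frontier_def interior_open)
qed

text \<open>\<open>unshared_edge\<close> puts every relative interior point on the frontier; the end
  points follow because the frontier is closed.\<close>

lemma unshared_boundary_edge:
  assumes K: "K \<in> \<T>" and t: "triangle p q r K"
    and un: "\<And>K'. K' \<in> \<T> \<Longrightarrow> closed_segment p q edge_of K' \<Longrightarrow> K' = K"
  shows "closed_segment p q \<in> boundary_edges \<Omega> \<T>"
proof -
  have pq: "p \<noteq> q" using triangle_distinct[OF t] by auto
  have "open_segment p q \<subseteq> frontier \<Omega>"
  proof
    fix x assume "x \<in> open_segment p q"
    then obtain s where s: "0 < s" "s < 1" "x = linepath p q s" by (auto simp: in_segment linepath_def)
    show "x \<in> frontier \<Omega>" unfolding s(3) by (rule unshared_edge[OF K t s(1,2) un]) simp_all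
  qed
  then have "closure (open_segment p q) \<subseteq> frontier \<Omega>" by (intro closure_minimal frontier_closed)
  then have "closed_segment p q \<subseteq> frontier \<Omega>" using pq by simp
  moreover have "closed_segment p q edge_of K" using triangle_edge[OF t] by blast
  ultimately show ?thesis using K by (auto simp: boundary_edges_def)
qed

lemma edge_endpoints:
  assumes K: "K \<in> \<T>" and E: "E edge_of K"
  obtains p q r where "edge_ends E = (p, q)" "E = closed_segment p q" "triangle p q r K"
proof -
  obtain a b c where abc: "triangle a b c K" using K by (rule mesh_tri)
  obtain u v where uv: "E = closed_segment u v" using triangle_edge[OF abc] E by blast
  obtain p q where pq: "edge_ends E = (p, q)" by fastforce
  then have Epq: "E = closed_segment p q" using edge_ends[of u v p q] uv by simp
  obtain r where "triangle p q r K" using edge_tri[OF abc, of p q] E Epq by blast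
  then show ?thesis using that pq Epq by blast
qed

text \<open>The half disc found in \<open>unshared_edge\<close> is what the description in
  \<open>outward_normal\<close> asks for, once the normal is divided by the length of the
  edge.\<close>

lemma outward_normal_edge:
  assumes K: "K \<in> \<T>" and t: "triangle p q r K" and E: "closed_segment p q \<in> boundary_edges \<Omega> \<T>" and s: "0 < s" "s < 1"
  shows "outward_normal \<Omega> (linepath p q s) = (side K p q / norm (q - p)) *\<^sub>R rot (q - p)"
proof -
  have nz: "norm (q - p) > 0" using triangle_distinct[OF t] by auto
  have s1: "\<bar>side K p q\<bar> = 1" by (auto simp: side_def)
  obtain \<rho> where \<rho>: "\<rho> > 0" "\<Omega> \<inter> ball (linepath p q s) \<rho> = {y \<in> ball (linepath p q s) \<rho>. side K p q * (rot (q - p) \<bullet> (y - linepath p q s)) < 0}"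
    by (rule unshared_edge[OF K t s]) (use boundary_edge_unique[OF K t E] in auto)
  show ?thesis
  proof (rule outward_normal_eq[OF _ \<rho>(1)])
    show "norm ((side K p q / norm (q - p)) *\<^sub>R rot (q - p)) = 1" using nz s1 by simp
    show "\<Omega> \<inter> ball (linepath p q s) \<rho> = {y \<in> ball (linepath p q s) \<rho>. (y - linepath p q s) \<bullet> ((side K p q / norm (q - p)) *\<^sub>R rot (q - p)) < 0}"
      unfolding \<rho>(2) using nz by (auto simp: inner_commute divide_less_0_iff)
  qed
qed

lemma finite_edges: "K \<in> \<T> \<Longrightarrow> finite {E. E edge_of K}"
  by (rule mesh_tri[of K]) (auto simp: triangle_edge)

lemma finite_all_edges: "finite (\<Union>K\<in>\<T>. {E. E edge_of K})"
  using finite_mesh finite_edges by blast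

lemma boundary_edges_subset: "boundary_edges \<Omega> \<T> \<subseteq> (\<Union>K\<in>\<T>. {E. E edge_of K})"
  by (auto simp: boundary_edges_def)

lemma edge_integral_eq:
  assumes "edge_ends E = (p, q)"
  shows "edge_integral E f = norm (q - p) * (LINT t|lebesgue_on {0..1}. f (linepath p q t))"
  using assms unfolding edge_integral_def edge_ends_def by simp

text \<open>At the end points of an edge, possibly corners, \<open>outward_normal\<close> may have
  no usable value; they form a null set.\<close>

lemma AE_unit_open: "AE t in lebesgue_on {0..1::real}. 0 < t \<and> t < 1"
  by (rule AE_lebesgue_on_negligible[where N="{0, 1}"]) (auto simp: less_le)

lemma flux_boundary:
  assumes K: "K \<in> \<T>" and E: "E edge_of K" "E \<in> boundary_edges \<Omega> \<T>" and f: "continuous_on K f"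
  shows "flux f i K E = edge_integral E (\<lambda>x. outward_normal \<Omega> x $ i * f x)"
proof -
  obtain p q r where e: "edge_ends E = (p, q)" "E = closed_segment p q" and t: "triangle p q r K"
    by (rule edge_endpoints[OF K E(1)])
  have nz: "norm (q - p) > 0" using triangle_distinct[OF t] by auto
  have "(LINT s|lebesgue_on {0..1}. outward_normal \<Omega> (linepath p q s) $ i * f (linepath p q s))
     = (LINT s|lebesgue_on {0..1}. (side K p q / norm (q - p) * rot (q - p) $ i) * f (linepath p q s))"
  proof (rule lebesgue_on_cong_AE(3))
    show "AE s in lebesgue_on {0..1}. outward_normal \<Omega> (linepath p q s) $ i * f (linepath p q s)
       = (side K p q / norm (q - p) * rot (q - p) $ i) * f (linepath p q s)"
      using AE_unit_open by eventually_elim (use outward_normal_edge[OF K t] E(2) e(2) in simp)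
  qed simp
  then show ?thesis
    unfolding edge_integral_eq[OF e(1)] using nz by (simp add: flux_def e(1))
qed

text \<open>Such an edge has exactly two triangles: at least two by
  \<open>unshared_boundary_edge\<close>, while a third would need a sign opposite to two opposite
  signs. The two fluxes differ only in the sign of \<open>side\<close>.\<close>

lemma flux_interior_cancel:
  assumes E: "E \<in> (\<Union>K\<in>\<T>. {E. E edge_of K})" "E \<notin> boundary_edges \<Omega> \<T>"
  shows "(\<Sum>K | K \<in> \<T> \<and> E edge_of K. flux f i K E) = 0"
proof -
  obtain K where K: "K \<in> \<T>" "E edge_of K" using E(1) by auto
  obtain p q r where e: "edge_ends E = (p, q)" "E = closed_segment p q" and t: "triangle p q r K"
    by (rule edge_endpoints[OF K])
  obtain K' where K': "K' \<in> \<T>" "E edge_of K'" "K' \<noteq> K"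
    using unshared_boundary_edge[OF K(1) t] E(2) e(2) by blast
  have T: "\<exists>r. triangle p q r L" if "L \<in> \<T>" "E edge_of L" for L
    using edge_endpoints[OF that] e(1) by (metis prod.inject)
  obtain r' where t': "triangle p q r' K'" using T K' by blast
  have opp: "side K' p q = - side K p q" using opposite_sides[OF K(1) K'(1) K'(3)[symmetric] t t'] .
  have "{K. K \<in> \<T> \<and> E edge_of K} = {K, K'}"
  proof -
    have "L = K \<or> L = K'" if L: "L \<in> \<T>" "E edge_of L" for L
    proof (rule ccontr)
      assume ne: "\<not> (L = K \<or> L = K')"
      obtain r2 where t2: "triangle p q r2 L" using T[OF L] by blast
      have "side L p q = - side K p q" "side L p q = - side K' p q"
        using opposite_sides[OF K(1) L(1) _ t t2] opposite_sides[OF K'(1) L(1) _ t' t2] ne by auto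
      then show False using opp by (auto simp: side_def split: if_splits)
    qed
    then show ?thesis using K K' by blast
  qed
  then show ?thesis using K'(3) opp by (simp add: flux_def e(1))
qed

text \<open>Summing \<open>triangle_flux\<close> and exchanging the sums groups the fluxes by edges.
  The weak derivative is required only inside each triangle; what links neighbours is that both see
  the same values of \<open>f\<close> on their common edge.\<close>

theorem mesh_green:
  assumes f: "continuous_on (closure \<Omega>) f" and g: "integrable (lebesgue_on (closure \<Omega>)) g"
    and w: "\<And>K. K \<in> \<T> \<Longrightarrow> is_weak_deriv (interior K) i f g"
  shows "(LINT x|lebesgue_on (closure \<Omega>). g x)
    = (\<Sum>E\<in>boundary_edges \<Omega> \<T>. edge_integral E (\<lambda>x. outward_normal \<Omega> x $ i * f x))"
proof -
  let ?A = "\<Union>K\<in>\<T>. {E. E edge_of K}"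
  have cK: "continuous_on K f" if "K \<in> \<T>" for K
    using continuous_on_subset[OF f mesh_subset[OF that]] .
  have "(LINT x|lebesgue_on (closure \<Omega>). g x) = (\<Sum>K\<in>\<T>. LINT x|lebesgue_on K. g x)"
    by (rule integral_mesh[OF g])
  also have "\<dots> = (\<Sum>K\<in>\<T>. \<Sum>E | E edge_of K. flux f i K E)"
  proof (rule sum.cong[OF refl])
    fix K assume K: "K \<in> \<T>"
    obtain p q r where t: "triangle p q r K" by (rule mesh_tri[OF K])
    show "(LINT x|lebesgue_on K. g x) = (\<Sum>E | E edge_of K. flux f i K E)"
      by (rule triangle_flux[OF t cK[OF K] integrable_on_mesh_subset[OF g mesh_subset[OF K]] w[OF K]])
         (use K in auto)
  qed
  also have "\<dots> = (\<Sum>K\<in>\<T>. \<Sum>E | E \<in> ?A \<and> E edge_of K. flux f i K E)"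
  proof (rule sum.cong[OF refl])
    fix K assume "K \<in> \<T>"
    then have "{E. E edge_of K} = {E. E \<in> ?A \<and> E edge_of K}" by blast
    then show "(\<Sum>E | E edge_of K. flux f i K E) = (\<Sum>E | E \<in> ?A \<and> E edge_of K. flux f i K E)" by (rule arg_cong)
  qed
  also have "\<dots> = (\<Sum>E\<in>?A. \<Sum>K | K \<in> \<T> \<and> E edge_of K. flux f i K E)"
    by (rule sum.swap_restrict[OF finite_mesh finite_all_edges])
  also have "\<dots> = (\<Sum>E\<in>boundary_edges \<Omega> \<T>. \<Sum>K | K \<in> \<T> \<and> E edge_of K. flux f i K E)"
  proof (rule sum.mono_neutral_right[OF finite_all_edges boundary_edges_subset])
    show "\<forall>E\<in>?A - boundary_edges \<Omega> \<T>. (\<Sum>K | K \<in> \<T> \<and> E edge_of K. flux f i K E) = 0"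
      by (intro ballI flux_interior_cancel) (elim DiffE; assumption)+
  qed
  also have "\<dots> = (\<Sum>E\<in>boundary_edges \<Omega> \<T>. edge_integral E (\<lambda>x. outward_normal \<Omega> x $ i * f x))"
  proof (rule sum.cong[OF refl])
    fix E assume E: "E \<in> boundary_edges \<Omega> \<T>"
    then obtain K where K: "K \<in> \<T>" "E edge_of K" by (auto simp: boundary_edges_def)
    obtain p q r where e: "E = closed_segment p q" and t: "triangle p q r K"
      by (rule edge_endpoints[OF K])
    have "{K'. K' \<in> \<T> \<and> E edge_of K'} = {K}"
    proof -
      have "K' = K" if "K' \<in> \<T>" "E edge_of K'" for K'
        using E that unfolding e by (intro boundary_edge_unique[OF K(1) t])
      then show ?thesis using K by blast
    qed
    then show "(\<Sum>K | K \<in> \<T> \<and> E edge_of K. flux f i K E) = edge_integral E (\<lambda>x. outward_normal \<Omega> x $ i * f x)"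
      using flux_boundary[OF K E cK[OF K(1)]] by simp
  qed
  finally show ?thesis .
qed

end

section \<open>Piecewise linear functions\<close>

text \<open>The choice is forced on a nondegenerate triangle, see
  \<open>pgrad_unique\<close>.\<close>

definition pgrad :: "(real^2) set \<Rightarrow> (real^2 \<Rightarrow> real) \<Rightarrow> real^2" where
  "pgrad K u = (SOME g. \<exists>c. \<forall>x\<in>K. u x = c + g \<bullet> x)"

lemma P1_on_pgrad:
  assumes "P1_on K u" obtains c where "\<And>x. x \<in> K \<Longrightarrow> u x = c + pgrad K u \<bullet> x"
proof -
  have "\<exists>g c. \<forall>x\<in>K. u x = c + g \<bullet> x" using assms unfolding P1_on_def by blast
  then have "\<exists>c. \<forall>x\<in>K. u x = c + pgrad K u \<bullet> x" unfolding pgrad_def by (rule someI_ex)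
  then show ?thesis using that by blast
qed

definition pw_grad :: "(real^2) set set \<Rightarrow> (real^2 \<Rightarrow> real) \<Rightarrow> real^2 \<Rightarrow> real^2" where
  "pw_grad \<T> u x = (\<Sum>K\<in>\<T>. indicator (interior K) x *\<^sub>R pgrad K u)"

context mesh
begin

lemma sum_interior_mesh:
  fixes c :: "(real^2) set \<Rightarrow> 'b::real_vector"
  assumes "x \<in> interior K" "K \<in> \<T>" shows "(\<Sum>K'\<in>\<T>. indicator (interior K') x *\<^sub>R c K') = c K"
proof -
  have "indicator (interior K') x *\<^sub>R c K' = (if K' = K then c K else 0)" if "K' \<in> \<T>" for K'
    using mesh_subset_of_interior_Int[OF assms(2) that] assms(1) interior_subset by (auto simp: indicator_def)
  then have "(\<Sum>K'\<in>\<T>. indicator (interior K') x *\<^sub>R c K') = (\<Sum>K'\<in>\<T>. if K' = K then c K else 0)"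
    by (intro sum.cong) auto
  then show ?thesis using assms(2) finite_mesh by simp
qed

lemma pw_grad_interior: "x \<in> interior K \<Longrightarrow> K \<in> \<T> \<Longrightarrow> pw_grad \<T> u x = pgrad K u"
  unfolding pw_grad_def by (rule sum_interior_mesh)

lemma h_fun_interior: "x \<in> interior K \<Longrightarrow> K \<in> \<T> \<Longrightarrow> h_fun \<T> x = diameter K"
  using sum_interior_mesh[of x K diameter] by (simp add: h_fun_def mult.commute)

definition pw_linear :: "(real^2 \<Rightarrow> real) \<Rightarrow> bool" where
  "pw_linear u \<longleftrightarrow> (\<forall>K\<in>\<T>. P1_on K u)"

text \<open>A single function that is affine on each closed triangle is consistent on shared edges,
  so pasting over the finite closed cover applies.\<close>

lemma pw_linear_continuous:
  assumes "pw_linear u" shows "continuous_on (closure \<Omega>) u"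
proof -
  have "continuous_on (\<Union>K\<in>\<T>. K) u"
  proof (rule continuous_on_closed_Union[OF finite_mesh])
    fix K assume K: "K \<in> \<T>"
    show "closed K" using mesh_compact[OF K] by (rule compact_imp_closed)
    obtain c where c: "\<And>x. x \<in> K \<Longrightarrow> u x = c + pgrad K u \<bullet> x"
      using assms K P1_on_pgrad unfolding pw_linear_def by blast
    have "continuous_on K (\<lambda>x. c + pgrad K u \<bullet> x)" by (intro continuous_intros)
    then show "continuous_on K u" using c by (simp cong: continuous_on_cong)
  qed
  then show ?thesis using Union_mesh by simp
qed

text \<open>On one triangle \<open>u\<close> coincides with an affine function, which is smooth, so
  the product rule with a smooth factor is available although \<open>f\<close> has only a weak
  derivative.\<close>

lemma pw_linear_weak_deriv_interior:
  assumes "pw_linear u" "K \<in> \<T>" "is_weak_deriv (interior K) i f g"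
  shows "is_weak_deriv (interior K) i (\<lambda>x. f x * u x) (\<lambda>x. g x * u x + f x * pw_grad \<T> u x $ i)"
proof -
  obtain c where c: "\<And>x. x \<in> K \<Longrightarrow> u x = c + pgrad K u \<bullet> x"
    using assms P1_on_pgrad unfolding pw_linear_def by blast
  have "is_weak_deriv (interior K) i (\<lambda>x. f x * (pgrad K u \<bullet> x + c))
      (\<lambda>x. g x * (pgrad K u \<bullet> x + c) + f x * partial i (\<lambda>x. pgrad K u \<bullet> x + c) x)"
    by (rule is_weak_deriv_mult[OF open_interior assms(3) smooth_affine])
  then show ?thesis
  proof (rule is_weak_deriv_cong)
    fix x assume x: "x \<in> interior K"
    then have "u x = pgrad K u \<bullet> x + c" using c interior_subset by (auto simp: add.commute)
    then show "f x * (pgrad K u \<bullet> x + c) = f x * u x"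
      "g x * (pgrad K u \<bullet> x + c) + f x * partial i (\<lambda>x. pgrad K u \<bullet> x + c) x = g x * u x + f x * pw_grad \<T> u x $ i"
      by (simp_all add: partial_affine pw_grad_interior[OF x assms(2)])
  qed
qed

lemma pw_linear_weak_deriv_self:
  assumes "pw_linear u" "K \<in> \<T>" shows "is_weak_deriv (interior K) i u (\<lambda>x. pw_grad \<T> u x $ i)"
  using pw_linear_weak_deriv_interior[OF assms is_weak_deriv_const[OF open_interior, of K i 1]] by simp

lemma AE_lebesgue_indicator: "AE x in lebesgue. indicator \<Omega> x = (indicator (closure \<Omega>) x :: real)"
proof -
  have "AE x in lebesgue. x \<in> closure \<Omega> \<longrightarrow> x \<in> \<Omega>"
    using AE_closure_domain by (simp add: AE_restrict_space_iff)
  then show ?thesis by eventually_elim (use closure_subset in \<open>auto simp: indicator_def\<close>)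
qed

lemma domain_sets [simp]: "\<Omega> \<in> sets lebesgue" "closure \<Omega> \<in> sets lebesgue"
  using open_domain by auto

text \<open>Almost every point of the closure is interior to a triangle and hence in \<Omega>.
  Integrals can therefore be taken over the compact closure, the union of the mesh.\<close>

lemma domain_closure:
  fixes f :: "real^2 \<Rightarrow> real"
  shows "f \<in> borel_measurable (lebesgue_on \<Omega>) \<longleftrightarrow> f \<in> borel_measurable (lebesgue_on (closure \<Omega>))"
    "integrable (lebesgue_on \<Omega>) f \<longleftrightarrow> integrable (lebesgue_on (closure \<Omega>)) f"
    "(LINT x|lebesgue_on \<Omega>. f x) = (LINT x|lebesgue_on (closure \<Omega>). f x)"
    "(AE x in lebesgue_on \<Omega>. P x) \<longleftrightarrow> (AE x in lebesgue_on (closure \<Omega>). P x)"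
proof -
  have ae: "AE x in lebesgue_on UNIV. indicator \<Omega> x * f x = indicator (closure \<Omega>) x * f x"
    using AE_lebesgue_indicator unfolding lebesgue_on_UNIV_eq by eventually_elim simp
  note cong = lebesgue_on_cong_AE[OF _ ae, unfolded lebesgue_on_UNIV_eq, simplified]
  show "f \<in> borel_measurable (lebesgue_on \<Omega>) \<longleftrightarrow> f \<in> borel_measurable (lebesgue_on (closure \<Omega>))"
    unfolding borel_measurable_lebesgue_on_iff[OF domain_sets(1)] borel_measurable_lebesgue_on_iff[OF domain_sets(2)]
    by (rule cong(1))
  show "integrable (lebesgue_on \<Omega>) f \<longleftrightarrow> integrable (lebesgue_on (closure \<Omega>)) f"
    unfolding integrable_lebesgue_on_iff[OF domain_sets(1)] integrable_lebesgue_on_iff[OF domain_sets(2)]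
    by (rule cong(2))
  show "(LINT x|lebesgue_on \<Omega>. f x) = (LINT x|lebesgue_on (closure \<Omega>). f x)"
    using cong(3) by (subst (1 2) integral_restrict_space) auto
  have "(AE x in lebesgue. x \<in> \<Omega> \<longrightarrow> P x) \<longleftrightarrow> (AE x in lebesgue. x \<in> closure \<Omega> \<longrightarrow> P x)"
  proof
    assume "AE x in lebesgue. x \<in> \<Omega> \<longrightarrow> P x"
    with AE_lebesgue_indicator show "AE x in lebesgue. x \<in> closure \<Omega> \<longrightarrow> P x"
      by eventually_elim (auto simp: indicator_def split: if_splits)
  next
    assume "AE x in lebesgue. x \<in> closure \<Omega> \<longrightarrow> P x"
    then show "AE x in lebesgue. x \<in> \<Omega> \<longrightarrow> P x"
      by eventually_elim (use closure_subset in auto)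
  qed
  then show "(AE x in lebesgue_on \<Omega>. P x) \<longleftrightarrow> (AE x in lebesgue_on (closure \<Omega>). P x)"
    by (simp add: AE_restrict_space_iff)
qed

lemma L2_inner_closure: "L2_inner \<Omega> f g = L2_inner (closure \<Omega>) f g"
  unfolding L2_inner_def by (rule domain_closure(3))

lemma weak_deriv_is:
  assumes "is_weak_deriv U i f g" shows "is_weak_deriv U i f (weak_deriv U i f)"
  unfolding weak_deriv_def by (rule someI[of "is_weak_deriv U i f", OF assms])

text \<open>On each open triangle the chosen weak derivative and the affine gradient are weak
  derivatives of the same function; finitely many null sets are discarded.\<close>

lemma AE_weak_grad:
  assumes "u \<in> Vh \<Omega> \<T>" shows "AE x in lebesgue_on (closure \<Omega>). weak_grad \<Omega> u x = pw_grad \<T> u x"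
proof -
  have H: "H1 \<Omega> u" and P: "pw_linear u" using assms by (auto simp: Vh_def pw_linear_def)
  have w: "is_weak_deriv \<Omega> i u (weak_deriv \<Omega> i u)" for i
    using H weak_deriv_is unfolding H1_def by blast
  define N where "N K i = {x \<in> interior K. weak_deriv \<Omega> i u x \<noteq> pw_grad \<T> u x $ i}" for K i
  have N: "negligible (N K i)" if "K \<in> \<T>" for K i
    unfolding N_def
    by (rule is_weak_deriv_unique[OF open_interior is_weak_deriv_subset[OF w interior_mesh_subset[OF that] open_interior open_domain]
          pw_linear_weak_deriv_self[OF P that]])
  have neg: "negligible (\<Union>K\<in>\<T>. \<Union>i. N K i)"
    using N finite_mesh by (intro negligible_Union) (auto intro!: negligible_Union)
  have "AE x in lebesgue_on (closure \<Omega>). x \<notin> (\<Union>K\<in>\<T>. \<Union>i. N K i)"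
    by (rule AE_lebesgue_on_negligible[OF _ neg]) auto
  with AE_interior_mesh show ?thesis
  proof eventually_elim
    fix x assume x: "\<exists>K\<in>\<T>. x \<in> interior K" "x \<notin> (\<Union>K\<in>\<T>. \<Union>i. N K i)"
    then show "weak_grad \<Omega> u x = pw_grad \<T> u x" by (auto simp: vec_eq_iff weak_grad_def N_def)
  qed
qed

lemma pw_grad_measurable: "(\<lambda>x. pw_grad \<T> u x $ i) \<in> borel_measurable borel"
  unfolding pw_grad_def by (simp add: sum_component) measurable

lemma pw_grad_bounded: obtains B where "\<And>x. norm (pw_grad \<T> u x) \<le> B"
proof
  fix x
  have "norm (indicator (interior K) x *\<^sub>R pgrad K u) \<le> norm (pgrad K u)" for K
    by (auto simp: indicator_def)
  then show "norm (pw_grad \<T> u x) \<le> (\<Sum>K\<in>\<T>. norm (pgrad K u))"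
    unfolding pw_grad_def by (intro order_trans[OF norm_sum] sum_mono)
qed

text \<open>A class closed under sums, products and squares in which integrability is automatic, the
  measure being finite. It contains the components of \<open>b\<close> and their weak derivatives,
  \<mu> and all piecewise gradients.\<close>

definition bdd_meas :: "(real^2 \<Rightarrow> real) \<Rightarrow> bool" where
  "bdd_meas f \<longleftrightarrow> f \<in> borel_measurable (lebesgue_on (closure \<Omega>)) \<and> (\<exists>B. AE x in lebesgue_on (closure \<Omega>). \<bar>f x\<bar> \<le> B)"

lemma finite_measure_domain: "finite_measure (lebesgue_on (closure \<Omega>))"
  by (intro finite_measure_lebesgue_on lmeasurable_compact compact_closure_domain)

lemma bdd_meas_integrable: assumes "bdd_meas f" shows "integrable (lebesgue_on (closure \<Omega>)) f"
proof -
  obtain B where "AE x in lebesgue_on (closure \<Omega>). \<bar>f x\<bar> \<le> B" using assms by (auto simp: bdd_meas_def)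
  then show ?thesis
    using assms by (intro finite_measure.integrable_const_bound[OF finite_measure_domain, of _ B]) (auto simp: bdd_meas_def)
qed

lemma bdd_meas_mult: assumes "bdd_meas f" "bdd_meas g" shows "bdd_meas (\<lambda>x. f x * g x)"
proof -
  obtain A B where A: "AE x in lebesgue_on (closure \<Omega>). \<bar>f x\<bar> \<le> A" and B: "AE x in lebesgue_on (closure \<Omega>). \<bar>g x\<bar> \<le> B"
    using assms by (auto simp: bdd_meas_def)
  have "AE x in lebesgue_on (closure \<Omega>). \<bar>f x * g x\<bar> \<le> \<bar>A\<bar> * \<bar>B\<bar>"
    using A B by eventually_elim (auto simp: abs_mult intro!: mult_mono)
  then show ?thesis using assms by (auto simp: bdd_meas_def)
qed

lemma bdd_meas_add: assumes "bdd_meas f" "bdd_meas g" shows "bdd_meas (\<lambda>x. f x + g x)"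
proof -
  obtain A B where A: "AE x in lebesgue_on (closure \<Omega>). \<bar>f x\<bar> \<le> A" and B: "AE x in lebesgue_on (closure \<Omega>). \<bar>g x\<bar> \<le> B"
    using assms by (auto simp: bdd_meas_def)
  have "AE x in lebesgue_on (closure \<Omega>). \<bar>f x + g x\<bar> \<le> A + B"
    using A B by eventually_elim auto
  then show ?thesis using assms by (auto simp: bdd_meas_def)
qed

lemma bdd_meas_const: "bdd_meas (\<lambda>_. c)"
  by (auto simp: bdd_meas_def)

lemma bdd_meas_sum: "(\<And>i. i \<in> I \<Longrightarrow> bdd_meas (f i)) \<Longrightarrow> bdd_meas (\<lambda>x. \<Sum>i\<in>I. f i x)"
  by (induction I rule: infinite_finite_induct) (auto intro: bdd_meas_const bdd_meas_add)

lemma bdd_meas_diff: "bdd_meas f \<Longrightarrow> bdd_meas g \<Longrightarrow> bdd_meas (\<lambda>x. f x - g x)"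
  using bdd_meas_add[of f "\<lambda>x. -1 * g x"] bdd_meas_mult[OF bdd_meas_const[of "-1"]] by simp

lemma bdd_meas_power2: "bdd_meas f \<Longrightarrow> bdd_meas (\<lambda>x. (f x)\<^sup>2)"
  unfolding power2_eq_square by (rule bdd_meas_mult)

lemma bdd_meas_continuous: assumes "continuous_on (closure \<Omega>) f" shows "bdd_meas f"
proof -
  have "bounded (f ` closure \<Omega>)" by (rule compact_imp_bounded[OF compact_continuous_image[OF assms compact_closure_domain]])
  then obtain B where "\<forall>y\<in>f ` closure \<Omega>. norm y \<le> B" unfolding bounded_iff by (rule exE)
  then have "AE x in lebesgue_on (closure \<Omega>). \<bar>f x\<bar> \<le> B" by (intro AE_I2) auto
  then show ?thesis using continuous_imp_measurable_on_sets_lebesgue[OF assms domain_sets(2)] by (auto simp: bdd_meas_def)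
qed

lemma bdd_meas_AE:
  assumes "bdd_meas f" "AE x in lebesgue_on (closure \<Omega>). f x = g x" shows "bdd_meas g"
proof -
  obtain B where "AE x in lebesgue_on (closure \<Omega>). \<bar>f x\<bar> \<le> B" using assms(1) by (auto simp: bdd_meas_def)
  with assms(2) have "AE x in lebesgue_on (closure \<Omega>). \<bar>g x\<bar> \<le> B" by eventually_elim simp
  then show ?thesis using assms(1) lebesgue_on_cong_AE(1)[OF domain_sets(2) assms(2)] by (auto simp: bdd_meas_def)
qed

lemma borel_measurable_lebesgue_onI:
  assumes "f \<in> borel_measurable borel" shows "f \<in> borel_measurable (lebesgue_on S)"
  using assms by (intro measurable_restrict_space1 measurable_completion) simp

lemma bdd_meas_pg: "bdd_meas (\<lambda>x. pw_grad \<T> u x $ i)"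
proof -
  obtain B where "\<And>x. norm (pw_grad \<T> u x) \<le> B" by (rule pw_grad_bounded) blast
  then have "\<bar>pw_grad \<T> u x $ i\<bar> \<le> B" for x using component_le_norm_cart[of "pw_grad \<T> u x" i] order_trans by blast
  then show ?thesis using borel_measurable_lebesgue_onI[OF pw_grad_measurable] by (auto simp: bdd_meas_def)
qed

lemma bdd_meas_indicator: "S \<in> sets lebesgue \<Longrightarrow> bdd_meas (indicator S)"
  unfolding bdd_meas_def by (auto intro!: exI[of _ 1] measurable_restrict_space1)

lemma bdd_meas_h_fun: "bdd_meas (h_fun \<T>)"
  unfolding h_fun_def by (intro bdd_meas_sum bdd_meas_mult bdd_meas_const bdd_meas_indicator) auto

lemma Linf_bm: "Linf \<Omega> f \<Longrightarrow> bdd_meas f"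
  unfolding Linf_def bdd_meas_def domain_closure .

lemma W1inf_bm:
  assumes "W1inf \<Omega> f" shows "bdd_meas (weak_deriv \<Omega> i f)" "is_weak_deriv \<Omega> i f (weak_deriv \<Omega> i f)"
proof -
  obtain g where g: "Linf \<Omega> g" "is_weak_deriv \<Omega> i f g" using assms by (auto simp: W1inf_def)
  show w: "is_weak_deriv \<Omega> i f (weak_deriv \<Omega> i f)" by (rule weak_deriv_is[OF g(2)])
  have "AE x in lebesgue_on \<Omega>. g x = weak_deriv \<Omega> i f x"
    by (rule AE_lebesgue_on_negligible[OF _ is_weak_deriv_unique[OF open_domain g(2) w]]) auto
  then show "bdd_meas (weak_deriv \<Omega> i f)" using bdd_meas_AE[OF Linf_bm[OF g(1)]] unfolding domain_closure by blast
qed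

text \<open>Membership requires weak derivatives on all of \<Omega>. \<open>mesh_green\<close> for
  \<open>\<phi> * w\<close> supplies them: the interior edges cancel there, and the boundary terms
  vanish because a test function is zero on the frontier.\<close>

lemma pw_linear_Vh:
  assumes P: "pw_linear w" and z: "\<And>x. x \<notin> closure \<Omega> \<Longrightarrow> w x = 0"
  shows "w \<in> Vh \<Omega> \<T>"
proof -
  note cont = pw_linear_continuous[OF P]
  have L2: "L2 \<Omega> f" if "bdd_meas f" for f
    using that bdd_meas_integrable[OF bdd_meas_power2[OF that]] unfolding L2_def domain_closure bdd_meas_def by blast
  have loc: "loc_integrable \<Omega> f" if f: "bdd_meas f" for f
    unfolding loc_integrable_def
  proof (intro allI impI)
    fix C assume C: "compact C \<and> C \<subseteq> \<Omega>"
    show "integrable (lebesgue_on C) f"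
      by (rule integrable_on_mesh_subset[OF bdd_meas_integrable[OF f]])
         (use C closure_subset in \<open>auto simp: lmeasurable_compact fmeasurableD\<close>)
  qed
  have "is_weak_deriv \<Omega> i w (\<lambda>x. pw_grad \<T> w x $ i)" for i
    unfolding is_weak_deriv_def
  proof (intro conjI allI impI)
    show "loc_integrable \<Omega> w" "loc_integrable \<Omega> (\<lambda>x. pw_grad \<T> w x $ i)"
      using loc bdd_meas_continuous[OF cont] bdd_meas_pg by blast+
    fix \<phi> assume t: "test_fun \<Omega> \<phi>"
    obtain C where C: "smooth \<phi>" "compact C" "C \<subseteq> \<Omega>" "supported_in C \<phi>" by (rule test_funE[OF t]) blast
    have bdd_meas\<phi>: "bdd_meas \<phi>" "bdd_meas (partial i \<phi>)" using smoothD(3,4)[OF C(1)] bdd_meas_continuous by blast+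
    have i1: "integrable (lebesgue_on (closure \<Omega>)) (\<lambda>x. partial i \<phi> x * w x)"
      "integrable (lebesgue_on (closure \<Omega>)) (\<lambda>x. \<phi> x * pw_grad \<T> w x $ i)"
      by (intro bdd_meas_integrable bdd_meas_mult bdd_meas\<phi> bdd_meas_continuous cont bdd_meas_pg)+
    have "(LINT x|lebesgue_on (closure \<Omega>). partial i \<phi> x * w x + \<phi> x * pw_grad \<T> w x $ i)
      = (\<Sum>E\<in>boundary_edges \<Omega> \<T>. edge_integral E (\<lambda>x. outward_normal \<Omega> x $ i * (\<phi> x * w x)))"
    proof (rule mesh_green)
      show "continuous_on (closure \<Omega>) (\<lambda>x. \<phi> x * w x)" by (intro continuous_on_mult cont smoothD(3)[OF C(1)])
      show "integrable (lebesgue_on (closure \<Omega>)) (\<lambda>x. partial i \<phi> x * w x + \<phi> x * pw_grad \<T> w x $ i)"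
        using i1 by (rule Bochner_Integration.integrable_add)
      show "is_weak_deriv (interior K) i (\<lambda>x. \<phi> x * w x) (\<lambda>x. partial i \<phi> x * w x + \<phi> x * pw_grad \<T> w x $ i)" if "K \<in> \<T>" for K
        by (rule pw_linear_weak_deriv_interior[OF P that is_weak_deriv_smooth[OF open_interior C(1)]])
    qed
    also have "\<dots> = 0"
    proof (rule sum.neutral, rule ballI)
      fix E assume E: "E \<in> boundary_edges \<Omega> \<T>"
      then obtain K where K: "K \<in> \<T>" "E edge_of K" by (auto simp: boundary_edges_def)
      obtain p q r where e: "edge_ends E = (p, q)" "E = closed_segment p q" by (rule edge_endpoints[OF K])
      have "\<phi> (linepath p q s) = 0" if "s \<in> {0..1}" for s
      proof -
        have "linepath p q s \<in> frontier \<Omega>" using that linepath_in_path[of s p q] E e(2) by (auto simp: boundary_edges_def)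
        then have "linepath p q s \<notin> \<Omega>" using open_domain by (auto simp: frontier_def interior_open)
        then show ?thesis using C by (auto simp: supported_in_def)
      qed
      then have "(LINT s|lebesgue_on {0..1}. outward_normal \<Omega> (linepath p q s) $ i * (\<phi> (linepath p q s) * w (linepath p q s)))
         = (LINT s|lebesgue_on {0..1::real}. 0)"
        by (intro Bochner_Integration.integral_cong) auto
      then show "edge_integral E (\<lambda>x. outward_normal \<Omega> x $ i * (\<phi> x * w x)) = 0"
        unfolding edge_integral_eq[OF e(1)] by simp
    qed
    finally show "L2_inner \<Omega> w (partial i \<phi>) = - L2_inner \<Omega> (\<lambda>x. pw_grad \<T> w x $ i) \<phi>"
      unfolding L2_inner_closure using Bochner_Integration.integral_add[OF i1] by (simp add: L2_inner_def mult.commute)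
  qed
  note wd = this
  have "H1 \<Omega> w"
    unfolding H1_def
  proof (intro conjI allI exI)
    show "L2 \<Omega> w" by (rule L2[OF bdd_meas_continuous[OF cont]])
    show "L2 \<Omega> (\<lambda>x. pw_grad \<T> w x $ i)" "is_weak_deriv \<Omega> i w (\<lambda>x. pw_grad \<T> w x $ i)" for i
      by (rule L2[OF bdd_meas_pg], rule wd)
  qed
  then show ?thesis using P z by (simp add: Vh_def pw_linear_def)
qed

end

section \<open>Nodal interpolation and inverse estimates\<close>

definition verts :: "(real^2) set \<Rightarrow> (real^2) set" where
  "verts K = {a. a extreme_point_of K}"

lemma verts_tri: "triangle p q r K \<Longrightarrow> verts K = {p, q, r}"
  using triangle_extreme unfolding verts_def by blast

lemma affine_interpolation:
  assumes t: "triangle p q r K" shows "\<exists>k g. \<forall>a\<in>verts K. k + g \<bullet> a = (c a :: real)"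
proof -
  have D: "rot (q - p) \<bullet> (r - p) \<noteq> 0" using t by (simp add: triangle_def)
  define G where "G p q r = rot (q - p) /\<^sub>R (rot (q - p) \<bullet> (r - p))" for p q r
  define k where "k p q r = - (rot (q - p) \<bullet> p) / (rot (q - p) \<bullet> (r - p))" for p q r
  have b: "bary p q r x = G p q r \<bullet> x + k p q r" for p q r x
    unfolding bary_affine G_def k_def ..
  let ?k = "c r * k p q r + c p * k q r p + c q * k r p q"
  let ?g = "c r *\<^sub>R G p q r + c p *\<^sub>R G q r p + c q *\<^sub>R G r p q"
  have e: "?k + ?g \<bullet> x = c r * bary p q r x + c p * bary q r p x + c q * bary r p q x" for x
    unfolding b by (simp add: inner_add_left algebra_simps)
  have "?k + ?g \<bullet> p = c p" "?k + ?g \<bullet> q = c q" "?k + ?g \<bullet> r = c r"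
    unfolding e using bary_param[OF D, of 0 0] bary_param[OF D, of 0 1] bary_param[OF D, of 1 0] by simp_all
  then have "\<forall>a\<in>verts K. ?k + ?g \<bullet> a = c a" unfolding verts_tri[OF t] by simp
  then show ?thesis by blast
qed

lemma ball_diameter_le:
  assumes "K \<noteq> {}" "\<And>r c. 0 \<le> r \<Longrightarrow> cball c r \<subseteq> K \<Longrightarrow> 2 * r \<le> X"
  shows "ball_diameter K \<le> X"
  unfolding ball_diameter_def
proof (rule cSup_least)
  obtain c where "cball c 0 \<subseteq> K" using assms(1) by auto
  then have "2 * 0 \<in> {2 * r |r c. 0 \<le> r \<and> cball c r \<subseteq> K}" by force
  then show "{2 * r |r c. 0 \<le> r \<and> cball c r \<subseteq> K} \<noteq> {}" by blast
qed (use assms(2) in blast)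

lemma ball_diameter_nonneg:
  assumes "K \<noteq> {}" "bounded K" shows "0 \<le> ball_diameter K"
  unfolding ball_diameter_def
proof (rule cSup_upper)
  obtain c where "cball c 0 \<subseteq> K" using assms(1) by auto
  then show "0 \<in> {2 * r |r c. 0 \<le> r \<and> cball c r \<subseteq> K}" by force
  show "bdd_above {2 * r |r c. 0 \<le> r \<and> cball c r \<subseteq> K}"
  proof (rule bdd_aboveI)
    fix x assume "x \<in> {2 * r |r c. 0 \<le> r \<and> cball c r \<subseteq> K}"
    then obtain r c where rc: "x = 2 * r" "0 \<le> r" "cball c r \<subseteq> K" by blast
    have "diameter (cball c r) \<le> diameter K" using rc(3) assms(2) by (rule diameter_subset)
    then show "x \<le> diameter K" using rc by (simp add: diameter_cball)
  qed
qed

text \<open>A disc of radius \<open>r\<close> in \<open>K\<close> has area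
  \<open>pi * r\<^sup>2\<close>, at most that of \<open>K\<close>. Shape regularity thereby bounds
  areas from below.\<close>

lemma ball_diameter_area:
  assumes "K \<noteq> {}" "compact K"
  shows "(ball_diameter K)\<^sup>2 \<le> 4 / pi * measure lebesgue K"
proof -
  have "ball_diameter K \<le> sqrt (4 / pi * measure lebesgue K)"
  proof (rule ball_diameter_le[OF assms(1)])
    fix r and c :: "real^2" assume rc: "0 \<le> r" "cball c r \<subseteq> K"
    have "measure lebesgue (cball c r) \<le> measure lebesgue K"
      using rc(2) assms(2) by (intro measure_mono_fmeasurable lmeasurable_compact) auto
    moreover have "measure lebesgue (cball c r) = pi * r\<^sup>2"
      using content_cball[OF rc(1), of c] by (simp add: unit_ball_vol_2)
    ultimately have "(2 * r)\<^sup>2 \<le> 4 / pi * measure lebesgue K"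
      by (simp add: field_simps power2_eq_square)
    then show "2 * r \<le> sqrt (4 / pi * measure lebesgue K)" by (rule real_le_rsqrt)
  qed
  then have "(ball_diameter K)\<^sup>2 \<le> (sqrt (4 / pi * measure lebesgue K))\<^sup>2"
    using ball_diameter_nonneg[OF assms(1) compact_imp_bounded[OF assms(2)]] by (rule power_mono)
  then show ?thesis by simp
qed

text \<open>The values at the ends of a diameter, parallel to \<open>g\<close>, of an inscribed disc
  differ by \<open>2 * r * norm g\<close> and by at most \<open>2 * M\<close>. This is the core of
  the inverse inequality.\<close>

lemma gradient_ball_diameter:
  assumes "K \<noteq> {}" "\<And>x. x \<in> K \<Longrightarrow> u x = k + g \<bullet> x" "\<And>x. x \<in> K \<Longrightarrow> \<bar>u x\<bar> \<le> M"
  shows "norm g * ball_diameter K \<le> 2 * M"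
proof (cases "g = 0")
  case True
  obtain x where "x \<in> K" using assms(1) by auto
  then have "0 \<le> M" using assms(3)[of x] by linarith
  then show ?thesis using True by simp
next
  case False
  have "ball_diameter K \<le> 2 * M / norm g"
  proof (rule ball_diameter_le[OF assms(1)])
    fix r c assume rc: "0 \<le> r" "cball c r \<subseteq> K"
    let ?d = "(r / norm g) *\<^sub>R g"
    have "c + ?d \<in> cball c r" "c - ?d \<in> cball c r" using False rc(1) by (auto simp: dist_norm)
    then have "c + ?d \<in> K" "c - ?d \<in> K" using rc(2) by auto
    then have "u (c + ?d) - u (c - ?d) \<le> 2 * M" "u (c + ?d) - u (c - ?d) = 2 * (g \<bullet> ?d)"
      using assms(3)[of "c + ?d"] assms(3)[of "c - ?d"] assms(2) by (auto simp: inner_simps)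
    moreover have "g \<bullet> ?d = r * norm g" using False by (simp add: power2_norm_eq_inner[symmetric] power2_eq_square)
    ultimately have "r * norm g \<le> M" by linarith
    then show "2 * r \<le> 2 * M / norm g" using False by (simp add: pos_le_divide_eq)
  qed
  then show ?thesis using False by (simp add: field_simps)
qed

context mesh
begin

lemma verts_mesh:
  assumes "K \<in> \<T>" shows "card (verts K) = 3" "K = convex hull (verts K)" "finite (verts K)" "K \<noteq> {}" "0 < diameter K"
proof -
  obtain p q r where t: "triangle p q r K" by (rule mesh_tri[OF assms])
  show "card (verts K) = 3" using triangle_distinct[OF t] by (simp add: verts_tri[OF t])
  show 1: "K = convex hull (verts K)" "finite (verts K)" unfolding verts_tri[OF t] using t by (auto simp: triangle_def)
  have pq: "p \<in> K" "q \<in> K" using 1 by (auto simp: verts_tri[OF t] hull_inc)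
  then show "K \<noteq> {}" by auto
  have "dist p q \<le> diameter K"
    using diameter_bounded_bound[OF compact_imp_bounded[OF mesh_compact[OF assms]] pq] .
  then show "0 < diameter K" using triangle_distinct[OF t] zero_less_dist_iff[of p q] by linarith
qed

lemma verts_subset: "K \<in> \<T> \<Longrightarrow> verts K \<subseteq> K"
  using verts_mesh(2) hull_subset by metis

lemma mesh_vertices: "vertices \<T> = (\<Union>K\<in>\<T>. verts K)"
  by (auto simp: vertices_def verts_def)

lemma finite_vertices: "finite (vertices \<T>)"
  unfolding mesh_vertices using finite_mesh verts_mesh(3) by blast

lemma interpolant:
  obtains w where "pw_linear w" "\<And>x. x \<notin> closure \<Omega> \<Longrightarrow> w x = 0" "\<And>K a. K \<in> \<T> \<Longrightarrow> a \<in> verts K \<Longrightarrow> w a = c a"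
proof -
  have "\<forall>K\<in>\<T>. \<exists>k g. \<forall>a\<in>verts K. k + g \<bullet> a = c a"
    using mesh_tri affine_interpolation by metis
  then obtain k g where kg: "\<And>K a. K \<in> \<T> \<Longrightarrow> a \<in> verts K \<Longrightarrow> k K + g K \<bullet> a = c a" by metis
  \<comment> \<open>A common face is the hull of vertices of both triangles; two affine functions
    that agree at these agree on the hull, because their coincidence set is convex.\<close>
  have agree: "k K + g K \<bullet> x = k K' + g K' \<bullet> x" if K: "K \<in> \<T>" "K' \<in> \<T>" "x \<in> K" "x \<in> K'" for K K' x
  proof -
    obtain p q r where t: "triangle p q r K" by (rule mesh_tri[OF K(1)])
    have F: "K \<inter> K' face_of K" "K \<inter> K' face_of K'" using faces[OF K(1,2)] faces[OF K(2,1)] by (auto simp: Int_commute)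
    obtain V where V: "V \<subseteq> {p, q, r}" "K \<inter> K' = convex hull V"
      using F(1) face_of_convex_hull_affine_independent[OF triangle_independent[OF t]] t by (auto simp: triangle_def)
    have "k K + g K \<bullet> a = k K' + g K' \<bullet> a" if "a \<in> V" for a
    proof -
      have aK: "a \<in> verts K" using V(1) that verts_tri[OF t] by auto
      have aF: "a \<in> K \<inter> K'" unfolding V(2) using that by (rule hull_inc)
      have "a extreme_point_of (K \<inter> K')"
        using extreme_point_of_face[OF F(1)] aK aF by (auto simp: verts_def)
      then have "a \<in> verts K'" using extreme_point_of_face[OF F(2)] by (auto simp: verts_def)
      then show ?thesis using kg K aK by simp
    qed
    then have "V \<subseteq> {x. k K + g K \<bullet> x = k K' + g K' \<bullet> x}" by auto
    moreover have "{x. k K + g K \<bullet> x = k K' + g K' \<bullet> x} = {x. (g K - g K') \<bullet> x = k K' - k K}"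
      by (auto simp: inner_diff_left)
    then have "convex {x. k K + g K \<bullet> x = k K' + g K' \<bullet> x}" by (simp add: convex_hyperplane)
    ultimately have "convex hull V \<subseteq> {x. k K + g K \<bullet> x = k K' + g K' \<bullet> x}" by (rule hull_minimal)
    then show ?thesis using K(3,4) V(2) by auto
  qed
  \<comment> \<open>Triangles overlap on edges; by \<open>agree\<close> the arbitrary choice among
    them does not affect the value.\<close>
  define w where "w x = (if x \<in> closure \<Omega> then (let K = SOME K. K \<in> \<T> \<and> x \<in> K in k K + g K \<bullet> x) else 0)" for x
  have w: "w x = k K + g K \<bullet> x" if "K \<in> \<T>" "x \<in> K" for K x
  proof -
    define K0 where "K0 = (SOME K. K \<in> \<T> \<and> x \<in> K)"
    have K0: "K0 \<in> \<T> \<and> x \<in> K0"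
      unfolding K0_def using that by (intro someI[of "\<lambda>K. K \<in> \<T> \<and> x \<in> K"]) auto
    have "x \<in> closure \<Omega>" using that mesh_subset by auto
    then have "w x = k K0 + g K0 \<bullet> x" by (simp add: w_def K0_def Let_def)
    also have "\<dots> = k K + g K \<bullet> x" by (rule agree) (use K0 that in auto)
    finally show ?thesis .
  qed
  show ?thesis
  proof (rule that)
    show "pw_linear w" unfolding pw_linear_def P1_on_def using w by blast
    show "w x = 0" if "x \<notin> closure \<Omega>" for x using that by (simp add: w_def)
    show "w a = c a" if "K \<in> \<T>" "a \<in> verts K" for K a
      using w[OF that(1)] verts_subset[OF that(1)] that kg by auto
  qed
qed

text \<open>Convex weights that represent the point also represent the value of an affine function;
  such weights return in \<open>streamline_bound\<close>.\<close>

lemma pw_linear_convex_combination: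
  assumes "pw_linear w" "K \<in> \<T>" "x \<in> K"
  obtains l where "\<And>a. a \<in> verts K \<Longrightarrow> 0 \<le> l a" "sum l (verts K) = 1" "w x = (\<Sum>a\<in>verts K. l a * w a)"
proof -
  obtain k where k: "\<And>x. x \<in> K \<Longrightarrow> w x = k + pgrad K w \<bullet> x"
    using assms(1,2) P1_on_pgrad unfolding pw_linear_def by blast
  have "x \<in> convex hull (verts K)" using verts_mesh(2)[OF assms(2)] assms(3) by simp
  then obtain l where l: "\<forall>a\<in>verts K. 0 \<le> l a" "sum l (verts K) = 1" "(\<Sum>a\<in>verts K. l a *\<^sub>R a) = x"
    unfolding convex_hull_finite[OF verts_mesh(3)[OF assms(2)]] by blast
  have "w x = k * sum l (verts K) + pgrad K w \<bullet> (\<Sum>a\<in>verts K. l a *\<^sub>R a)" using k[OF assms(3)] l by simp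
  also have "\<dots> = (\<Sum>a\<in>verts K. l a * (k + pgrad K w \<bullet> a))"
    by (simp add: inner_sum_right sum_distrib_left sum.distrib[symmetric] algebra_simps)
  also have "\<dots> = (\<Sum>a\<in>verts K. l a * w a)"
    using k verts_subset[OF assms(2)] by (intro sum.cong) auto
  finally show ?thesis using that l by blast
qed

lemma pw_linear_abs_bound:
  assumes "pw_linear w" "K \<in> \<T>" "x \<in> K" shows "\<bar>w x\<bar> \<le> sqrt (\<Sum>a\<in>verts K. (w a)\<^sup>2)"
proof -
  let ?S = "\<Sum>a\<in>verts K. (w a)\<^sup>2"
  obtain l where l: "\<And>a. a \<in> verts K \<Longrightarrow> 0 \<le> l a" "sum l (verts K) = 1" "w x = (\<Sum>a\<in>verts K. l a * w a)"
    by (rule pw_linear_convex_combination[OF assms]) blast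
  have "\<bar>w a\<bar> \<le> sqrt ?S" if "a \<in> verts K" for a
    using member_le_sum[of a "verts K" "\<lambda>a. (w a)\<^sup>2"] that verts_mesh(3)[OF assms(2)] by (intro real_le_rsqrt) simp
  then have "(\<Sum>a\<in>verts K. \<bar>l a * w a\<bar>) \<le> (\<Sum>a\<in>verts K. l a * sqrt ?S)"
    using l(1) by (intro sum_mono) (auto simp: abs_mult intro!: mult_left_mono)
  also have "\<dots> = sqrt ?S" using l(2) by (simp add: sum_distrib_right[symmetric])
  finally show ?thesis unfolding l(3) using sum_abs[of "\<lambda>a. l a * w a" "verts K"] by linarith
qed

lemma pw_linear_square_bound:
  assumes "pw_linear w" "K \<in> \<T>" "x \<in> K" shows "(w x)\<^sup>2 \<le> (\<Sum>a\<in>verts K. (w a)\<^sup>2)"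
proof -
  have "\<bar>w x\<bar>\<^sup>2 \<le> (sqrt (\<Sum>a\<in>verts K. (w a)\<^sup>2))\<^sup>2" by (intro power_mono pw_linear_abs_bound[OF assms]) simp
  then show ?thesis by (simp add: sum_nonneg)
qed

end

section \<open>Mesh regularity with explicit constants\<close>

locale shape_mesh = mesh +
  fixes \<sigma> \<zeta> :: real
  assumes \<sigma>: "\<sigma> > 0" "\<And>K. K \<in> \<T> \<Longrightarrow> diameter K \<le> \<sigma> * ball_diameter K"
    and \<zeta>: "\<zeta> \<ge> 1" "\<And>a K. a \<in> vertices \<T> \<Longrightarrow> K \<in> star \<T> a \<Longrightarrow> 1 / \<zeta> \<le> h_vertex \<T> a / diameter K \<and> h_vertex \<T> a / diameter K \<le> \<zeta>"
begin

lemma diameter_area: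
  assumes "K \<in> \<T>" shows "(diameter K)\<^sup>2 \<le> 4 * \<sigma>\<^sup>2 / pi * measure lebesgue K"
proof -
  note ne = verts_mesh(4)[OF assms] note c = mesh_compact[OF assms]
  have "(diameter K)\<^sup>2 \<le> (\<sigma> * ball_diameter K)\<^sup>2"
    using \<sigma>(2)[OF assms] verts_mesh(5)[OF assms] by (intro power_mono) auto
  also have "\<dots> \<le> \<sigma>\<^sup>2 * (4 / pi * measure lebesgue K)"
    unfolding power_mult_distrib by (intro mult_left_mono ball_diameter_area ne c) simp
  finally show ?thesis by (simp add: mult_ac)
qed

text \<open>\<open>gradient_ball_diameter\<close> with \<open>M\<close> bounded by the nodal values,
  after shape regularity has replaced the inscribed diameter by the diameter. The 4 is the square of
  the 2 there.\<close>

lemma pgrad_bound: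
  assumes w: "pw_linear w" and K: "K \<in> \<T>"
  shows "(diameter K)\<^sup>2 * (norm (pgrad K w))\<^sup>2 \<le> 4 * \<sigma>\<^sup>2 * (\<Sum>a\<in>verts K. (w a)\<^sup>2)"
proof -
  let ?S = "\<Sum>a\<in>verts K. (w a)\<^sup>2"
  obtain k where k: "\<And>x. x \<in> K \<Longrightarrow> w x = k + pgrad K w \<bullet> x"
    using w K P1_on_pgrad unfolding pw_linear_def by blast
  have "norm (pgrad K w) * ball_diameter K \<le> 2 * sqrt ?S"
    by (rule gradient_ball_diameter[OF verts_mesh(4)[OF K] k pw_linear_abs_bound[OF w K]])
  then have "\<sigma> * (norm (pgrad K w) * ball_diameter K) \<le> \<sigma> * (2 * sqrt ?S)"
    using \<sigma>(1) by (intro mult_left_mono) auto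
  moreover have "diameter K * norm (pgrad K w) \<le> (\<sigma> * ball_diameter K) * norm (pgrad K w)"
    by (intro mult_right_mono \<sigma>(2) K) simp
  ultimately have "diameter K * norm (pgrad K w) \<le> \<sigma> * (2 * sqrt ?S)" by (simp add: mult_ac)
  then have "(diameter K * norm (pgrad K w))\<^sup>2 \<le> (\<sigma> * (2 * sqrt ?S))\<^sup>2"
    using verts_mesh(5)[OF K] by (intro power_mono) auto
  then show ?thesis by (simp add: power_mult_distrib sum_nonneg mult_ac)
qed

lemma star_iff: "K \<in> star \<T> a \<longleftrightarrow> K \<in> \<T> \<and> a \<in> verts K"
  by (auto simp: star_def verts_def)

lemma h_vertex_bounds:
  assumes "K \<in> \<T>" "a \<in> verts K"
  shows "diameter K \<le> \<zeta> * h_vertex \<T> a" "h_vertex \<T> a \<le> \<zeta> * diameter K" "0 < h_vertex \<T> a"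
proof -
  have d: "0 < diameter K" by (rule verts_mesh(5)[OF assms(1)])
  have "1 / \<zeta> \<le> h_vertex \<T> a / diameter K" "h_vertex \<T> a / diameter K \<le> \<zeta>"
    using \<zeta>(2)[of a K] assms by (auto simp: mesh_vertices star_iff)
  then show 1: "diameter K \<le> \<zeta> * h_vertex \<T> a" "h_vertex \<T> a \<le> \<zeta> * diameter K"
    using d \<zeta>(1) by (auto simp: field_simps)
  then have "0 < \<zeta> * h_vertex \<T> a" using d by linarith
  then show "0 < h_vertex \<T> a" using \<zeta>(1) by (simp add: zero_less_mult_iff)
qed

end

section \<open>The discrete problem\<close>

context mesh
begin

text \<open>The difference of two candidates is orthogonal to the independent vectors
  \<open>q - p\<close> and \<open>r - p\<close>, and the nonzero determinant makes it 0 as in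
  Cramer's rule.\<close>

lemma pgrad_unique:
  assumes K: "K \<in> \<T>" and g: "\<And>x. x \<in> K \<Longrightarrow> u x = c + g \<bullet> x"
  shows "pgrad K u = g"
proof -
  obtain p q r where t: "triangle p q r K" by (rule mesh_tri[OF K])
  have "P1_on K u" unfolding P1_on_def using g by blast
  then obtain k where k: "\<And>x. x \<in> K \<Longrightarrow> u x = k + pgrad K u \<bullet> x" by (rule P1_on_pgrad) blast
  have pqr: "p \<in> K" "q \<in> K" "r \<in> K" using t by (auto simp: triangle_def hull_inc)
  define h where "h = pgrad K u - g"
  have "h \<bullet> (q - p) = 0" "h \<bullet> (r - p) = 0"
    using g[OF pqr(1)] g[OF pqr(2)] g[OF pqr(3)] k[OF pqr(1)] k[OF pqr(2)] k[OF pqr(3)]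
    unfolding h_def inner_diff_left inner_diff_right by linarith+
  then have e: "h $ 1 * (q - p) $ 1 + h $ 2 * (q - p) $ 2 = 0" "h $ 1 * (r - p) $ 1 + h $ 2 * (r - p) $ 2 = 0"
    by (simp_all add: inner_vec_def sum_2)
  define D where "D = rot (q - p) \<bullet> (r - p)"
  have D: "D \<noteq> 0" "D = (q - p) $ 1 * (r - p) $ 2 - (q - p) $ 2 * (r - p) $ 1"
    using t by (auto simp: D_def triangle_def rot_inner)
  have "h $ 1 * D = 0" "h $ 2 * D = 0" unfolding D(2) using e by algebra+
  then have "h = 0" using D(1) by (simp add: vec_eq_iff forall_2)
  then show ?thesis by (simp add: h_def)
qed

lemma pgrad_linear:
  assumes "pw_linear u" "pw_linear w" "K \<in> \<T>"
  shows "pgrad K (\<lambda>x. u x + s * w x) = pgrad K u + s *\<^sub>R pgrad K w" "P1_on K (\<lambda>x. u x + s * w x)"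
proof -
  obtain k where k: "\<And>x. x \<in> K \<Longrightarrow> u x = k + pgrad K u \<bullet> x" using assms P1_on_pgrad unfolding pw_linear_def by blast
  obtain l where l: "\<And>x. x \<in> K \<Longrightarrow> w x = l + pgrad K w \<bullet> x" using assms P1_on_pgrad unfolding pw_linear_def by blast
  have *: "u x + s * w x = (k + s * l) + (pgrad K u + s *\<^sub>R pgrad K w) \<bullet> x" if "x \<in> K" for x
    using k[OF that] l[OF that] by (simp add: inner_add_left algebra_simps)
  show "pgrad K (\<lambda>x. u x + s * w x) = pgrad K u + s *\<^sub>R pgrad K w" by (rule pgrad_unique[OF assms(3) *])
  show "P1_on K (\<lambda>x. u x + s * w x)" unfolding P1_on_def using * by blast
qed

lemma pw_grad_linear:
  assumes "pw_linear u" "pw_linear w" shows "pw_grad \<T> (\<lambda>x. u x + s * w x) y = pw_grad \<T> u y + s *\<^sub>R pw_grad \<T> w y"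
  unfolding pw_grad_def by (simp add: pgrad_linear[OF assms] scaleR_add_right sum.distrib scaleR_sum_right mult.commute)

lemma pw_linear_linear: "pw_linear u \<Longrightarrow> pw_linear w \<Longrightarrow> pw_linear (\<lambda>x. u x + s * w x)"
  using pgrad_linear(2) unfolding pw_linear_def by blast

lemma Vh_PL: "u \<in> Vh \<Omega> \<T> \<Longrightarrow> pw_linear u" and Vh_outside: "u \<in> Vh \<Omega> \<T> \<Longrightarrow> x \<notin> closure \<Omega> \<Longrightarrow> u x = 0"
  by (auto simp: Vh_def pw_linear_def)

text \<open>Through \<open>pw_linear_Vh\<close>, closure under linear combinations is read off from
  piecewise linearity instead of from \<open>H1\<close>.\<close>

lemma Vh_linear: "u \<in> Vh \<Omega> \<T> \<Longrightarrow> w \<in> Vh \<Omega> \<T> \<Longrightarrow> (\<lambda>x. u x + s * w x) \<in> Vh \<Omega> \<T>"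
  by (intro pw_linear_Vh pw_linear_linear) (auto simp: Vh_PL Vh_outside)

section \<open>Integrals over the domain and over vertex patches\<close>

abbreviation I :: "(real^2 \<Rightarrow> real) \<Rightarrow> real" where
  "I f \<equiv> (LINT x|lebesgue_on (closure \<Omega>). f x)"

lemma I_add: "bdd_meas f \<Longrightarrow> bdd_meas g \<Longrightarrow> I (\<lambda>x. f x + g x) = I f + I g"
  and I_cmult: "I (\<lambda>x. c * f x) = c * I f"
  and I_sum: "(\<And>i. i \<in> J \<Longrightarrow> bdd_meas (F i)) \<Longrightarrow> I (\<lambda>x. \<Sum>i\<in>J. F i x) = (\<Sum>i\<in>J. I (F i))"
  and I_mono: "bdd_meas f \<Longrightarrow> bdd_meas g \<Longrightarrow> AE x in lebesgue_on (closure \<Omega>). f x \<le> g x \<Longrightarrow> I f \<le> I g"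
  using bdd_meas_integrable by (auto intro!: Bochner_Integration.integral_add Bochner_Integration.integral_sum integral_mono_AE)

lemma I_nonneg: "(\<And>x. 0 \<le> f x) \<Longrightarrow> 0 \<le> I f"
  by simp

lemma I_cong_AE: "AE x in lebesgue_on (closure \<Omega>). f x = g x \<Longrightarrow> I f = I g"
  by (rule lebesgue_on_cong_AE(3)[OF domain_sets(2)])

lemma AE_subset:
  assumes "AE x in lebesgue_on (closure \<Omega>). P x" "S \<subseteq> closure \<Omega>" "S \<in> sets lebesgue"
  shows "AE x in lebesgue_on S. P x"
  using assms by (simp add: AE_restrict_space_iff, elim eventually_mono) auto

lemma integral_subset:
  assumes "S \<subseteq> closure \<Omega>" "S \<in> sets lebesgue"
  shows "(LINT x|lebesgue_on S. f x) = I (\<lambda>x. indicator S x * f x)"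
proof -
  have "(LINT x|lebesgue_on S. f x) = (LINT x|lebesgue. indicator S x * f x)"
    using assms by (subst integral_restrict_space) auto
  also have "(\<lambda>x. indicator S x * f x) = (\<lambda>x. indicator (closure \<Omega>) x *\<^sub>R (indicator S x * f x))"
    using assms(1) by (auto simp: fun_eq_iff indicator_def)
  also have "(LINT x|lebesgue. indicator (closure \<Omega>) x *\<^sub>R (indicator S x * f x)) = I (\<lambda>x. indicator S x * f x)"
    by (subst integral_restrict_space) auto
  finally show ?thesis .
qed

lemma patch_subset: "patch \<T> a \<subseteq> closure \<Omega>"
  using mesh_subset by (auto simp: patch_def star_def)

lemma patch_sets [simp]: "patch \<T> a \<in> sets lebesgue"
  unfolding patch_def star_def using finite_mesh by (intro sets.finite_Union) auto

lemma measure_patch: "measure lebesgue (patch \<T> a) = I (indicator (patch \<T> a))"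
proof -
  have "measure lebesgue (patch \<T> a) = (LINT x|lebesgue_on (patch \<T> a). 1)"
    by (simp add: measure_restrict_space)
  also have "\<dots> = I (\<lambda>x. indicator (patch \<T> a) x * 1)" by (rule integral_subset[OF patch_subset patch_sets])
  finally show ?thesis by simp
qed

lemma indicator_patch_interior:
  assumes "x \<in> interior K" "K \<in> \<T>"
  shows "indicator (patch \<T> a) x = (if a \<in> verts K then 1 else 0 :: real)"
proof -
  have "x \<in> patch \<T> a \<longleftrightarrow> a \<in> verts K"
  proof
    assume "x \<in> patch \<T> a"
    then obtain K' where "K' \<in> \<T>" "a \<in> verts K'" "x \<in> K'" by (auto simp: patch_def star_def verts_def)
    then show "a \<in> verts K" using mesh_subset_of_interior_Int[OF assms(2), of K'] assms(1) by auto
  next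
    assume "a \<in> verts K"
    then show "x \<in> patch \<T> a" using assms interior_subset by (auto simp: patch_def star_def verts_def)
  qed
  then show ?thesis by (simp add: indicator_def)
qed

text \<open>The finite overlap of the patches: inside a triangle, a sum over all vertices localized
  to patches reduces to its three vertices.\<close>

lemma patch_sum:
  assumes "x \<in> interior K" "K \<in> \<T>"
  shows "(\<Sum>a\<in>vertices \<T>. indicator (patch \<T> a) x * c a) = (\<Sum>a\<in>verts K. c a :: real)"
proof -
  have "(\<Sum>a\<in>vertices \<T>. indicator (patch \<T> a) x * c a) = (\<Sum>a\<in>vertices \<T>. if a \<in> verts K then c a else 0)"
    unfolding indicator_patch_interior[OF assms] by (intro sum.cong) auto
  also have "\<dots> = (\<Sum>a\<in>verts K. c a)"
    using assms(2) finite_vertices mesh_vertices by (subst sum.mono_neutral_right[of _ "verts K"]) (auto intro: sum.cong)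
  finally show ?thesis .
qed

lemma measure_mesh_pos:
  assumes "K \<in> \<T>" shows "0 < measure lebesgue K"
proof -
  obtain p q r where t: "triangle p q r K" by (rule mesh_tri[OF assms])
  have D: "rot (q - p) \<bullet> (r - p) \<noteq> 0" "K = convex hull {p, q, r}" using t by (auto simp: triangle_def)
  \<comment> \<open>The barycentre, with all three coordinates equal to \<open>1 / 3\<close>, shows
    that the interior is nonempty.\<close>
  have "p + (1/3) *\<^sub>R (r - p) + (1/3) *\<^sub>R (q - p) \<in> interior K"
    unfolding D(2) interior_triangle[OF D(1)] mem_Collect_eq bary_param[OF D(1)] by simp
  then have "interior K \<noteq> {}" by blast
  then have "\<not> negligible K" using open_not_negligible[OF open_interior] negligible_subset interior_subset by metis
  then have "measure lebesgue K \<noteq> 0" using negligible_iff_measure0 lmeasurable_compact[OF mesh_compact[OF assms]] by blast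
  then show ?thesis using measure_nonneg[of lebesgue K] by linarith
qed

lemma measure_patch_pos:
  assumes "a \<in> vertices \<T>" shows "0 < measure lebesgue (patch \<T> a)"
proof -
  obtain K where K: "K \<in> \<T>" "a \<in> verts K" using assms mesh_vertices by auto
  then have "K \<subseteq> patch \<T> a" by (auto simp: patch_def star_def verts_def)
  moreover have "compact (patch \<T> a)"
    unfolding patch_def star_def using finite_mesh mesh_compact by (intro compact_Union) auto
  ultimately have "measure lebesgue K \<le> measure lebesgue (patch \<T> a)"
    using K(1) by (intro measure_mono_fmeasurable lmeasurable_compact) auto
  then show ?thesis using measure_mesh_pos[OF K(1)] by linarith
qed

section \<open>Integrals along boundary edges\<close>

lemma boundary_edge_normal:
  assumes E: "E \<in> boundary_edges \<Omega> \<T>"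
  obtains K p q n where "K \<in> \<T>" "E edge_of K" "edge_ends E = (p, q)" "closed_segment p q \<subseteq> K" "norm n = 1"
    "\<And>t. 0 < t \<Longrightarrow> t < 1 \<Longrightarrow> outward_normal \<Omega> (linepath p q t) = n"
proof -
  obtain K where K: "K \<in> \<T>" "E edge_of K" using E by (auto simp: boundary_edges_def)
  obtain p q r where e: "edge_ends E = (p, q)" "E = closed_segment p q" and t: "triangle p q r K"
    by (rule edge_endpoints[OF K])
  have nz: "norm (q - p) > 0" using triangle_distinct[OF t] by auto
  show ?thesis
  proof (rule that[OF K e(1)])
    show "closed_segment p q \<subseteq> K" using e(2) K(2) edge_of_imp_subset by auto
    show "norm ((side K p q / norm (q - p)) *\<^sub>R rot (q - p)) = 1" using nz by (simp add: side_def)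
    show "outward_normal \<Omega> (linepath p q t) = (side K p q / norm (q - p)) *\<^sub>R rot (q - p)" if "0 < t" "t < 1" for t
      using outward_normal_edge[OF K(1) t _ that] E e(2) by simp
  qed
qed

text \<open>The normal is constant on the relative interior of a boundary edge, so these integrands agree there
  with continuous functions.\<close>

definition bdry_cont :: "(real^2 \<Rightarrow> real) \<Rightarrow> bool" where
  "bdry_cont f \<longleftrightarrow> (\<exists>\<psi>. (\<forall>n. continuous_on (closure \<Omega>) (\<psi> n)) \<and> f = (\<lambda>x. \<psi> (outward_normal \<Omega> x) x))"

lemma bdry_contI:
  "(\<And>n. continuous_on (closure \<Omega>) (\<psi> n)) \<Longrightarrow> bdry_cont (\<lambda>x. \<psi> (outward_normal \<Omega> x) x)"
  unfolding bdry_cont_def by blast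

lemma bdry_cont_integrable:
  assumes f: "bdry_cont f" and E: "E \<in> boundary_edges \<Omega> \<T>" and e: "edge_ends E = (p, q)"
  shows "integrable (lebesgue_on {0..1}) (\<lambda>t. f (linepath p q t))"
proof -
  obtain \<psi> where \<psi>: "\<And>n. continuous_on (closure \<Omega>) (\<psi> n)" "f = (\<lambda>x. \<psi> (outward_normal \<Omega> x) x)"
    using f unfolding bdry_cont_def by blast
  obtain K n where K: "K \<in> \<T>" "closed_segment p q \<subseteq> K"
     "\<And>t. 0 < t \<Longrightarrow> t < 1 \<Longrightarrow> outward_normal \<Omega> (linepath p q t) = n"
    by (rule boundary_edge_normal[OF E]) (use e in auto)
  have seg: "linepath p q t \<in> closure \<Omega>" if "t \<in> {0..1}" for t
    using linepath_in_path[OF that, of p q] K mesh_subset by blast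
  have c: "continuous_on {0..1} (\<lambda>t. \<psi> n (linepath p q t))"
    using seg by (intro continuous_on_compose2[OF \<psi>(1)] continuous_on_linepath) auto
  have "integrable lborel (\<lambda>t. indicator {0..1} t *\<^sub>R \<psi> n (linepath p q t))"
    using borel_integrable_compact[OF compact_Icc c] by (simp add: set_integrable_def)
  then have "integrable lebesgue (\<lambda>t. indicator {0..1} t *\<^sub>R \<psi> n (linepath p q t))"
    by (subst integrable_completion) (use borel_measurable_continuous_on_indicator[OF _ c] in auto)
  then have "integrable (lebesgue_on {0..1}) (\<lambda>t. \<psi> n (linepath p q t))"
    by (subst integrable_restrict_space) auto
  moreover have "AE t in lebesgue_on {0..1}. f (linepath p q t) = \<psi> n (linepath p q t)"
    using AE_unit_open by eventually_elim (use \<psi>(2) K(3) in simp)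
  ultimately show ?thesis
    using lebesgue_on_cong_AE(2)[of "{0..1}" "\<lambda>t. f (linepath p q t)" "\<lambda>t. \<psi> n (linepath p q t)"] by simp
qed

definition bdry_int :: "(real^2 \<Rightarrow> real) \<Rightarrow> real" where
  "bdry_int f = (\<Sum>E\<in>boundary_edges \<Omega> \<T>. edge_integral E f)"

lemma bdry_int_add:
  assumes "bdry_cont f" "bdry_cont g" shows "bdry_int (\<lambda>x. f x + g x) = bdry_int f + bdry_int g"
  unfolding bdry_int_def sum.distrib[symmetric]
proof (rule sum.cong[OF refl])
  fix E assume E: "E \<in> boundary_edges \<Omega> \<T>"
  obtain p q where e: "edge_ends E = (p, q)" by fastforce
  show "edge_integral E (\<lambda>x. f x + g x) = edge_integral E f + edge_integral E g"
    unfolding edge_integral_eq[OF e] using assms[THEN bdry_cont_integrable, OF E e] by (simp add: distrib_left)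
qed

lemma bdry_int_cmult: "bdry_int (\<lambda>x. c * f x) = c * bdry_int f"
  unfolding bdry_int_def sum_distrib_left
proof (rule sum.cong[OF refl])
  fix E
  obtain p q where e: "edge_ends E = (p, q)" by fastforce
  show "edge_integral E (\<lambda>x. c * f x) = c * edge_integral E f"
    unfolding edge_integral_eq[OF e] by simp
qed

lemma bdry_int_mono:
  assumes "bdry_cont f" "bdry_cont g" "\<And>x. f x \<le> g x" shows "bdry_int f \<le> bdry_int g"
  unfolding bdry_int_def
proof (rule sum_mono)
  fix E assume E: "E \<in> boundary_edges \<Omega> \<T>"
  obtain p q where e: "edge_ends E = (p, q)" by fastforce
  show "edge_integral E f \<le> edge_integral E g"
    unfolding edge_integral_eq[OF e] using assms(1,2)[THEN bdry_cont_integrable, OF E e] assms(3)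
    by (intro mult_left_mono integral_mono) auto
qed

lemma bdry_int_nonneg: "(\<And>x. 0 \<le> f x) \<Longrightarrow> 0 \<le> bdry_int f"
proof -
  assume f: "\<And>x. 0 \<le> f x"
  show ?thesis unfolding bdry_int_def
  proof (rule sum_nonneg)
    fix E
    obtain p q where e: "edge_ends E = (p, q)" by fastforce
    show "0 \<le> edge_integral E f" unfolding edge_integral_eq[OF e] using f by (intro mult_nonneg_nonneg integral_nonneg) auto
  qed
qed

end

section \<open>The bilinear form and the norm in terms of piecewise gradients\<close>

locale advection = shape_mesh +
  fixes b :: "real^2 \<Rightarrow> real^2" and \<mu> :: "real^2 \<Rightarrow> real" and \<alpha> \<beta> B M d :: real
  assumes bw: "\<And>i. W1inf \<Omega> (\<lambda>x. b x $ i)" and bc: "continuous_on (closure \<Omega>) b"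
    and mu: "Linf \<Omega> \<mu>" and alpha: "\<alpha> > 0" and beta: "\<beta> > 0"
    and coercive: "AE x in lebesgue_on \<Omega>. \<mu> x - weak_div \<Omega> b x / 2 \<ge> \<alpha>"
    and B: "B > 0" "\<And>x. x \<in> closure \<Omega> \<Longrightarrow> norm (b x) \<le> B"
    and M: "M > 0" "AE x in lebesgue_on \<Omega>. \<bar>\<mu> x\<bar> \<le> M"
    and d: "d > 0" "\<And>K. K \<in> \<T> \<Longrightarrow> diameter K \<le> d"
begin

abbreviation "V \<equiv> Vh \<Omega> \<T>"

text \<open>Replaces \<open>adv\<close>, which rests on chosen weak derivatives, by a representative
  that is bounded and measurable and, for piecewise linear functions, linear at every point.\<close>

definition D :: "(real^2 \<Rightarrow> real) \<Rightarrow> real^2 \<Rightarrow> real" where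
  "D u x = b x \<bullet> pw_grad \<T> u x"

lemma b_component_continuous: "continuous_on (closure \<Omega>) (\<lambda>x. b x $ i)"
  using bc by (intro continuous_intros)

lemma bdd_meas_D: "bdd_meas (D u)"
  unfolding D_def inner_vec_def inner_real_def
  by (intro bdd_meas_sum bdd_meas_mult bdd_meas_pg bdd_meas_continuous b_component_continuous)

lemma D_linear: "pw_linear u \<Longrightarrow> pw_linear w \<Longrightarrow> D (\<lambda>x. u x + s * w x) y = D u y + s * D w y"
  by (simp add: D_def pw_grad_linear inner_add_right)

lemma adv_AE: "u \<in> V \<Longrightarrow> AE x in lebesgue_on (closure \<Omega>). adv \<Omega> b u x = D u x"
  by (drule AE_weak_grad) (auto simp: adv_def D_def elim: eventually_mono)

definition avg :: "(real^2 \<Rightarrow> real) \<Rightarrow> real^2 \<Rightarrow> real" where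
  "avg u a = I (\<lambda>x. indicator (patch \<T> a) x * D u x) / measure lebesgue (patch \<T> a)"

lemma bdd_meas_patch: "bdd_meas f \<Longrightarrow> bdd_meas (\<lambda>x. indicator (patch \<T> a) x * f x)"
  by (intro bdd_meas_mult bdd_meas_indicator patch_sets)

lemma avg_linear: "pw_linear u \<Longrightarrow> pw_linear w \<Longrightarrow> avg (\<lambda>x. u x + s * w x) a = avg u a + s * avg w a"
proof -
  assume P: "pw_linear u" "pw_linear w"
  have "I (\<lambda>x. indicator (patch \<T> a) x * D (\<lambda>x. u x + s * w x) x)
    = I (\<lambda>x. indicator (patch \<T> a) x * D u x + s * (indicator (patch \<T> a) x * D w x))"
    by (simp add: D_linear[OF P] algebra_simps)
  also have "\<dots> = I (\<lambda>x. indicator (patch \<T> a) x * D u x) + s * I (\<lambda>x. indicator (patch \<T> a) x * D w x)"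
    by (subst I_add) (simp_all only: I_cmult bdd_meas_patch bdd_meas_D bdd_meas_mult bdd_meas_const)
  finally show ?thesis by (simp add: avg_def add_divide_distrib)
qed

definition fluct :: "(real^2 \<Rightarrow> real) \<Rightarrow> real^2 \<Rightarrow> real^2 \<Rightarrow> real" where
  "fluct u a x = D u x - avg u a"

lemma bdd_meas_kp: "bdd_meas (fluct u a)"
  unfolding fluct_def by (intro bdd_meas_diff bdd_meas_D bdd_meas_const)

lemma fluct_linear: "pw_linear u \<Longrightarrow> pw_linear w \<Longrightarrow> fluct (\<lambda>x. u x + s * w x) a y = fluct u a y + s * fluct w a y"
  by (simp add: fluct_def D_linear avg_linear algebra_simps)

lemma kappa_AE:
  assumes u: "u \<in> V" shows "AE x in lebesgue_on (closure \<Omega>). kappa \<Omega> b \<T> a u x = fluct u a x"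
proof -
  have "(LINT y|lebesgue_on (patch \<T> a). adv \<Omega> b u y) = (LINT y|lebesgue_on (patch \<T> a). D u y)"
    by (rule lebesgue_on_cong_AE(3)[OF patch_sets AE_subset[OF adv_AE[OF u] patch_subset patch_sets]])
  also have "\<dots> = I (\<lambda>x. indicator (patch \<T> a) x * D u x)"
    by (rule integral_subset[OF patch_subset patch_sets])
  finally have e: "1 / measure lebesgue (patch \<T> a) * (LINT y|lebesgue_on (patch \<T> a). adv \<Omega> b u y) = avg u a"
    by (simp add: avg_def)
  show ?thesis using adv_AE[OF u] by eventually_elim (simp only: kappa_def e fluct_def)
qed

definition S :: "(real^2 \<Rightarrow> real) \<Rightarrow> (real^2 \<Rightarrow> real) \<Rightarrow> real" where
  "S u v = (\<Sum>a\<in>vertices \<T>. \<beta> * h_vertex \<T> a * I (\<lambda>x. indicator (patch \<T> a) x * (fluct u a x * fluct v a x)))"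

lemma Sh_eq:
  assumes "u \<in> V" "v \<in> V" shows "Sh \<Omega> b \<beta> \<T> u v = S u v"
  unfolding Sh_def S_def
proof (rule sum.cong[OF refl])
  fix a
  have "L2_inner (patch \<T> a) (kappa \<Omega> b \<T> a u) (kappa \<Omega> b \<T> a v)
     = I (\<lambda>x. indicator (patch \<T> a) x * (kappa \<Omega> b \<T> a u x * kappa \<Omega> b \<T> a v x))"
    unfolding L2_inner_def by (rule integral_subset[OF patch_subset patch_sets])
  also have "\<dots> = I (\<lambda>x. indicator (patch \<T> a) x * (fluct u a x * fluct v a x))"
    by (rule I_cong_AE) (use kappa_AE[OF assms(1), of a] kappa_AE[OF assms(2), of a] in eventually_elim, simp)
  finally show "\<beta> * h_vertex \<T> a * L2_inner (patch \<T> a) (kappa \<Omega> b \<T> a u) (kappa \<Omega> b \<T> a v)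
    = \<beta> * h_vertex \<T> a * I (\<lambda>x. indicator (patch \<T> a) x * (fluct u a x * fluct v a x))" by simp
qed

definition X :: "(real^2 \<Rightarrow> real) \<Rightarrow> real" where
  "X u = I (\<lambda>x. h_fun \<T> x * (D u x)\<^sup>2)"

definition bdry_energy :: "(real^2 \<Rightarrow> real) \<Rightarrow> real" where
  "bdry_energy u = bdry_int (\<lambda>x. \<bar>b x \<bullet> outward_normal \<Omega> x\<bar> / 2 * (u x)\<^sup>2)"

definition inflow_form :: "(real^2 \<Rightarrow> real) \<Rightarrow> (real^2 \<Rightarrow> real) \<Rightarrow> real" where
  "inflow_form u v = bdry_int (\<lambda>x. neg_part (b x \<bullet> outward_normal \<Omega> x) * u x * v x)"

text \<open>With \<open>S\<close>, \<open>X\<close> and \<open>LPSD_sq\<close> it restates the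
  discrete problem using \<open>D\<close> in place of \<open>adv\<close>; \<open>Ah_eq\<close> and
  \<open>LPSD_eq\<close> give agreement on \<open>Vh\<close>.\<close>

definition A :: "(real^2 \<Rightarrow> real) \<Rightarrow> (real^2 \<Rightarrow> real) \<Rightarrow> real" where
  "A u v = I (\<lambda>x. D u x * v x) + I (\<lambda>x. \<mu> x * u x * v x) + inflow_form u v + S u v"

lemma Ah_eq:
  assumes "u \<in> V" "v \<in> V" shows "Ah \<Omega> b \<mu> \<beta> \<T> u v = A u v"
proof -
  have "L2_inner \<Omega> (adv \<Omega> b u) v = I (\<lambda>x. D u x * v x)"
    unfolding L2_inner_closure unfolding L2_inner_def
    by (rule I_cong_AE) (use adv_AE[OF assms(1)] in eventually_elim, simp)
  moreover have "L2_inner \<Omega> (\<lambda>x. \<mu> x * u x) v = I (\<lambda>x. \<mu> x * u x * v x)"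
    unfolding L2_inner_closure unfolding L2_inner_def ..
  ultimately show ?thesis by (simp add: Ah_def A_def Sh_eq[OF assms] boundary_integral_def inflow_form_def bdry_int_def)
qed

lemma h_fun_nonneg: "0 \<le> h_fun \<T> x"
  unfolding h_fun_def using verts_mesh(5) by (intro sum_nonneg mult_nonneg_nonneg) (auto intro: less_imp_le)

definition LPSD_sq :: "(real^2 \<Rightarrow> real) \<Rightarrow> real" where
  "LPSD_sq u = X u + \<alpha> * I (\<lambda>x. (u x)\<^sup>2) + bdry_energy u + S u u"

lemma S_nonneg: "0 \<le> S u u"
  unfolding S_def
proof (rule sum_nonneg)
  fix a assume "a \<in> vertices \<T>"
  then have "0 < h_vertex \<T> a" using h_vertex_bounds(3) mesh_vertices by auto
  then show "0 \<le> \<beta> * h_vertex \<T> a * I (\<lambda>x. indicator (patch \<T> a) x * (fluct u a x * fluct u a x))"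
    using beta by (intro mult_nonneg_nonneg[OF _ I_nonneg]) auto
qed

lemma X_nonneg: "0 \<le> X u"
  unfolding X_def by (intro I_nonneg mult_nonneg_nonneg h_fun_nonneg) simp

lemma bdry_energy_nonneg: "0 \<le> bdry_energy u"
  unfolding bdry_energy_def by (intro bdry_int_nonneg) simp

lemma LPSD_eq:
  assumes u: "u \<in> V" shows "LPSD_norm \<Omega> b \<alpha> \<beta> \<T> u = sqrt (LPSD_sq u)"
proof -
  have sq: "(L2_norm \<Omega> f)\<^sup>2 = I (\<lambda>x. (f x)\<^sup>2)" for f
    unfolding L2_norm_def L2_inner_closure unfolding L2_inner_def
    using I_nonneg[of "\<lambda>x. f x * f x"] by (simp add: power2_eq_square)
  have "I (\<lambda>x. (sqrt (h_fun \<T> x) * adv \<Omega> b u x)\<^sup>2) = X u"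
    unfolding X_def
    by (rule I_cong_AE) (use adv_AE[OF u] in eventually_elim, simp add: power_mult_distrib h_fun_nonneg)
  then show ?thesis
    by (simp add: LPSD_norm_def sq Sh_eq[OF u u] LPSD_sq_def bdry_energy_def bdry_int_def)
qed

text \<open>A vanishing integral makes the open set of points of \<Omega> with
  \<open>u x \<noteq> 0\<close> a null set, hence empty; continuity extends the zero to the closure,
  and \<open>Vh\<close> prescribes it outside. The denominators of the quotient are thus
  positive.\<close>

lemma I_square_pos:
  assumes u: "u \<in> V" "u \<noteq> (\<lambda>_. 0)" shows "0 < I (\<lambda>x. (u x)\<^sup>2)"
proof (rule ccontr)
  have cont: "continuous_on (closure \<Omega>) u" by (rule pw_linear_continuous[OF Vh_PL[OF u(1)]])
  assume "\<not> 0 < I (\<lambda>x. (u x)\<^sup>2)"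
  moreover have "0 \<le> I (\<lambda>x. (u x)\<^sup>2)" by (rule I_nonneg) simp
  ultimately have "I (\<lambda>x. (u x)\<^sup>2) = 0" by linarith
  then have "AE x in lebesgue_on (closure \<Omega>). (u x)\<^sup>2 = 0"
    by (subst (asm) integral_nonneg_eq_0_iff_AE) (auto intro!: bdd_meas_integrable bdd_meas_continuous continuous_intros cont)
  then have ae: "AE x in lebesgue. x \<notin> {x \<in> \<Omega>. u x \<noteq> 0}"
    by (simp add: AE_restrict_space_iff, elim eventually_mono) (use closure_subset in auto)
  have op: "open {x \<in> \<Omega>. u x \<noteq> 0}"
  proof -
    have "open (\<Omega> \<inter> u -` (- {0}))"
      using continuous_on_subset[OF cont closure_subset] open_domain by (intro continuous_open_preimage) auto
    moreover have "\<Omega> \<inter> u -` (- {0}) = {x \<in> \<Omega>. u x \<noteq> 0}" by auto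
    ultimately show ?thesis by simp
  qed
  then have "{x \<in> \<Omega>. u x \<noteq> 0} \<in> sets lebesgue" by simp
  then have "negligible {x \<in> \<Omega>. u x \<noteq> 0}"
    unfolding negligible_iff_null_sets using AE_iff_null_sets ae by blast
  then have "{x \<in> \<Omega>. u x \<noteq> 0} = {}" using op open_not_negligible by blast
  then have z: "\<And>x. x \<in> \<Omega> \<Longrightarrow> u x = 0" by auto
  have "u x = 0" for x
  proof (cases "x \<in> closure \<Omega>")
    case True
    then show ?thesis using continuous_constant_on_closure[OF cont, of 0 x] z by simp
  qed (use Vh_outside[OF u(1)] in simp)
  then show False using u(2) by auto
qed

lemma LPSD_sq_pos: "u \<in> V \<Longrightarrow> u \<noteq> (\<lambda>_. 0) \<Longrightarrow> 0 < LPSD_sq u"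
  unfolding LPSD_sq_def using X_nonneg[of u] S_nonneg[of u] bdry_energy_nonneg[of u] mult_pos_pos[OF alpha I_square_pos[of u]] by linarith

lemma bdry_cont_form:
  assumes "pw_linear u" "pw_linear v"
  shows "bdry_cont (\<lambda>x. \<bar>b x \<bullet> outward_normal \<Omega> x\<bar> / 2 * (u x)\<^sup>2)"
    "bdry_cont (\<lambda>x. neg_part (b x \<bullet> outward_normal \<Omega> x) * u x * v x)"
    "bdry_cont (\<lambda>x. outward_normal \<Omega> x $ i * (b x $ i * u x * u x))"
    "bdry_cont (\<lambda>x. (b x \<bullet> outward_normal \<Omega> x) * (u x)\<^sup>2)"
proof -
  note c = pw_linear_continuous[OF assms(1)] pw_linear_continuous[OF assms(2)] bc b_component_continuous
  show "bdry_cont (\<lambda>x. \<bar>b x \<bullet> outward_normal \<Omega> x\<bar> / 2 * (u x)\<^sup>2)"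
    by (rule bdry_contI[of "\<lambda>n x. \<bar>b x \<bullet> n\<bar> / 2 * (u x)\<^sup>2"]) (intro continuous_intros c; simp)
  show "bdry_cont (\<lambda>x. neg_part (b x \<bullet> outward_normal \<Omega> x) * u x * v x)"
    by (rule bdry_contI[of "\<lambda>n x. neg_part (b x \<bullet> n) * u x * v x"]) (unfold neg_part_def, intro continuous_intros c; simp)
  show "bdry_cont (\<lambda>x. outward_normal \<Omega> x $ i * (b x $ i * u x * u x))"
    by (rule bdry_contI[of "\<lambda>n x. n $ i * (b x $ i * u x * u x)"]) (intro continuous_intros c)
  show "bdry_cont (\<lambda>x. (b x \<bullet> outward_normal \<Omega> x) * (u x)\<^sup>2)"
    by (rule bdry_contI[of "\<lambda>n x. (b x \<bullet> n) * (u x)\<^sup>2"]) (intro continuous_intros c)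
qed

lemma bdd_meas_weak_div: "bdd_meas (weak_div \<Omega> b)"
  unfolding weak_div_def[abs_def] by (intro bdd_meas_sum W1inf_bm(1) bw)

text \<open>\<open>mesh_green\<close> for \<open>b x $ i * u x * u x\<close>, whose weak derivative
  on a triangle comes from two applications of the product rule. The sum over both components
  contains the divergence once and the advective term twice.\<close>

lemma divergence_identity:
  assumes u: "pw_linear u"
  shows "I (\<lambda>x. weak_div \<Omega> b x * (u x)\<^sup>2) + 2 * I (\<lambda>x. D u x * u x) = bdry_int (\<lambda>x. (b x \<bullet> outward_normal \<Omega> x) * (u x)\<^sup>2)"
proof -
  note cu = pw_linear_continuous[OF u] note bu = bdd_meas_continuous[OF cu] note bb = bdd_meas_continuous[OF b_component_continuous]
  define g where "g i x = (weak_deriv \<Omega> i (\<lambda>y. b y $ i) x * u x + b x $ i * pw_grad \<T> u x $ i) * u x + b x $ i * u x * pw_grad \<T> u x $ i" for i x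
  have bg: "bdd_meas (g i)" for i unfolding g_def by (intro bdd_meas_add bdd_meas_mult bb bu bdd_meas_pg W1inf_bm(1) bw)
  have "I (g i) = bdry_int (\<lambda>x. outward_normal \<Omega> x $ i * (b x $ i * u x * u x))" for i
    unfolding bdry_int_def
  proof (rule mesh_green)
    show "continuous_on (closure \<Omega>) (\<lambda>x. b x $ i * u x * u x)" by (intro continuous_on_mult b_component_continuous cu)
    show "integrable (lebesgue_on (closure \<Omega>)) (g i)" by (rule bdd_meas_integrable[OF bg])
    fix K assume K: "K \<in> \<T>"
    show "is_weak_deriv (interior K) i (\<lambda>x. b x $ i * u x * u x) (g i)"
      unfolding g_def
      by (intro pw_linear_weak_deriv_interior[OF u K] is_weak_deriv_subset[OF W1inf_bm(2)[OF bw] interior_mesh_subset[OF K] open_interior open_domain])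
  qed
  then have "I (g 1) + I (g 2) = bdry_int (\<lambda>x. outward_normal \<Omega> x $ 1 * (b x $ 1 * u x * u x)) + bdry_int (\<lambda>x. outward_normal \<Omega> x $ 2 * (b x $ 2 * u x * u x))"
    by simp
  also have "\<dots> = bdry_int (\<lambda>x. outward_normal \<Omega> x $ 1 * (b x $ 1 * u x * u x) + outward_normal \<Omega> x $ 2 * (b x $ 2 * u x * u x))"
    by (rule bdry_int_add[symmetric]; rule bdry_cont_form(3)[OF u u])
  also have "\<dots> = bdry_int (\<lambda>x. (b x \<bullet> outward_normal \<Omega> x) * (u x)\<^sup>2)"
    by (simp add: inner_vec_def sum_2 power2_eq_square algebra_simps)
  finally have "bdry_int (\<lambda>x. (b x \<bullet> outward_normal \<Omega> x) * (u x)\<^sup>2) = I (\<lambda>x. g 1 x + g 2 x)"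
    by (simp add: I_add[OF bg bg])
  also have "(\<lambda>x. g 1 x + g 2 x) = (\<lambda>x. weak_div \<Omega> b x * (u x)\<^sup>2 + 2 * (D u x * u x))"
    by (simp add: fun_eq_iff g_def weak_div_def D_def inner_vec_def sum_2 power2_eq_square algebra_simps)
  also have "I \<dots> = I (\<lambda>x. weak_div \<Omega> b x * (u x)\<^sup>2) + 2 * I (\<lambda>x. D u x * u x)"
    by (subst I_add) (simp_all only: I_cmult bdd_meas_mult bdd_meas_const bdd_meas_weak_div bdd_meas_power2 bu bdd_meas_D)
  finally show ?thesis by simp
qed

lemma bdd_meas_mu: "bdd_meas \<mu>" by (rule Linf_bm[OF mu])

text \<open>Half of \<open>divergence_identity\<close> trades the advective term for minus half the
  divergence and a boundary term with weight \<open>z / 2\<close>, \<open>z\<close> the normal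
  component of \<open>b\<close>. The former joins \<mu> and leaves at least \<alpha>; the latter
  joins the inflow term by \<open>neg_part z + z / 2 = |z| / 2\<close>.\<close>

lemma A_coercive:
  assumes u: "pw_linear u"
  shows "\<alpha> * I (\<lambda>x. (u x)\<^sup>2) + bdry_energy u + S u u \<le> A u u"
proof -
  note bu = bdd_meas_continuous[OF pw_linear_continuous[OF u]]
  have "\<alpha> * I (\<lambda>x. (u x)\<^sup>2) = I (\<lambda>x. \<alpha> * (u x)\<^sup>2)" by (simp only: I_cmult)
  also have "\<dots> \<le> I (\<lambda>x. \<mu> x * u x * u x + (- 1 / 2) * (weak_div \<Omega> b x * (u x)\<^sup>2))"
  proof (rule I_mono)
    show "bdd_meas (\<lambda>x. \<alpha> * (u x)\<^sup>2)" by (intro bdd_meas_mult bdd_meas_const bdd_meas_power2 bu)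
    show "bdd_meas (\<lambda>x. \<mu> x * u x * u x + (- 1 / 2) * (weak_div \<Omega> b x * (u x)\<^sup>2))"
      by (intro bdd_meas_add bdd_meas_mult bdd_meas_const bdd_meas_power2 bu bdd_meas_mu bdd_meas_weak_div)
    show "AE x in lebesgue_on (closure \<Omega>). \<alpha> * (u x)\<^sup>2 \<le> \<mu> x * u x * u x + (- 1 / 2) * (weak_div \<Omega> b x * (u x)\<^sup>2)"
      using coercive unfolding domain_closure
    proof eventually_elim
      fix x assume "\<mu> x - weak_div \<Omega> b x / 2 \<ge> \<alpha>"
      then have "\<alpha> * (u x)\<^sup>2 \<le> (\<mu> x - weak_div \<Omega> b x / 2) * (u x)\<^sup>2" by (rule mult_right_mono) simp
      then show "\<alpha> * (u x)\<^sup>2 \<le> \<mu> x * u x * u x + (- 1 / 2) * (weak_div \<Omega> b x * (u x)\<^sup>2)"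
        by (simp add: power2_eq_square algebra_simps)
    qed
  qed
  also have "\<dots> = I (\<lambda>x. \<mu> x * u x * u x) - 1 / 2 * I (\<lambda>x. weak_div \<Omega> b x * (u x)\<^sup>2)"
  proof -
    have b1: "bdd_meas (\<lambda>x. \<mu> x * u x * u x)" by (intro bdd_meas_mult bu bdd_meas_mu)
    have b2: "bdd_meas (\<lambda>x. (- 1 / 2) * (weak_div \<Omega> b x * (u x)\<^sup>2))" by (intro bdd_meas_mult bdd_meas_const bdd_meas_weak_div bdd_meas_power2 bu)
    show ?thesis unfolding I_add[OF b1 b2] I_cmult by simp
  qed
  finally have 1: "\<alpha> * I (\<lambda>x. (u x)\<^sup>2) \<le> I (\<lambda>x. \<mu> x * u x * u x) - 1 / 2 * I (\<lambda>x. weak_div \<Omega> b x * (u x)\<^sup>2)" .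
  have "bdry_energy u = bdry_int (\<lambda>x. neg_part (b x \<bullet> outward_normal \<Omega> x) * u x * u x + (1 / 2) * ((b x \<bullet> outward_normal \<Omega> x) * (u x)\<^sup>2))"
    unfolding bdry_energy_def by (simp add: neg_part_def power2_eq_square field_simps)
  also have "\<dots> = inflow_form u u + 1 / 2 * bdry_int (\<lambda>x. (b x \<bullet> outward_normal \<Omega> x) * (u x)\<^sup>2)"
  proof -
    have "bdry_cont (\<lambda>x. (1 / 2) * ((b x \<bullet> outward_normal \<Omega> x) * (u x)\<^sup>2))"
      by (rule bdry_contI[of "\<lambda>n x. (1 / 2) * ((b x \<bullet> n) * (u x)\<^sup>2)"]) (intro continuous_intros pw_linear_continuous[OF u] bc)
    then show ?thesis unfolding inflow_form_def by (subst bdry_int_add[OF bdry_cont_form(2)[OF u u]]) (simp_all only: bdry_int_cmult)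
  qed
  finally have "bdry_energy u = inflow_form u u + 1 / 2 * bdry_int (\<lambda>x. (b x \<bullet> outward_normal \<Omega> x) * (u x)\<^sup>2)" .
  then show ?thesis using 1 divergence_identity[OF u] unfolding A_def by linarith
qed

end

section \<open>Stability bounds for the corrector\<close>

text \<open>Expanding the square of \<open>x / sqrt t + sqrt t * y / 2\<close> even gives the
  coefficient \<open>t / 4\<close>; the weaker \<open>t\<close> keeps later constants
  simple.\<close>

lemma young: "t > 0 \<Longrightarrow> - (x * y) \<le> x\<^sup>2 / t + t * y\<^sup>2" for x y t :: real
proof -
  assume t: "t > 0"
  have "0 \<le> (x / sqrt t + sqrt t * y / 2)\<^sup>2" by simp
  also have "\<dots> = x\<^sup>2 / t + x * y + t * y\<^sup>2 / 4"
    using t by (simp add: power2_sum power_divide power_mult_distrib)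
  finally have "- (x * y) \<le> x\<^sup>2 / t + t * y\<^sup>2 / 4" by simp
  moreover have "t * y\<^sup>2 / 4 \<le> t * y\<^sup>2" using t by simp
  ultimately show ?thesis by linarith
qed

lemma sum_square_le: "(x + s * y)\<^sup>2 \<le> 2 * x\<^sup>2 + 2 * s\<^sup>2 * y\<^sup>2" for x y s :: real
proof -
  have "0 \<le> (x - s * y)\<^sup>2" by simp
  then show ?thesis by (simp add: power2_eq_square algebra_simps)
qed

context advection
begin

text \<open>An intermediate quantity: the parts of the norm of the corrector are bounded by
  \<open>Q u\<close>, directly or through its streamline part, and \<open>Q u\<close> is at most
  \<open>3 * \<zeta> * X u\<close>.\<close>

definition Q :: "(real^2 \<Rightarrow> real) \<Rightarrow> real" where
  "Q u = (\<Sum>a\<in>vertices \<T>. h_vertex \<T> a * (avg u a)\<^sup>2 * measure lebesgue (patch \<T> a))"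

lemma vertex_h_pos: "a \<in> vertices \<T> \<Longrightarrow> 0 < h_vertex \<T> a"
  using h_vertex_bounds(3) mesh_vertices by auto

lemma patch_sum_integral:
  assumes "\<And>a. bdd_meas (f a)"
  shows "(\<Sum>a\<in>vertices \<T>. c a * I (\<lambda>x. indicator (patch \<T> a) x * f a x))
    = I (\<lambda>x. \<Sum>a\<in>vertices \<T>. indicator (patch \<T> a) x * (c a * f a x))"
    "bdd_meas (\<lambda>x. \<Sum>a\<in>vertices \<T>. indicator (patch \<T> a) x * (c a * f a x))"
proof -
  have "(\<Sum>a\<in>vertices \<T>. c a * I (\<lambda>x. indicator (patch \<T> a) x * f a x))
    = (\<Sum>a\<in>vertices \<T>. I (\<lambda>x. indicator (patch \<T> a) x * (c a * f a x)))"
    by (simp only: I_cmult[symmetric] mult.left_commute)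
  also have "\<dots> = I (\<lambda>x. \<Sum>a\<in>vertices \<T>. indicator (patch \<T> a) x * (c a * f a x))"
    by (rule I_sum[symmetric]) (intro bdd_meas_patch bdd_meas_mult bdd_meas_const assms)
  finally show "(\<Sum>a\<in>vertices \<T>. c a * I (\<lambda>x. indicator (patch \<T> a) x * f a x))
    = I (\<lambda>x. \<Sum>a\<in>vertices \<T>. indicator (patch \<T> a) x * (c a * f a x))" .
  show "bdd_meas (\<lambda>x. \<Sum>a\<in>vertices \<T>. indicator (patch \<T> a) x * (c a * f a x))"
    by (intro bdd_meas_sum bdd_meas_patch bdd_meas_mult bdd_meas_const assms)
qed

text \<open>Deviations from the patch mean have mean zero, so the cross term reduces to the squared
  mean. Both \<open>avg_le\<close> and \<open>S_le\<close> follow by dropping a nonnegative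
  term.\<close>

lemma variance:
  assumes a: "a \<in> vertices \<T>"
  shows "I (\<lambda>x. indicator (patch \<T> a) x * (fluct u a x * fluct u a x))
    = I (\<lambda>x. indicator (patch \<T> a) x * (D u x)\<^sup>2) - (avg u a)\<^sup>2 * measure lebesgue (patch \<T> a)"
proof -
  let ?c = "indicator (patch \<T> a) :: real^2 \<Rightarrow> real" and ?m = "measure lebesgue (patch \<T> a)"
  have bc: "bdd_meas ?c" by (rule bdd_meas_indicator[OF patch_sets])
  have m: "0 < ?m" by (rule measure_patch_pos[OF a])
  have 1: "bdd_meas (\<lambda>x. ?c x * (D u x)\<^sup>2)" "bdd_meas (\<lambda>x. (- 2 * avg u a) * (?c x * D u x))" "bdd_meas (\<lambda>x. (avg u a)\<^sup>2 * ?c x)"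
    by (intro bdd_meas_mult bdd_meas_const bdd_meas_power2 bdd_meas_D bc)+
  have "I (\<lambda>x. ?c x * (fluct u a x * fluct u a x)) = I (\<lambda>x. (?c x * (D u x)\<^sup>2 + (- 2 * avg u a) * (?c x * D u x)) + (avg u a)\<^sup>2 * ?c x)"
    by (simp add: fluct_def power2_eq_square algebra_simps)
  also have "\<dots> = I (\<lambda>x. ?c x * (D u x)\<^sup>2) + (- 2 * avg u a) * I (\<lambda>x. ?c x * D u x) + (avg u a)\<^sup>2 * I ?c"
    unfolding I_add[OF bdd_meas_add[OF 1(1,2)] 1(3)] I_add[OF 1(1,2)] I_cmult ..
  also have "I (\<lambda>x. ?c x * D u x) = avg u a * ?m" using m by (simp add: avg_def)
  also have "I ?c = ?m" by (rule measure_patch[symmetric])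
  finally show ?thesis by (simp add: power2_eq_square)
qed

lemma avg_le:
  assumes a: "a \<in> vertices \<T>"
  shows "(avg u a)\<^sup>2 * measure lebesgue (patch \<T> a) \<le> I (\<lambda>x. indicator (patch \<T> a) x * (D u x)\<^sup>2)"
proof -
  have "0 \<le> I (\<lambda>x. indicator (patch \<T> a) x * (fluct u a x * fluct u a x))"
    by (intro I_nonneg) simp
  then show ?thesis using variance[OF a, of u] by linarith
qed

lemma S_le:
  "S u u \<le> \<beta> * (\<Sum>a\<in>vertices \<T>. h_vertex \<T> a * I (\<lambda>x. indicator (patch \<T> a) x * (D u x)\<^sup>2))"
  unfolding S_def sum_distrib_left
proof (rule sum_mono)
  fix a assume a: "a \<in> vertices \<T>"
  have "0 \<le> (avg u a)\<^sup>2 * measure lebesgue (patch \<T> a)" by simp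
  then have "I (\<lambda>x. indicator (patch \<T> a) x * (fluct u a x * fluct u a x)) \<le> I (\<lambda>x. indicator (patch \<T> a) x * (D u x)\<^sup>2)"
    using variance[OF a, of u] by linarith
  then have "(\<beta> * h_vertex \<T> a) * I (\<lambda>x. indicator (patch \<T> a) x * (fluct u a x * fluct u a x)) \<le> (\<beta> * h_vertex \<T> a) * I (\<lambda>x. indicator (patch \<T> a) x * (D u x)\<^sup>2)"
    using beta vertex_h_pos[OF a] by (intro mult_left_mono) auto
  then show "\<beta> * h_vertex \<T> a * I (\<lambda>x. indicator (patch \<T> a) x * (fluct u a x * fluct u a x))
    \<le> \<beta> * (h_vertex \<T> a * I (\<lambda>x. indicator (patch \<T> a) x * (D u x)\<^sup>2))" by (simp add: mult.assoc)
qed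

text \<open>Almost every point lies in the patches of exactly three vertices, and each
  \<open>h_vertex\<close> is at most \<zeta> times the local diameter: the origin of the factor
  \<open>3 * \<zeta>\<close>.\<close>

lemma patch_D_le: "(\<Sum>a\<in>vertices \<T>. h_vertex \<T> a * I (\<lambda>x. indicator (patch \<T> a) x * (D u x)\<^sup>2)) \<le> 3 * \<zeta> * X u"
proof -
  have "(\<Sum>a\<in>vertices \<T>. h_vertex \<T> a * I (\<lambda>x. indicator (patch \<T> a) x * (D u x)\<^sup>2))
    = I (\<lambda>x. \<Sum>a\<in>vertices \<T>. indicator (patch \<T> a) x * (h_vertex \<T> a * (D u x)\<^sup>2))"
    by (rule patch_sum_integral(1)) (intro bdd_meas_power2 bdd_meas_D)
  also have "\<dots> \<le> I (\<lambda>x. (3 * \<zeta>) * (h_fun \<T> x * (D u x)\<^sup>2))"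
  proof (rule I_mono)
    show "bdd_meas (\<lambda>x. \<Sum>a\<in>vertices \<T>. indicator (patch \<T> a) x * (h_vertex \<T> a * (D u x)\<^sup>2))"
      by (intro bdd_meas_sum bdd_meas_patch bdd_meas_mult bdd_meas_const bdd_meas_power2 bdd_meas_D)
    show "bdd_meas (\<lambda>x. (3 * \<zeta>) * (h_fun \<T> x * (D u x)\<^sup>2))" by (intro bdd_meas_mult bdd_meas_const bdd_meas_power2 bdd_meas_D bdd_meas_h_fun)
    show "AE x in lebesgue_on (closure \<Omega>). (\<Sum>a\<in>vertices \<T>. indicator (patch \<T> a) x * (h_vertex \<T> a * (D u x)\<^sup>2)) \<le> (3 * \<zeta>) * (h_fun \<T> x * (D u x)\<^sup>2)"
      using AE_interior_mesh
    proof eventually_elim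
      fix x assume "\<exists>K\<in>\<T>. x \<in> interior K"
      then obtain K where K: "K \<in> \<T>" "x \<in> interior K" by auto
      have "(\<Sum>a\<in>verts K. h_vertex \<T> a) \<le> (\<Sum>a\<in>verts K. \<zeta> * diameter K)"
        by (intro sum_mono h_vertex_bounds(2)[OF K(1)])
      then have "(\<Sum>a\<in>verts K. h_vertex \<T> a) \<le> 3 * \<zeta> * diameter K" using verts_mesh(1)[OF K(1)] by simp
      then have "(\<Sum>a\<in>verts K. h_vertex \<T> a) * (D u x)\<^sup>2 \<le> (3 * \<zeta> * diameter K) * (D u x)\<^sup>2" by (rule mult_right_mono) simp
      then show "(\<Sum>a\<in>vertices \<T>. indicator (patch \<T> a) x * (h_vertex \<T> a * (D u x)\<^sup>2)) \<le> (3 * \<zeta>) * (h_fun \<T> x * (D u x)\<^sup>2)"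
        unfolding patch_sum[OF K(2,1)] h_fun_interior[OF K(2,1)] by (simp add: sum_distrib_right mult_ac)
    qed
  qed
  also have "\<dots> = 3 * \<zeta> * X u" unfolding I_cmult X_def ..
  finally show ?thesis .
qed

lemma Q_le: "Q u \<le> 3 * \<zeta> * X u"
proof -
  have "Q u \<le> (\<Sum>a\<in>vertices \<T>. h_vertex \<T> a * I (\<lambda>x. indicator (patch \<T> a) x * (D u x)\<^sup>2))"
    unfolding Q_def mult.assoc
    by (intro sum_mono mult_left_mono avg_le less_imp_le vertex_h_pos)
  then show ?thesis using patch_D_le[of u] by linarith
qed

lemma S_X: "S u u \<le> 3 * \<zeta> * \<beta> * X u"
proof -
  have "S u u \<le> \<beta> * (3 * \<zeta> * X u)"
    using beta by (intro order_trans[OF S_le] mult_left_mono patch_D_le) simp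
  then show ?thesis by (simp add: mult_ac)
qed

lemma Q_integral:
  shows "Q u = I (\<lambda>x. \<Sum>a\<in>vertices \<T>. indicator (patch \<T> a) x * (h_vertex \<T> a * (avg u a)\<^sup>2))"
    "bdd_meas (\<lambda>x. \<Sum>a\<in>vertices \<T>. indicator (patch \<T> a) x * (h_vertex \<T> a * (avg u a)\<^sup>2))"
proof -
  have "Q u = (\<Sum>a\<in>vertices \<T>. (h_vertex \<T> a * (avg u a)\<^sup>2) * I (\<lambda>x. indicator (patch \<T> a) x * 1))"
    unfolding Q_def measure_patch by simp
  also have "\<dots> = I (\<lambda>x. \<Sum>a\<in>vertices \<T>. indicator (patch \<T> a) x * (h_vertex \<T> a * (avg u a)\<^sup>2 * 1))"
    by (rule patch_sum_integral(1)[OF bdd_meas_const])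
  finally show "Q u = I (\<lambda>x. \<Sum>a\<in>vertices \<T>. indicator (patch \<T> a) x * (h_vertex \<T> a * (avg u a)\<^sup>2))" by simp
  show "bdd_meas (\<lambda>x. \<Sum>a\<in>vertices \<T>. indicator (patch \<T> a) x * (h_vertex \<T> a * (avg u a)\<^sup>2))"
    by (intro bdd_meas_sum bdd_meas_patch bdd_meas_const)
qed

text \<open>The pointwise form in \<open>Q_integral\<close> serves area integrals; this form by
  triangles serves the boundary, where each edge is charged to a triangle.\<close>

lemma Q_mesh: "Q u = (\<Sum>K\<in>\<T>. measure lebesgue K * (\<Sum>a\<in>verts K. h_vertex \<T> a * (avg u a)\<^sup>2))"
proof -
  let ?f = "\<lambda>x. \<Sum>a\<in>vertices \<T>. indicator (patch \<T> a) x * (h_vertex \<T> a * (avg u a)\<^sup>2)"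
  have "Q u = (\<Sum>K\<in>\<T>. LINT x|lebesgue_on K. ?f x)"
    unfolding Q_integral(1) by (rule integral_mesh[OF bdd_meas_integrable[OF Q_integral(2)]])
  also have "\<dots> = (\<Sum>K\<in>\<T>. measure lebesgue K * (\<Sum>a\<in>verts K. h_vertex \<T> a * (avg u a)\<^sup>2))"
  proof (rule sum.cong[OF refl])
    fix K assume K: "K \<in> \<T>"
    have "(LINT x|lebesgue_on K. ?f x) = (LINT x|lebesgue_on K. (\<Sum>a\<in>verts K. h_vertex \<T> a * (avg u a)\<^sup>2))"
      by (rule lebesgue_on_cong_AE(3)[OF mesh_sets[OF K]])
         (use AE_interior_convex[OF mesh_convex[OF K] mesh_sets[OF K]] in eventually_elim, rule patch_sum[OF _ K])
    also have "\<dots> = measure lebesgue K * (\<Sum>a\<in>verts K. h_vertex \<T> a * (avg u a)\<^sup>2)"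
      using K by (simp add: measure_restrict_space)
    finally show "(LINT x|lebesgue_on K. ?f x) = measure lebesgue K * (\<Sum>a\<in>verts K. h_vertex \<T> a * (avg u a)\<^sup>2)" .
  qed
  finally show ?thesis .
qed

end

section \<open>Norm bounds for the corrector\<close>

locale corrector = advection +
  fixes u w :: "real^2 \<Rightarrow> real"
  assumes u: "pw_linear u" and w: "pw_linear w" and nodal: "\<And>K a. K \<in> \<T> \<Longrightarrow> a \<in> verts K \<Longrightarrow> w a = h_vertex \<T> a * avg u a"
begin

text \<open>Of the two factors \<open>h_vertex\<close> in the square, one stays in \<open>Q\<close>
  and the other becomes \<zeta> times the diameter. This spare power of the mesh size pays for the
  inverse and trace estimates.\<close>

lemma nodal_square:
  assumes "K \<in> \<T>" "a \<in> verts K"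
  shows "(w a)\<^sup>2 \<le> \<zeta> * diameter K * (h_vertex \<T> a * (avg u a)\<^sup>2)"
proof -
  note h = h_vertex_bounds[OF assms]
  have "(w a)\<^sup>2 = h_vertex \<T> a * (h_vertex \<T> a * (avg u a)\<^sup>2)"
    unfolding nodal[OF assms] by (simp add: power2_eq_square mult_ac)
  also have "\<dots> \<le> (\<zeta> * diameter K) * (h_vertex \<T> a * (avg u a)\<^sup>2)"
    using h by (intro mult_right_mono) auto
  finally show ?thesis .
qed

lemma nodal_square_sum:
  assumes "K \<in> \<T>"
  shows "(\<Sum>a\<in>verts K. (w a)\<^sup>2) \<le> \<zeta> * diameter K * (\<Sum>a\<in>verts K. h_vertex \<T> a * (avg u a)\<^sup>2)"
  unfolding sum_distrib_left by (intro sum_mono nodal_square assms)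

lemma h_avg_nonneg: "K \<in> \<T> \<Longrightarrow> 0 \<le> (\<Sum>a\<in>verts K. h_vertex \<T> a * (avg u a)\<^sup>2)"
  using h_vertex_bounds(3) by (intro sum_nonneg mult_nonneg_nonneg) (auto intro: less_imp_le)

text \<open>The spare power of the mesh size is simply bounded by \<open>d\<close>, the bound for
  all diameters.\<close>

lemma L2_bound: "I (\<lambda>x. (w x)\<^sup>2) \<le> \<zeta> * d * Q u"
proof -
  have "I (\<lambda>x. (w x)\<^sup>2) \<le> I (\<lambda>x. (\<zeta> * d) * (\<Sum>a\<in>vertices \<T>. indicator (patch \<T> a) x * (h_vertex \<T> a * (avg u a)\<^sup>2)))"
  proof (rule I_mono)
    show "bdd_meas (\<lambda>x. (w x)\<^sup>2)" by (intro bdd_meas_power2 bdd_meas_continuous pw_linear_continuous w)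
    show "bdd_meas (\<lambda>x. (\<zeta> * d) * (\<Sum>a\<in>vertices \<T>. indicator (patch \<T> a) x * (h_vertex \<T> a * (avg u a)\<^sup>2)))"
      by (intro bdd_meas_mult[OF bdd_meas_const] Q_integral)
    show "AE x in lebesgue_on (closure \<Omega>). (w x)\<^sup>2 \<le> (\<zeta> * d) * (\<Sum>a\<in>vertices \<T>. indicator (patch \<T> a) x * (h_vertex \<T> a * (avg u a)\<^sup>2))"
      using AE_interior_mesh
    proof eventually_elim
      fix x assume "\<exists>K\<in>\<T>. x \<in> interior K"
      then obtain K where K: "K \<in> \<T>" "x \<in> interior K" by auto
      have "(w x)\<^sup>2 \<le> (\<Sum>a\<in>verts K. (w a)\<^sup>2)" using pw_linear_square_bound[OF w K(1)] K(2) interior_subset by blast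
      also have "\<dots> \<le> \<zeta> * diameter K * (\<Sum>a\<in>verts K. h_vertex \<T> a * (avg u a)\<^sup>2)" by (rule nodal_square_sum[OF K(1)])
      also have "\<dots> \<le> \<zeta> * d * (\<Sum>a\<in>verts K. h_vertex \<T> a * (avg u a)\<^sup>2)"
        using \<zeta>(1) d(2)[OF K(1)] by (intro mult_right_mono mult_left_mono h_avg_nonneg[OF K(1)]) auto
      finally show "(w x)\<^sup>2 \<le> (\<zeta> * d) * (\<Sum>a\<in>vertices \<T>. indicator (patch \<T> a) x * (h_vertex \<T> a * (avg u a)\<^sup>2))"
        unfolding patch_sum[OF K(2,1)] .
    qed
  qed
  also have "\<dots> = \<zeta> * d * Q u" unfolding I_cmult Q_integral(1) ..
  finally show ?thesis .
qed

text \<open>The powers of the diameter balance: the inverse estimate loses two, the weight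
  \<open>h_fun\<close> returns one and the nodal values return the other.\<close>

lemma X_bound: "X w \<le> 4 * \<sigma>\<^sup>2 * \<zeta> * B\<^sup>2 * Q u"
proof -
  let ?C = "4 * \<sigma>\<^sup>2 * \<zeta> * B\<^sup>2"
  have "X w \<le> I (\<lambda>x. ?C * (\<Sum>a\<in>vertices \<T>. indicator (patch \<T> a) x * (h_vertex \<T> a * (avg u a)\<^sup>2)))"
    unfolding X_def
  proof (rule I_mono)
    show "bdd_meas (\<lambda>x. h_fun \<T> x * (D w x)\<^sup>2)" by (intro bdd_meas_mult bdd_meas_h_fun bdd_meas_power2 bdd_meas_D)
    show "bdd_meas (\<lambda>x. ?C * (\<Sum>a\<in>vertices \<T>. indicator (patch \<T> a) x * (h_vertex \<T> a * (avg u a)\<^sup>2)))"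
      by (intro bdd_meas_mult[OF bdd_meas_const] Q_integral)
    show "AE x in lebesgue_on (closure \<Omega>). h_fun \<T> x * (D w x)\<^sup>2 \<le> ?C * (\<Sum>a\<in>vertices \<T>. indicator (patch \<T> a) x * (h_vertex \<T> a * (avg u a)\<^sup>2))"
      using AE_interior_mesh
    proof eventually_elim
      fix x assume "\<exists>K\<in>\<T>. x \<in> interior K"
      then obtain K where K: "K \<in> \<T>" "x \<in> interior K" by auto
      let ?h = "diameter K" and ?g = "norm (pgrad K w)" and ?S = "\<Sum>a\<in>verts K. h_vertex \<T> a * (avg u a)\<^sup>2"
      have h: "0 < ?h" by (rule verts_mesh(5)[OF K(1)])
      have "x \<in> closure \<Omega>" using K interior_subset mesh_subset by blast
      then have "\<bar>D w x\<bar> \<le> B * ?g"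
        unfolding D_def pw_grad_interior[OF K(2,1)]
        using Cauchy_Schwarz_ineq2[of "b x" "pgrad K w"] mult_right_mono[OF B(2)[of x], of ?g] by auto
      then have "\<bar>D w x\<bar>\<^sup>2 \<le> (B * ?g)\<^sup>2" by (rule power_mono) simp
      then have D2: "(D w x)\<^sup>2 \<le> B\<^sup>2 * ?g\<^sup>2" by (simp add: power_mult_distrib)
      have "?h * (?h * ?g\<^sup>2) \<le> 4 * \<sigma>\<^sup>2 * (\<Sum>a\<in>verts K. (w a)\<^sup>2)"
        using pgrad_bound[OF w K(1)] by (simp add: power2_eq_square mult.assoc)
      also have "\<dots> \<le> 4 * \<sigma>\<^sup>2 * (\<zeta> * ?h * ?S)"
        by (intro mult_left_mono nodal_square_sum[OF K(1)]) simp
      also have "\<dots> = ?h * (4 * \<sigma>\<^sup>2 * \<zeta> * ?S)" by simp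
      finally have hg: "?h * ?g\<^sup>2 \<le> 4 * \<sigma>\<^sup>2 * \<zeta> * ?S" using h by (simp only: mult_le_cancel_left_pos)
      have "?h * (D w x)\<^sup>2 \<le> ?h * (B\<^sup>2 * ?g\<^sup>2)" using D2 h by (intro mult_left_mono) auto
      also have "\<dots> = B\<^sup>2 * (?h * ?g\<^sup>2)" by simp
      also have "\<dots> \<le> B\<^sup>2 * (4 * \<sigma>\<^sup>2 * \<zeta> * ?S)" by (intro mult_left_mono hg) simp
      also have "\<dots> = ?C * ?S" by simp
      finally show "h_fun \<T> x * (D w x)\<^sup>2 \<le> ?C * (\<Sum>a\<in>vertices \<T>. indicator (patch \<T> a) x * (h_vertex \<T> a * (avg u a)\<^sup>2))"
        unfolding patch_sum[OF K(2,1)] h_fun_interior[OF K(2,1)] .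
    qed
  qed
  also have "\<dots> = ?C * Q u" unfolding I_cmult Q_integral(1) ..
  finally show ?thesis .
qed

text \<open>A discrete trace estimate: the length of the edge and the nodal values contribute one
  power of the diameter each, and \<open>diameter_area\<close> turns the square into an area. The
  constant is \<open>B / 2\<close> times \<open>4 * \<sigma>\<^sup>2 * \<zeta> / pi\<close>, times 3
  for the edges of a triangle.\<close>

lemma bdry_energy_bound: "bdry_energy w \<le> 6 * B * \<zeta> * \<sigma>\<^sup>2 / pi * Q u"
proof -
  let ?c = "2 * B * \<zeta> * \<sigma>\<^sup>2 / pi"
  define F where "F K = measure lebesgue K * (\<Sum>a\<in>verts K. h_vertex \<T> a * (avg u a)\<^sup>2)" for K
  have F: "0 \<le> F K" if "K \<in> \<T>" for K unfolding F_def using h_avg_nonneg[OF that] by simp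
  have edge: "edge_integral E (\<lambda>x. \<bar>b x \<bullet> outward_normal \<Omega> x\<bar> / 2 * (w x)\<^sup>2) \<le> ?c * (\<Sum>K | K \<in> \<T> \<and> E edge_of K. F K)"
    if E: "E \<in> boundary_edges \<Omega> \<T>" for E
  proof -
    obtain K p q n where K: "K \<in> \<T>" "E edge_of K" and e: "edge_ends E = (p, q)" and sub: "closed_segment p q \<subseteq> K" and n: "norm n = 1"
      and on: "\<And>t. 0 < t \<Longrightarrow> t < 1 \<Longrightarrow> outward_normal \<Omega> (linepath p q t) = n"
      by (rule boundary_edge_normal[OF E]) blast
    let ?W = "\<Sum>a\<in>verts K. (w a)\<^sup>2" and ?S = "\<Sum>a\<in>verts K. h_vertex \<T> a * (avg u a)\<^sup>2" and ?h = "diameter K"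
    have W: "0 \<le> ?W" by (intro sum_nonneg) simp
    have int: "integrable (lebesgue_on {0..1}) (\<lambda>t. \<bar>b (linepath p q t) \<bullet> outward_normal \<Omega> (linepath p q t)\<bar> / 2 * (w (linepath p q t))\<^sup>2)"
      by (rule bdry_cont_integrable[OF bdry_cont_form(1)[OF w w] E e])
    have "(LINT t|lebesgue_on {0..1}. \<bar>b (linepath p q t) \<bullet> outward_normal \<Omega> (linepath p q t)\<bar> / 2 * (w (linepath p q t))\<^sup>2)
       \<le> (LINT t|lebesgue_on {0..1::real}. B / 2 * ?W)"
    proof (rule integral_mono_AE[OF int])
      have ae: "AE t in lebesgue_on {0..1::real}. t \<in> {0..1}" by (intro AE_I2) simp
      show "AE t in lebesgue_on {0..1}. \<bar>b (linepath p q t) \<bullet> outward_normal \<Omega> (linepath p q t)\<bar> / 2 * (w (linepath p q t))\<^sup>2 \<le> B / 2 * ?W"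
        using AE_unit_open ae
      proof eventually_elim
        fix t :: real assume t: "0 < t \<and> t < 1" "t \<in> {0..1}"
        have x: "linepath p q t \<in> K" using linepath_in_path[OF t(2), of p q] sub by blast
        then have "norm (b (linepath p q t)) \<le> B" using B(2) mesh_subset K(1) by blast
        then have "\<bar>b (linepath p q t) \<bullet> n\<bar> \<le> B" using Cauchy_Schwarz_ineq2[of "b (linepath p q t)" n] n by simp
        then have "\<bar>b (linepath p q t) \<bullet> outward_normal \<Omega> (linepath p q t)\<bar> / 2 \<le> B / 2" using on t by simp
        then show "\<bar>b (linepath p q t) \<bullet> outward_normal \<Omega> (linepath p q t)\<bar> / 2 * (w (linepath p q t))\<^sup>2 \<le> B / 2 * ?W"
          using B(1) by (intro mult_mono pw_linear_square_bound[OF w K(1) x]) auto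
      qed
    qed (intro finite_measure.integrable_const finite_measure_lebesgue_on, simp)
    also have "\<dots> = B / 2 * ?W" by (simp add: measure_restrict_space)
    finally have 1: "edge_integral E (\<lambda>x. \<bar>b x \<bullet> outward_normal \<Omega> x\<bar> / 2 * (w x)\<^sup>2) \<le> norm (q - p) * (B / 2 * ?W)"
      unfolding edge_integral_eq[OF e] by (intro mult_left_mono) auto
    have "p \<in> K" "q \<in> K" using sub by auto
    then have "norm (q - p) \<le> ?h"
      using diameter_bounded_bound[OF compact_imp_bounded[OF mesh_compact[OF K(1)]], of q p] by (simp add: dist_norm)
    then have "norm (q - p) * (B / 2 * ?W) \<le> ?h * (B / 2 * ?W)"
      using B(1) W by (intro mult_right_mono) auto
    also have "\<dots> \<le> ?h * (B / 2 * (\<zeta> * ?h * ?S))"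
      using B(1) verts_mesh(5)[OF K(1)] by (intro mult_left_mono nodal_square_sum[OF K(1)]) auto
    also have "\<dots> = (B / 2 * \<zeta>) * ?S * ?h\<^sup>2" by (simp add: power2_eq_square)
    also have "\<dots> \<le> (B / 2 * \<zeta>) * ?S * (4 * \<sigma>\<^sup>2 / pi * measure lebesgue K)"
      using B(1) \<zeta>(1) h_avg_nonneg[OF K(1)] by (intro mult_left_mono diameter_area[OF K(1)]) auto
    also have "\<dots> = ?c * F K" by (simp add: F_def)
    \<comment> \<open>Adding nonnegative terms for all triangles at the edge brings the bound into a
      form in which the sums can be exchanged.\<close>
    also have "\<dots> \<le> ?c * (\<Sum>K | K \<in> \<T> \<and> E edge_of K. F K)"
    proof (rule mult_left_mono)
      show "F K \<le> (\<Sum>K | K \<in> \<T> \<and> E edge_of K. F K)"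
        using K F finite_mesh by (intro member_le_sum) auto
    qed (use B(1) \<zeta>(1) in simp)
    finally show ?thesis using 1 by linarith
  qed
  have c: "0 \<le> ?c" using B(1) \<zeta>(1) by simp
  let ?A = "\<Union>K\<in>\<T>. {E. E edge_of K}"
  \<comment> \<open>Summed over all edges, each triangle is counted at most three times.\<close>
  have "(\<Sum>E\<in>?A. \<Sum>K | K \<in> \<T> \<and> E edge_of K. F K) = (\<Sum>K\<in>\<T>. \<Sum>E | E \<in> ?A \<and> E edge_of K. F K)"
    by (rule sum.swap_restrict[OF finite_all_edges finite_mesh])
  also have "\<dots> \<le> (\<Sum>K\<in>\<T>. 3 * F K)"
  proof (rule sum_mono)
    fix K assume K: "K \<in> \<T>"
    obtain p q r where t: "triangle p q r K" by (rule mesh_tri[OF K])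
    have "{E. E \<in> ?A \<and> E edge_of K} \<subseteq> {closed_segment p q, closed_segment q r, closed_segment r p}"
      using triangle_edge[OF t] by blast
    then have "card {E. E \<in> ?A \<and> E edge_of K} \<le> card {closed_segment p q, closed_segment q r, closed_segment r p}"
      by (intro card_mono) auto
    also have "\<dots> \<le> 3" by (simp add: card_insert_if)
    finally have "real (card {E. E \<in> ?A \<and> E edge_of K}) * F K \<le> 3 * F K" using F[OF K] by (intro mult_right_mono) auto
    then show "(\<Sum>E | E \<in> ?A \<and> E edge_of K. F K) \<le> 3 * F K" by simp
  qed
  also have "\<dots> = 3 * Q u" unfolding Q_mesh F_def by (simp add: sum_distrib_left)
  finally have A: "(\<Sum>E\<in>?A. \<Sum>K | K \<in> \<T> \<and> E edge_of K. F K) \<le> 3 * Q u" .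
  have "bdry_energy w \<le> (\<Sum>E\<in>boundary_edges \<Omega> \<T>. ?c * (\<Sum>K | K \<in> \<T> \<and> E edge_of K. F K))"
    unfolding bdry_energy_def bdry_int_def by (intro sum_mono edge)
  also have "\<dots> = ?c * (\<Sum>E\<in>boundary_edges \<Omega> \<T>. \<Sum>K | K \<in> \<T> \<and> E edge_of K. F K)" by (simp add: sum_distrib_left)
  also have "\<dots> \<le> ?c * (\<Sum>E\<in>?A. \<Sum>K | K \<in> \<T> \<and> E edge_of K. F K)"
    using F by (intro mult_left_mono[OF _ c] sum_mono2 finite_all_edges boundary_edges_subset sum_nonneg) auto
  also have "\<dots> \<le> ?c * (3 * Q u)" by (rule mult_left_mono[OF A c])
  finally show ?thesis by simp
qed

end

context corrector
begin

text \<open>On a triangle \<open>w\<close> is the combination, with convex weights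
  \<open>l a\<close>, of \<open>h_vertex \<T> a * avg u a\<close>. The product of
  \<open>D u x\<close> with a mean is at least half its square minus half the squared fluctuation.
  Quasi-uniformity bounds \<open>h_vertex\<close> below by the diameter over \<zeta>, and the
  integrated fluctuations add up to the stabilization without its factor \<beta>.\<close>

lemma streamline_bound: "X u / (2 * \<zeta>) - S u u / (2 * \<beta>) \<le> I (\<lambda>x. D u x * w x)"
proof -
  let ?g = "\<lambda>x. \<Sum>a\<in>vertices \<T>. indicator (patch \<T> a) x * ((h_vertex \<T> a / 2) * (fluct u a x * fluct u a x))"
  have bk: "bdd_meas (\<lambda>x. fluct u a x * fluct u a x)" for a by (intro bdd_meas_mult bdd_meas_kp)
  have bg: "bdd_meas ?g" by (rule patch_sum_integral(2)[OF bk])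
  have bh: "bdd_meas (\<lambda>x. h_fun \<T> x * (D u x)\<^sup>2)" by (intro bdd_meas_mult bdd_meas_h_fun bdd_meas_power2 bdd_meas_D)
  have bw': "bdd_meas (\<lambda>x. D u x * w x)" by (intro bdd_meas_mult bdd_meas_D bdd_meas_continuous pw_linear_continuous w)
  have "I ?g = (\<Sum>a\<in>vertices \<T>. (h_vertex \<T> a / 2) * I (\<lambda>x. indicator (patch \<T> a) x * (fluct u a x * fluct u a x)))"
    by (rule patch_sum_integral(1)[OF bk, symmetric])
  also have "\<dots> = S u u / (2 * \<beta>)"
    unfolding S_def sum_divide_distrib using beta by (intro sum.cong) auto
  finally have Ig: "I ?g = S u u / (2 * \<beta>)" .
  have "I (\<lambda>x. 1 / (2 * \<zeta>) * (h_fun \<T> x * (D u x)\<^sup>2)) \<le> I (\<lambda>x. D u x * w x + ?g x)"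
  proof (rule I_mono[OF bdd_meas_mult[OF bdd_meas_const bh] bdd_meas_add[OF bw' bg]])
    show "AE x in lebesgue_on (closure \<Omega>). 1 / (2 * \<zeta>) * (h_fun \<T> x * (D u x)\<^sup>2) \<le> D u x * w x + ?g x"
      using AE_interior_mesh
    proof eventually_elim
      fix x assume "\<exists>K\<in>\<T>. x \<in> interior K"
      then obtain K where K: "K \<in> \<T>" "x \<in> interior K" by auto
      then have xK: "x \<in> K" using interior_subset by blast
      let ?h = "diameter K" and ?D = "D u x"
      obtain l where l: "\<And>a. a \<in> verts K \<Longrightarrow> 0 \<le> l a" "sum l (verts K) = 1" "w x = (\<Sum>a\<in>verts K. l a * w a)"
        by (rule pw_linear_convex_combination[OF w K(1) xK]) blast
      have "l a * (?h / \<zeta> * (?D\<^sup>2 / 2)) \<le> ?D * (l a * w a) + h_vertex \<T> a / 2 * (fluct u a x * fluct u a x)"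
        if a: "a \<in> verts K" for a
      proof -
        note hb = h_vertex_bounds[OF K(1) a]
        \<comment> \<open>The convex weights have to leave the fluctuation terms, since
          \<open>S\<close> carries none.\<close>
        have l1: "l a \<le> 1" using member_le_sum[of a "verts K" l] l a verts_mesh(3)[OF K(1)] by auto
        have "?h / \<zeta> \<le> h_vertex \<T> a" using hb(1) \<zeta>(1) by (simp add: field_simps)
        then have "l a * (?h / \<zeta> * (?D\<^sup>2 / 2)) \<le> l a * (h_vertex \<T> a * (?D\<^sup>2 / 2))"
          using l(1)[OF a] by (intro mult_left_mono mult_right_mono) auto
        moreover have "l a * (h_vertex \<T> a * ((fluct u a x)\<^sup>2 / 2)) \<le> 1 * (h_vertex \<T> a * ((fluct u a x)\<^sup>2 / 2))"
          using l1 hb(3) by (intro mult_right_mono) auto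
        moreover have "(l a * h_vertex \<T> a) * (?D\<^sup>2 / 2 - (fluct u a x)\<^sup>2 / 2) \<le> (l a * h_vertex \<T> a) * (?D * avg u a)"
        proof (rule mult_left_mono)
          \<comment> \<open>Polarization, with \<open>k\<close> the fluctuation; the last square,
            that of the mean, is then dropped.\<close>
          have "?D * (?D - k) = ?D\<^sup>2 / 2 - k\<^sup>2 / 2 + (?D - k)\<^sup>2 / 2" for k
            by (simp add: power2_eq_square field_simps)
          moreover have "avg u a = ?D - fluct u a x" by (simp add: fluct_def)
          moreover have "0 \<le> (?D - fluct u a x)\<^sup>2" by simp
          ultimately show "?D\<^sup>2 / 2 - (fluct u a x)\<^sup>2 / 2 \<le> ?D * avg u a" by simp
        qed (use l(1)[OF a] hb(3) in simp)
        moreover have "(l a * h_vertex \<T> a) * (?D * avg u a) = ?D * (l a * w a)" unfolding nodal[OF K(1) a] by simp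
        moreover have "(l a * h_vertex \<T> a) * (?D\<^sup>2 / 2 - (fluct u a x)\<^sup>2 / 2) = l a * (h_vertex \<T> a * (?D\<^sup>2 / 2)) - l a * (h_vertex \<T> a * ((fluct u a x)\<^sup>2 / 2))"
          by (simp only: right_diff_distrib mult.assoc)
        moreover have "1 * (h_vertex \<T> a * ((fluct u a x)\<^sup>2 / 2)) = h_vertex \<T> a / 2 * (fluct u a x * fluct u a x)"
          by (simp add: power2_eq_square)
        ultimately show ?thesis by linarith
      qed
      then have "(\<Sum>a\<in>verts K. l a * (?h / \<zeta> * (?D\<^sup>2 / 2))) \<le> (\<Sum>a\<in>verts K. ?D * (l a * w a) + h_vertex \<T> a / 2 * (fluct u a x * fluct u a x))"
        by (rule sum_mono)
      also have "\<dots> = ?D * w x + (\<Sum>a\<in>verts K. h_vertex \<T> a / 2 * (fluct u a x * fluct u a x))"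
        unfolding l(3) by (simp add: sum.distrib sum_distrib_left)
      also have "(\<Sum>a\<in>verts K. l a * (?h / \<zeta> * (?D\<^sup>2 / 2))) = 1 / (2 * \<zeta>) * (?h * ?D\<^sup>2)"
        unfolding sum_distrib_right[symmetric] l(2) by simp
      finally show "1 / (2 * \<zeta>) * (h_fun \<T> x * (D u x)\<^sup>2) \<le> D u x * w x + ?g x"
        unfolding patch_sum[OF K(2,1)] h_fun_interior[OF K(2,1)] .
    qed
  qed
  then have "1 / (2 * \<zeta>) * X u \<le> I (\<lambda>x. D u x * w x) + S u u / (2 * \<beta>)"
    unfolding I_cmult I_add[OF bw' bg] Ig X_def .
  then show ?thesis by simp
qed

end

section \<open>The remaining terms of the form, tested with the corrector\<close>

context advection
begin

text \<open>Young's inequality with \<open>\<mu> x * u x\<close> in the first slot, so that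
  \<open>M\<close> enters squared and only next to \<open>u\<close>.\<close>

lemma reaction_bound:
  assumes u: "pw_linear u" and w: "pw_linear w" and t: "t > 0"
  shows "- (M\<^sup>2 / t * I (\<lambda>x. (u x)\<^sup>2) + t * I (\<lambda>x. (w x)\<^sup>2)) \<le> I (\<lambda>x. \<mu> x * u x * w x)"
proof -
  note bu = bdd_meas_continuous[OF pw_linear_continuous[OF u]] note bw' = bdd_meas_continuous[OF pw_linear_continuous[OF w]]
  have b: "bdd_meas (\<lambda>x. M\<^sup>2 / t * (u x)\<^sup>2)" "bdd_meas (\<lambda>x. t * (w x)\<^sup>2)" "bdd_meas (\<lambda>x. (- 1) * (\<mu> x * u x * w x))"
    by (intro bdd_meas_mult bdd_meas_const bdd_meas_power2 bu bw' bdd_meas_mu)+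
  have "I (\<lambda>x. (- 1) * (\<mu> x * u x * w x)) \<le> I (\<lambda>x. M\<^sup>2 / t * (u x)\<^sup>2 + t * (w x)\<^sup>2)"
  proof (rule I_mono[OF b(3) bdd_meas_add[OF b(1,2)]])
    show "AE x in lebesgue_on (closure \<Omega>). (- 1) * (\<mu> x * u x * w x) \<le> M\<^sup>2 / t * (u x)\<^sup>2 + t * (w x)\<^sup>2"
      using M(2) unfolding domain_closure
    proof eventually_elim
      fix x assume "\<bar>\<mu> x\<bar> \<le> M"
      then have "\<bar>\<mu> x\<bar>\<^sup>2 \<le> M\<^sup>2" by (rule power_mono) simp
      then have "(\<mu> x)\<^sup>2 * (u x)\<^sup>2 / t \<le> M\<^sup>2 * (u x)\<^sup>2 / t" using t by (intro divide_right_mono mult_right_mono) auto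
      then show "(- 1) * (\<mu> x * u x * w x) \<le> M\<^sup>2 / t * (u x)\<^sup>2 + t * (w x)\<^sup>2"
        using young[OF t, of "\<mu> x * u x" "w x"] by (simp add: power_mult_distrib)
    qed
  qed
  then show ?thesis unfolding I_add[OF b(1,2)] I_cmult by linarith
qed

text \<open>Young's inequality pointwise, with \<open>neg_part z \<le> |z|\<close>; the factors 2
  compensate the \<open>|z| / 2\<close> in the boundary energy.\<close>

lemma boundary_bound:
  assumes u: "pw_linear u" and w: "pw_linear w" and t: "t > 0"
  shows "- (2 / t * bdry_energy u + 2 * t * bdry_energy w) \<le> inflow_form u w"
proof -
  note c = pw_linear_continuous[OF u] pw_linear_continuous[OF w] bc
  have b: "bdry_cont (\<lambda>x. 2 / t * (\<bar>b x \<bullet> outward_normal \<Omega> x\<bar> / 2 * (u x)\<^sup>2))"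
    by (rule bdry_contI[of "\<lambda>n x. 2 / t * (\<bar>b x \<bullet> n\<bar> / 2 * (u x)\<^sup>2)"]) (intro continuous_intros c; simp)
  have b': "bdry_cont (\<lambda>x. 2 * t * (\<bar>b x \<bullet> outward_normal \<Omega> x\<bar> / 2 * (w x)\<^sup>2))"
    by (rule bdry_contI[of "\<lambda>n x. 2 * t * (\<bar>b x \<bullet> n\<bar> / 2 * (w x)\<^sup>2)"]) (intro continuous_intros c; simp)
  have bs: "bdry_cont (\<lambda>x. 2 / t * (\<bar>b x \<bullet> outward_normal \<Omega> x\<bar> / 2 * (u x)\<^sup>2) + 2 * t * (\<bar>b x \<bullet> outward_normal \<Omega> x\<bar> / 2 * (w x)\<^sup>2))"
    by (rule bdry_contI[of "\<lambda>n x. 2 / t * (\<bar>b x \<bullet> n\<bar> / 2 * (u x)\<^sup>2) + 2 * t * (\<bar>b x \<bullet> n\<bar> / 2 * (w x)\<^sup>2)"]) (intro continuous_intros c; simp)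
  have bn: "bdry_cont (\<lambda>x. (- 1) * (neg_part (b x \<bullet> outward_normal \<Omega> x) * u x * w x))"
    by (rule bdry_contI[of "\<lambda>n x. (- 1) * (neg_part (b x \<bullet> n) * u x * w x)"]) (unfold neg_part_def, intro continuous_intros c; simp)
  have "bdry_int (\<lambda>x. (- 1) * (neg_part (b x \<bullet> outward_normal \<Omega> x) * u x * w x))
    \<le> bdry_int (\<lambda>x. 2 / t * (\<bar>b x \<bullet> outward_normal \<Omega> x\<bar> / 2 * (u x)\<^sup>2) + 2 * t * (\<bar>b x \<bullet> outward_normal \<Omega> x\<bar> / 2 * (w x)\<^sup>2))"
  proof (rule bdry_int_mono[OF bn bs])
    fix x
    let ?z = "b x \<bullet> outward_normal \<Omega> x" and ?y = "(u x)\<^sup>2 / t + t * (w x)\<^sup>2"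
    have n: "0 \<le> neg_part ?z" "neg_part ?z \<le> \<bar>?z\<bar>" by (auto simp: neg_part_def)
    have y: "0 \<le> ?y" using t by simp
    have "neg_part ?z * (- (u x * w x)) \<le> neg_part ?z * ?y" by (rule mult_left_mono[OF young[OF t] n(1)])
    also have "\<dots> \<le> \<bar>?z\<bar> * ?y" by (rule mult_right_mono[OF n(2) y])
    also have "\<dots> = 2 / t * (\<bar>?z\<bar> / 2 * (u x)\<^sup>2) + 2 * t * (\<bar>?z\<bar> / 2 * (w x)\<^sup>2)" by (simp add: algebra_simps)
    finally show "(- 1) * (neg_part ?z * u x * w x) \<le> 2 / t * (\<bar>?z\<bar> / 2 * (u x)\<^sup>2) + 2 * t * (\<bar>?z\<bar> / 2 * (w x)\<^sup>2)"
      by (simp add: mult.assoc)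
  qed
  then show ?thesis unfolding bdry_int_add[OF b b'] bdry_int_cmult bdry_energy_def inflow_form_def by linarith
qed

lemma bdd_meas_fluct_product: "bdd_meas (\<lambda>x. indicator (patch \<T> a) x * (fluct u a x * fluct v a x))"
  by (intro bdd_meas_patch bdd_meas_mult bdd_meas_kp)

text \<open>Young's inequality within each patch, then weighted by
  \<open>\<beta> * h_vertex \<T> a\<close>.\<close>

lemma stabilization_bound:
  assumes t: "t > 0" shows "- (S u u / t + t * S w w) \<le> S u w"
proof -
  have "- (\<beta> * h_vertex \<T> a * I (\<lambda>x. indicator (patch \<T> a) x * (fluct u a x * fluct w a x)))
    \<le> \<beta> * h_vertex \<T> a * I (\<lambda>x. indicator (patch \<T> a) x * (fluct u a x * fluct u a x)) / t
     + t * (\<beta> * h_vertex \<T> a * I (\<lambda>x. indicator (patch \<T> a) x * (fluct w a x * fluct w a x)))"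
    if a: "a \<in> vertices \<T>" for a
  proof -
    let ?c = "\<lambda>x. indicator (patch \<T> a) x :: real"
    have b: "bdd_meas (\<lambda>x. 1 / t * (?c x * (fluct u a x * fluct u a x)))" "bdd_meas (\<lambda>x. t * (?c x * (fluct w a x * fluct w a x)))"
      "bdd_meas (\<lambda>x. (- 1) * (?c x * (fluct u a x * fluct w a x)))"
      by (intro bdd_meas_mult[OF bdd_meas_const] bdd_meas_fluct_product)+
    have "I (\<lambda>x. (- 1) * (?c x * (fluct u a x * fluct w a x))) \<le> I (\<lambda>x. 1 / t * (?c x * (fluct u a x * fluct u a x)) + t * (?c x * (fluct w a x * fluct w a x)))"
    proof (rule I_mono[OF b(3) bdd_meas_add[OF b(1,2)] AE_I2])
      fix x
      have "?c x * (- (fluct u a x * fluct w a x)) \<le> ?c x * ((fluct u a x)\<^sup>2 / t + t * (fluct w a x)\<^sup>2)"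
        by (intro mult_left_mono young t) simp
      then show "(- 1) * (?c x * (fluct u a x * fluct w a x)) \<le> 1 / t * (?c x * (fluct u a x * fluct u a x)) + t * (?c x * (fluct w a x * fluct w a x))"
        by (simp add: power2_eq_square algebra_simps)
    qed
    then have "- I (\<lambda>x. ?c x * (fluct u a x * fluct w a x)) \<le> 1 / t * I (\<lambda>x. ?c x * (fluct u a x * fluct u a x)) + t * I (\<lambda>x. ?c x * (fluct w a x * fluct w a x))"
      unfolding I_add[OF b(1,2)] I_cmult by linarith
    then have "(\<beta> * h_vertex \<T> a) * (- I (\<lambda>x. ?c x * (fluct u a x * fluct w a x))) \<le> (\<beta> * h_vertex \<T> a) * (1 / t * I (\<lambda>x. ?c x * (fluct u a x * fluct u a x)) + t * I (\<lambda>x. ?c x * (fluct w a x * fluct w a x)))"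
      using beta vertex_h_pos[OF a] by (intro mult_left_mono) auto
    then show ?thesis by (simp add: algebra_simps)
  qed
  then have "(\<Sum>a\<in>vertices \<T>. - (\<beta> * h_vertex \<T> a * I (\<lambda>x. indicator (patch \<T> a) x * (fluct u a x * fluct w a x))))
    \<le> (\<Sum>a\<in>vertices \<T>. \<beta> * h_vertex \<T> a * I (\<lambda>x. indicator (patch \<T> a) x * (fluct u a x * fluct u a x)) / t
     + t * (\<beta> * h_vertex \<T> a * I (\<lambda>x. indicator (patch \<T> a) x * (fluct w a x * fluct w a x))))"
    by (rule sum_mono)
  then have "- S u w \<le> S u u / t + t * S w w"
    unfolding S_def by (simp only: sum.distrib sum_negf sum_divide_distrib sum_distrib_left)
  then show ?thesis by linarith
qed

lemma A_linear:
  assumes u: "pw_linear u" and v: "pw_linear v" and w: "pw_linear w"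
  shows "A u (\<lambda>x. v x + s * w x) = A u v + s * A u w"
proof -
  note bu = bdd_meas_continuous[OF pw_linear_continuous[OF u]] note bv = bdd_meas_continuous[OF pw_linear_continuous[OF v]] note bw' = bdd_meas_continuous[OF pw_linear_continuous[OF w]]
  have b1: "bdd_meas (\<lambda>x. D u x * v x)" "bdd_meas (\<lambda>x. s * (D u x * w x))" by (intro bdd_meas_mult bdd_meas_const bdd_meas_D bv bw')+
  have 1: "I (\<lambda>x. D u x * (v x + s * w x)) = I (\<lambda>x. D u x * v x) + s * I (\<lambda>x. D u x * w x)"
    using I_add[OF b1] unfolding I_cmult by (simp add: algebra_simps)
  have b2: "bdd_meas (\<lambda>x. \<mu> x * u x * v x)" "bdd_meas (\<lambda>x. s * (\<mu> x * u x * w x))" by (intro bdd_meas_mult bdd_meas_const bdd_meas_mu bu bv bw')+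
  have 2: "I (\<lambda>x. \<mu> x * u x * (v x + s * w x)) = I (\<lambda>x. \<mu> x * u x * v x) + s * I (\<lambda>x. \<mu> x * u x * w x)"
    using I_add[OF b2] unfolding I_cmult by (simp add: algebra_simps)
  have b3: "bdry_cont (\<lambda>x. s * (neg_part (b x \<bullet> outward_normal \<Omega> x) * u x * w x))"
    by (rule bdry_contI[of "\<lambda>n x. s * (neg_part (b x \<bullet> n) * u x * w x)"])
       (unfold neg_part_def, intro continuous_intros bc pw_linear_continuous u w; simp)
  have 3: "inflow_form u (\<lambda>x. v x + s * w x) = inflow_form u v + s * inflow_form u w"
    unfolding inflow_form_def using bdry_int_add[OF bdry_cont_form(2)[OF u v] b3] unfolding bdry_int_cmult by (simp add: algebra_simps)
  have 4: "S u (\<lambda>x. v x + s * w x) = S u v + s * S u w"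
    unfolding S_def sum_distrib_left sum.distrib[symmetric]
  proof (rule sum.cong[OF refl])
    fix a
    let ?c = "\<lambda>x. indicator (patch \<T> a) x :: real"
    have b: "bdd_meas (\<lambda>x. s * (?c x * (fluct u a x * fluct w a x)))" by (intro bdd_meas_mult[OF bdd_meas_const] bdd_meas_fluct_product)
    have "I (\<lambda>x. ?c x * (fluct u a x * fluct (\<lambda>x. v x + s * w x) a x)) = I (\<lambda>x. ?c x * (fluct u a x * fluct v a x)) + s * I (\<lambda>x. ?c x * (fluct u a x * fluct w a x))"
      using I_add[OF bdd_meas_fluct_product[of a u v] b] unfolding I_cmult fluct_linear[OF v w] by (simp add: algebra_simps)
    then show "\<beta> * h_vertex \<T> a * I (\<lambda>x. ?c x * (fluct u a x * fluct (\<lambda>x. v x + s * w x) a x))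
      = \<beta> * h_vertex \<T> a * I (\<lambda>x. ?c x * (fluct u a x * fluct v a x)) + s * (\<beta> * h_vertex \<T> a * I (\<lambda>x. ?c x * (fluct u a x * fluct w a x)))"
      by (simp add: algebra_simps)
  qed
  show ?thesis unfolding A_def 1 2 3 4 by (simp add: algebra_simps)
qed

text \<open>Each part of the squared norm integrates a nonnegative weight times a square, so
  \<open>sum_square_le\<close> under the integrals takes the place of a triangle inequality.\<close>

lemma LPSD_sq_sum:
  assumes u: "pw_linear u" and w: "pw_linear w"
  shows "LPSD_sq (\<lambda>x. u x + s * w x) \<le> 2 * LPSD_sq u + 2 * s\<^sup>2 * LPSD_sq w"
proof -
  note bu = bdd_meas_continuous[OF pw_linear_continuous[OF u]] note bw' = bdd_meas_continuous[OF pw_linear_continuous[OF w]]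
  \<comment> \<open>Covers the streamline, \<open>L2\<close> and stabilization parts with different
    weights \<open>c\<close>; the boundary part is an edge integral and is treated
    separately.\<close>
  have gen: "I (\<lambda>x. c x * (f x + s * g x)\<^sup>2) \<le> 2 * I (\<lambda>x. c x * (f x)\<^sup>2) + 2 * s\<^sup>2 * I (\<lambda>x. c x * (g x)\<^sup>2)"
    if c: "bdd_meas c" "\<And>x. 0 \<le> c x" and fg: "bdd_meas f" "bdd_meas g" for c f g
  proof -
    have b: "bdd_meas (\<lambda>x. 2 * (c x * (f x)\<^sup>2))" "bdd_meas (\<lambda>x. 2 * s\<^sup>2 * (c x * (g x)\<^sup>2))"
      by (intro bdd_meas_mult bdd_meas_const bdd_meas_power2 c fg)+
    have "I (\<lambda>x. c x * (f x + s * g x)\<^sup>2) \<le> I (\<lambda>x. 2 * (c x * (f x)\<^sup>2) + 2 * s\<^sup>2 * (c x * (g x)\<^sup>2))"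
    proof (rule I_mono[OF _ bdd_meas_add[OF b] AE_I2])
      show "bdd_meas (\<lambda>x. c x * (f x + s * g x)\<^sup>2)" by (intro bdd_meas_mult[OF c(1)] bdd_meas_power2 bdd_meas_add bdd_meas_mult[OF bdd_meas_const] fg)
      fix x
      have "c x * (f x + s * g x)\<^sup>2 \<le> c x * (2 * (f x)\<^sup>2 + 2 * s\<^sup>2 * (g x)\<^sup>2)" by (rule mult_left_mono[OF sum_square_le c(2)])
      then show "c x * (f x + s * g x)\<^sup>2 \<le> 2 * (c x * (f x)\<^sup>2) + 2 * s\<^sup>2 * (c x * (g x)\<^sup>2)" by (simp add: algebra_simps)
    qed
    then show ?thesis unfolding I_add[OF b] I_cmult .
  qed
  have 1: "X (\<lambda>x. u x + s * w x) \<le> 2 * X u + 2 * s\<^sup>2 * X w"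
    unfolding X_def D_linear[OF u w] by (rule gen[OF bdd_meas_h_fun h_fun_nonneg bdd_meas_D bdd_meas_D])
  have 2: "I (\<lambda>x. (u x + s * w x)\<^sup>2) \<le> 2 * I (\<lambda>x. (u x)\<^sup>2) + 2 * s\<^sup>2 * I (\<lambda>x. (w x)\<^sup>2)"
    using gen[OF bdd_meas_const[of 1] _ bu bw'] by simp
  have 3: "bdry_energy (\<lambda>x. u x + s * w x) \<le> 2 * bdry_energy u + 2 * s\<^sup>2 * bdry_energy w"
  proof -
    note c = pw_linear_continuous[OF u] pw_linear_continuous[OF w] bc
    let ?z = "\<lambda>x. \<bar>b x \<bullet> outward_normal \<Omega> x\<bar> / 2"
    have b: "bdry_cont (\<lambda>x. 2 * (?z x * (u x)\<^sup>2))"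
      by (rule bdry_contI[of "\<lambda>n x. 2 * (\<bar>b x \<bullet> n\<bar> / 2 * (u x)\<^sup>2)"]) (intro continuous_intros c; simp)
    have b': "bdry_cont (\<lambda>x. 2 * s\<^sup>2 * (?z x * (w x)\<^sup>2))"
      by (rule bdry_contI[of "\<lambda>n x. 2 * s\<^sup>2 * (\<bar>b x \<bullet> n\<bar> / 2 * (w x)\<^sup>2)"]) (intro continuous_intros c; simp)
    have bs: "bdry_cont (\<lambda>x. 2 * (?z x * (u x)\<^sup>2) + 2 * s\<^sup>2 * (?z x * (w x)\<^sup>2))"
      by (rule bdry_contI[of "\<lambda>n x. 2 * (\<bar>b x \<bullet> n\<bar> / 2 * (u x)\<^sup>2) + 2 * s\<^sup>2 * (\<bar>b x \<bullet> n\<bar> / 2 * (w x)\<^sup>2)"]) (intro continuous_intros c; simp)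
    have "bdry_int (\<lambda>x. ?z x * (u x + s * w x)\<^sup>2) \<le> bdry_int (\<lambda>x. 2 * (?z x * (u x)\<^sup>2) + 2 * s\<^sup>2 * (?z x * (w x)\<^sup>2))"
    proof (rule bdry_int_mono[OF bdry_cont_form(1)[OF pw_linear_linear[OF u w] u] bs])
      fix x
      have "?z x * (u x + s * w x)\<^sup>2 \<le> ?z x * (2 * (u x)\<^sup>2 + 2 * s\<^sup>2 * (w x)\<^sup>2)" by (rule mult_left_mono[OF sum_square_le]) simp
      then show "?z x * (u x + s * w x)\<^sup>2 \<le> 2 * (?z x * (u x)\<^sup>2) + 2 * s\<^sup>2 * (?z x * (w x)\<^sup>2)" by (simp add: algebra_simps)
    qed
    then show ?thesis unfolding bdry_int_add[OF b b'] bdry_int_cmult bdry_energy_def .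
  qed
  have 4: "S (\<lambda>x. u x + s * w x) (\<lambda>x. u x + s * w x) \<le> 2 * S u u + 2 * s\<^sup>2 * S w w"
    unfolding S_def sum_distrib_left sum.distrib[symmetric]
  proof (rule sum_mono)
    fix a assume a: "a \<in> vertices \<T>"
    let ?c = "\<lambda>x. indicator (patch \<T> a) x :: real"
    have "I (\<lambda>x. ?c x * (fluct u a x + s * fluct w a x)\<^sup>2) \<le> 2 * I (\<lambda>x. ?c x * (fluct u a x)\<^sup>2) + 2 * s\<^sup>2 * I (\<lambda>x. ?c x * (fluct w a x)\<^sup>2)"
      by (rule gen[OF bdd_meas_indicator[OF patch_sets] _ bdd_meas_kp bdd_meas_kp]) simp
    then have "(\<beta> * h_vertex \<T> a) * I (\<lambda>x. ?c x * (fluct u a x + s * fluct w a x)\<^sup>2) \<le> (\<beta> * h_vertex \<T> a) * (2 * I (\<lambda>x. ?c x * (fluct u a x)\<^sup>2) + 2 * s\<^sup>2 * I (\<lambda>x. ?c x * (fluct w a x)\<^sup>2))"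
      using beta vertex_h_pos[OF a] by (intro mult_left_mono) auto
    then show "\<beta> * h_vertex \<T> a * I (\<lambda>x. ?c x * (fluct (\<lambda>x. u x + s * w x) a x * fluct (\<lambda>x. u x + s * w x) a x))
      \<le> 2 * (\<beta> * h_vertex \<T> a * I (\<lambda>x. ?c x * (fluct u a x * fluct u a x))) + 2 * s\<^sup>2 * (\<beta> * h_vertex \<T> a * I (\<lambda>x. ?c x * (fluct w a x * fluct w a x)))"
      unfolding fluct_linear[OF u w] power2_eq_square[of "fluct _ _ _"] power2_eq_square[of "fluct _ _ _ + _"] by (simp only: distrib_left mult.left_commute mult.assoc)
  qed
  have "\<alpha> * I (\<lambda>x. (u x + s * w x)\<^sup>2) \<le> \<alpha> * (2 * I (\<lambda>x. (u x)\<^sup>2) + 2 * s\<^sup>2 * I (\<lambda>x. (w x)\<^sup>2))"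
    using alpha by (intro mult_left_mono 2) simp
  with 1 3 4 show ?thesis unfolding LPSD_sq_def by (simp add: algebra_simps)
qed

end

section \<open>The inf-sup condition\<close>

text \<open>\<open>Au\<close> and \<open>Aw\<close> stand for \<open>A u u\<close> and \<open>A u w\<close>; \<open>x\<close>, \<open>i\<close>, \<open>e\<close>, \<open>s\<close> stand for the streamline, \<open>L2\<close>,
  boundary and stabilization parts of the squared norm of \<open>u\<close>, and \<open>iw\<close>, \<open>ew\<close>, \<open>sw\<close> for those of \<open>w\<close>.\<close>

lemma absorb:
  fixes x i e s iw ew sw :: real
  assumes pos: "\<zeta> > 0" "\<alpha> > 0" "\<beta> > 0" "M > 0" "Cw > 0"
    and nonneg: "0 \<le> x" "0 \<le> i" "0 \<le> e" "0 \<le> s"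
    and cw: "iw + 2 * ew + sw \<le> Cw * x"
    and Au: "\<alpha> * i + e + s \<le> Au"
    and Aw: "\<And>t. t > 0 \<Longrightarrow> x / (2 * \<zeta>) - s / (2 * \<beta>) - (M\<^sup>2 / t * i + t * iw) - (2 / t * e + 2 * t * ew) - (s / t + t * sw) \<le> Aw"
    and t: "t = 1 / (4 * \<zeta> * Cw)" and C: "C = 1 / (2 * \<beta>) + M\<^sup>2 / (t * \<alpha>) + 3 / t" and \<delta>: "\<delta> = 1 / (2 * C)"
  shows "min (1 / 2) (\<delta> / (4 * \<zeta>)) * (x + \<alpha> * i + e + s) \<le> Au + \<delta> * Aw"
proof -
  have t0: "t > 0" using pos t by simp
  have C0: "C > 0" unfolding C using pos t0 by (intro add_pos_pos divide_pos_pos mult_pos_pos) auto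
  have \<delta>0: "\<delta> > 0" unfolding \<delta> using C0 by simp
  let ?n = "\<alpha> * i + e + s"
  have n0: "0 \<le> \<alpha> * i" "0 \<le> ?n" using pos nonneg by auto
  \<comment> \<open>\<open>t\<close> is chosen so that the corrector terms cost at most
    \<open>x / (4 * \<zeta>)\<close>, half of the streamline term gained.\<close>
  have "t * (iw + 2 * ew + sw) \<le> t * (Cw * x)" using t0 cw by (intro mult_left_mono) auto
  also have "\<dots> = x / (4 * \<zeta>)" unfolding t using pos by simp
  finally have tw: "t * iw + 2 * t * ew + t * sw \<le> x / (4 * \<zeta>)" by (simp add: algebra_simps)
  have "M\<^sup>2 / t * i = M\<^sup>2 / (t * \<alpha>) * (\<alpha> * i)" using pos by simp
  also have "\<dots> \<le> M\<^sup>2 / (t * \<alpha>) * ?n" using pos t0 nonneg by (intro mult_left_mono) auto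
  finally have 1: "M\<^sup>2 / t * i \<le> M\<^sup>2 / (t * \<alpha>) * ?n" .
  have 2: "s / (2 * \<beta>) \<le> 1 / (2 * \<beta>) * ?n" using pos nonneg n0 by (simp add: divide_right_mono)
  have "2 * e + s \<le> 3 * (z + e + s)" if "0 \<le> z" for z using that nonneg by simp
  from this[OF n0(1)] have "2 * e + s \<le> 3 * ?n" .
  then have "1 / t * (2 * e + s) \<le> 1 / t * (3 * ?n)" using t0 by (intro mult_left_mono) auto
  then have 3: "2 / t * e + s / t \<le> 3 / t * ?n" by (simp add: algebra_simps add_divide_distrib)
  \<comment> \<open>\<open>C\<close> collects the coefficients of all terms in \<open>u\<close>,
    each measured against the coercive quantity \<open>?n\<close>.\<close>
  have Cn: "C * ?n = 1 / (2 * \<beta>) * ?n + M\<^sup>2 / (t * \<alpha>) * ?n + 3 / t * ?n" unfolding C by (simp only: distrib_right)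
  have "x / (2 * \<zeta>) - s / (2 * \<beta>) - (M\<^sup>2 / t * i + t * iw) - (2 / t * e + 2 * t * ew) - (s / t + t * sw) \<le> Aw"
    by (rule Aw[OF t0])
  then have "x / (4 * \<zeta>) - C * ?n \<le> Aw"
    unfolding Cn using 1 2 3 tw by (simp add: field_simps)
  then have "\<delta> * (x / (4 * \<zeta>) - C * ?n) \<le> \<delta> * Aw" using \<delta>0 by (intro mult_left_mono) auto
  \<comment> \<open>Since \<open>\<delta> * C = 1 / 2\<close>, the correction uses up half of the
    coercive part and leaves the other half.\<close>
  moreover have "\<delta> * (x / (4 * \<zeta>) - C * ?n) = \<delta> / (4 * \<zeta>) * x - ?n / 2"
    unfolding \<delta> using C0 by (simp add: field_simps)
  moreover have arith: "P + 1 / 2 * n \<le> U + R" if "L \<le> R" "L = P - n / 2" "n \<le> U" for L R P n U :: real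
    using that by linarith
  ultimately have "\<delta> / (4 * \<zeta>) * x + 1 / 2 * ?n \<le> Au + \<delta> * Aw" using Au by (intro arith)
  moreover have "min (1 / 2) (\<delta> / (4 * \<zeta>)) * x \<le> \<delta> / (4 * \<zeta>) * x" using nonneg by (intro mult_right_mono) auto
  moreover have "min (1 / 2) (\<delta> / (4 * \<zeta>)) * ?n \<le> 1 / 2 * ?n" using n0 by (intro mult_right_mono) auto
  ultimately have "min (1 / 2) (\<delta> / (4 * \<zeta>)) * x + min (1 / 2) (\<delta> / (4 * \<zeta>)) * ?n \<le> Au + \<delta> * Aw"
    by (meson add_mono order_trans)
  then show ?thesis by (simp only: distrib_left add.assoc)
qed

text \<open>\<open>nu\<close> and \<open>nv\<close> are squared norms; by the bound on
  \<open>nv\<close> the product of the norms is at most \<open>sqrt R * nu\<close>.\<close>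

lemma inf_sup_quotient:
  fixes a nu nv :: real
  assumes "0 < nu" "0 < nv" "0 \<le> c" "0 < R" "c * nu \<le> a" "nv \<le> R * nu"
  shows "c / sqrt R \<le> a / (sqrt nu * sqrt nv)"
proof -
  have "sqrt nu * sqrt nv \<le> sqrt nu * (sqrt R * sqrt nu)"
    using assms(1,6) by (intro mult_left_mono) (auto simp: real_sqrt_mult[symmetric])
  also have "\<dots> = sqrt R * nu" using assms(1) by simp
  finally have "c / sqrt R * (sqrt nu * sqrt nv) \<le> c / sqrt R * (sqrt R * nu)"
    using assms(3,4) by (intro mult_left_mono) auto
  also have "\<dots> \<le> a" using assms(4,5) by simp
  finally show ?thesis using assms(1,2) by (simp add: pos_le_divide_eq)
qed

text \<open>The constant is obtained before the domain, the mesh, the coefficients and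
  \<open>u\<close> are introduced, so uniformity is visible in the order of quantifiers: only the
  seven numbers fixed at the start can enter.\<close>

lemma advection_inf_sup:
  assumes pos: "\<sigma> > 0" "\<zeta> > 0" "\<alpha> > 0" "\<beta> > 0" "B > 0" "M > 0" "d > 0"
  obtains \<gamma> where "\<gamma> > 0"
    "\<And>\<Omega> \<T> b \<mu> u. advection \<Omega> \<T> \<sigma> \<zeta> b \<mu> \<alpha> \<beta> B M d \<Longrightarrow> u \<in> Vh \<Omega> \<T> \<Longrightarrow> u \<noteq> (\<lambda>_. 0) \<Longrightarrow>
      \<exists>v\<in>Vh \<Omega> \<T> - {\<lambda>_. 0}. \<gamma> \<le> Ah \<Omega> b \<mu> \<beta> \<T> u v / (LPSD_norm \<Omega> b \<alpha> \<beta> \<T> u * LPSD_norm \<Omega> b \<alpha> \<beta> \<T> v)"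
proof -
  \<comment> \<open>The corrector bounds in terms of \<open>Q u\<close>, multiplied by the factor
    \<open>3 * \<zeta>\<close> of \<open>Q_le\<close>; \<open>cS\<close> goes through the streamline
    part by \<open>S_X\<close> instead.\<close>
  define cX where "cX = 4 * \<sigma>\<^sup>2 * \<zeta> * B\<^sup>2 * (3 * \<zeta>)"
  define cI where "cI = \<zeta> * d * (3 * \<zeta>)"
  define cB where "cB = 6 * B * \<zeta> * \<sigma>\<^sup>2 / pi * (3 * \<zeta>)"
  define cS where "cS = 3 * \<zeta> * \<beta> * cX"
  have c0: "cX > 0" "cI > 0" "cB > 0" using pos by (simp_all add: cX_def cI_def cB_def)
  then have cS0: "cS > 0" using pos by (simp add: cS_def)
  define Cw where "Cw = cI + 2 * cB + cS"
  have Cw0: "Cw > 0" using c0 cS0 by (simp add: Cw_def)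
  define t where "t = 1 / (4 * \<zeta> * Cw)"
  define C where "C = 1 / (2 * \<beta>) + M\<^sup>2 / (t * \<alpha>) + 3 / t"
  define \<delta> where "\<delta> = 1 / (2 * C)"
  define c where "c = min (1 / 2) (\<delta> / (4 * \<zeta>))"
  \<comment> \<open>From \<open>LPSD_sq_sum\<close> with parameter \<delta>: the first 2 belongs to
    \<open>u\<close>, the rest to the corrector.\<close>
  define R where "R = 2 + 2 * \<delta>\<^sup>2 * (cX + \<alpha> * cI + cB + cS)"
  have t0: "t > 0" using pos Cw0 by (simp add: t_def)
  have C0: "C > 0" unfolding C_def using pos t0 by (intro add_pos_pos divide_pos_pos mult_pos_pos) auto
  have \<delta>0: "\<delta> > 0" unfolding \<delta>_def using C0 by simp
  have cpos: "c > 0" unfolding c_def using \<delta>0 pos by simp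
  have "0 < cX + \<alpha> * cI + cB + cS" using c0 cS0 pos by (intro add_pos_pos mult_pos_pos)
  then have R0: "R > 0" unfolding R_def by (intro add_pos_nonneg mult_nonneg_nonneg) auto
  show ?thesis
  proof (rule that)
    show "c / sqrt R > 0" using cpos R0 by simp
    fix \<Omega> \<T> b \<mu> u
    assume adv: "advection \<Omega> \<T> \<sigma> \<zeta> b \<mu> \<alpha> \<beta> B M d" and uV: "u \<in> Vh \<Omega> \<T>" "u \<noteq> (\<lambda>_. 0)"
    interpret advection \<Omega> \<T> \<sigma> \<zeta> b \<mu> \<alpha> \<beta> B M d by (rule adv)
    have pu: "pw_linear u" by (rule Vh_PL[OF uV(1)])
    obtain w where w: "pw_linear w" and w0: "\<And>x. x \<notin> closure \<Omega> \<Longrightarrow> w x = 0" and wn: "\<And>K a. K \<in> \<T> \<Longrightarrow> a \<in> verts K \<Longrightarrow> w a = h_vertex \<T> a * avg u a"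
      by (rule interpolant[of "\<lambda>a. h_vertex \<T> a * avg u a"]) blast
    interpret corrector \<Omega> \<T> \<sigma> \<zeta> b \<mu> \<alpha> \<beta> B M d u w
      by unfold_locales (use pu w wn in auto)
    have Q: "k * Q u \<le> k * (3 * \<zeta>) * X u" if "0 \<le> k" for k
      using mult_left_mono[OF Q_le[of u] that] by (simp add: mult.assoc)
    have xw: "X w \<le> cX * X u" unfolding cX_def by (rule order_trans[OF X_bound Q]) (use pos in simp)
    have iw: "I (\<lambda>x. (w x)\<^sup>2) \<le> cI * X u" unfolding cI_def by (rule order_trans[OF L2_bound Q]) (use pos in simp)
    have ew: "bdry_energy w \<le> cB * X u" unfolding cB_def by (rule order_trans[OF bdry_energy_bound Q]) (use pos in simp)
    have sw: "S w w \<le> cS * X u"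
    proof -
      have "3 * \<zeta> * \<beta> * X w \<le> 3 * \<zeta> * \<beta> * (cX * X u)" by (rule mult_left_mono[OF xw]) (use pos in simp)
      from order_trans[OF S_X this] show ?thesis by (simp only: cS_def mult.assoc)
    qed
    define v where "v = (\<lambda>x. u x + \<delta> * w x)"
    have wV: "w \<in> Vh \<Omega> \<T>" by (rule pw_linear_Vh[OF w w0])
    have vV: "v \<in> Vh \<Omega> \<T>" unfolding v_def by (rule Vh_linear[OF uV(1) wV])
    have "c * (X u + \<alpha> * I (\<lambda>x. (u x)\<^sup>2) + bdry_energy u + S u u) \<le> A u u + \<delta> * A u w"
      unfolding c_def
    proof (rule absorb[OF pos(2,3,4,6) Cw0 X_nonneg _ bdry_energy_nonneg S_nonneg _ A_coercive[OF pu] _ t_def C_def \<delta>_def])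
      show "I (\<lambda>x. (w x)\<^sup>2) + 2 * bdry_energy w + S w w \<le> Cw * X u"
        using iw ew sw by (simp add: Cw_def distrib_right)
      show "X u / (2 * \<zeta>) - S u u / (2 * \<beta>) - (M\<^sup>2 / t * I (\<lambda>x. (u x)\<^sup>2) + t * I (\<lambda>x. (w x)\<^sup>2))
         - (2 / t * bdry_energy u + 2 * t * bdry_energy w) - (S u u / t + t * S w w) \<le> A u w" if "t > 0" for t
        using streamline_bound reaction_bound[OF pu w that] boundary_bound[OF pu w that] stabilization_bound[OF that, of u w]
        unfolding A_def by linarith
    qed (rule I_nonneg, simp)
    then have Av: "c * LPSD_sq u \<le> A u v" unfolding v_def A_linear[OF pu pu w] LPSD_sq_def .
    have n0: "0 < LPSD_sq u" by (rule LPSD_sq_pos[OF uV])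
    \<comment> \<open>The form tested with 0 vanishes, while \<open>A u v\<close> is
      positive.\<close>
    have v0: "v \<noteq> (\<lambda>_. 0)"
    proof
      assume z: "v = (\<lambda>_. 0)"
      have "A u (\<lambda>_. 0) = 0"
        using A_linear[OF pu pu pu, of "-1"] by simp
      then show False using Av mult_pos_pos[OF cpos n0] unfolding z by linarith
    qed
    have "LPSD_sq w \<le> (cX + \<alpha> * cI + cB + cS) * X u"
    proof -
      have "\<alpha> * I (\<lambda>x. (w x)\<^sup>2) \<le> \<alpha> * cI * X u"
        by (subst mult.assoc, rule mult_left_mono[OF iw]) (use pos in simp)
      then show ?thesis unfolding LPSD_sq_def distrib_right using xw ew sw by (intro add_mono)
    qed
    also have "\<dots> \<le> (cX + \<alpha> * cI + cB + cS) * LPSD_sq u"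
    proof (rule mult_left_mono)
      show "X u \<le> LPSD_sq u"
        unfolding LPSD_sq_def using bdry_energy_nonneg[of u] S_nonneg[of u] mult_nonneg_nonneg[OF less_imp_le[OF pos(3)] I_nonneg[of "\<lambda>x. (u x)\<^sup>2"]]
        by simp
    qed (use \<open>0 < cX + \<alpha> * cI + cB + cS\<close> in simp)
    finally have "2 * \<delta>\<^sup>2 * LPSD_sq w \<le> 2 * \<delta>\<^sup>2 * ((cX + \<alpha> * cI + cB + cS) * LPSD_sq u)" by (rule mult_left_mono) simp
    then have "LPSD_sq v \<le> 2 * LPSD_sq u + 2 * \<delta>\<^sup>2 * ((cX + \<alpha> * cI + cB + cS) * LPSD_sq u)"
      unfolding v_def by (intro order_trans[OF LPSD_sq_sum[OF pu w]] add_left_mono)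
    also have "\<dots> = R * LPSD_sq u" unfolding R_def by (simp only: distrib_right mult.assoc)
    finally have nv: "LPSD_sq v \<le> R * LPSD_sq u" .
    have "c / sqrt R \<le> A u v / (sqrt (LPSD_sq u) * sqrt (LPSD_sq v))"
      by (rule inf_sup_quotient[OF n0 LPSD_sq_pos[OF vV v0] less_imp_le[OF cpos] R0 Av nv])
    then have "c / sqrt R \<le> Ah \<Omega> b \<mu> \<beta> \<T> u v / (LPSD_norm \<Omega> b \<alpha> \<beta> \<T> u * LPSD_norm \<Omega> b \<alpha> \<beta> \<T> v)"
      unfolding Ah_eq[OF uV(1) vV] LPSD_eq[OF uV(1)] LPSD_eq[OF vV] .
    then show "\<exists>v\<in>Vh \<Omega> \<T> - {\<lambda>_. 0}. c / sqrt R \<le> Ah \<Omega> b \<mu> \<beta> \<T> u v / (LPSD_norm \<Omega> b \<alpha> \<beta> \<T> u * LPSD_norm \<Omega> b \<alpha> \<beta> \<T> v)"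
      using vV v0 by blast
  qed
qed

text \<open>Infimum and supremum are taken in the extended reals, where they exist without any
  boundedness argument.\<close>

theorem theorem3p1:
  fixes \<Omega> :: "(real^2) set" and b :: "real^2 \<Rightarrow> real^2" and \<mu> :: "real^2 \<Rightarrow> real"
    and \<alpha> \<beta> :: real and \<F> :: "(real^2) set set set"
  assumes "polygonal_domain \<Omega>"
    and "\<forall>i. W1inf \<Omega> (\<lambda>x. b x $ i)"
    and "continuous_on (closure \<Omega>) b"
    and "Linf \<Omega> \<mu>"
    and "\<alpha> > 0"
    and "AE x in lebesgue_on \<Omega>. \<mu> x - weak_div \<Omega> b x / 2 \<ge> \<alpha>"
    and "\<forall>\<T>\<in>\<F>. mesh_of \<Omega> \<T>"
    and "shape_regular \<F>"
    and "locally_quasi_uniform \<F>"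
    and "\<beta> > 0"
    and "stabilization_scaling \<F> b \<beta>"
  shows "\<exists>\<gamma>>0. \<forall>\<T>\<in>\<F>.
    (INF u\<in>Vh \<Omega> \<T> - {\<lambda>_. 0}. SUP v\<in>Vh \<Omega> \<T> - {\<lambda>_. 0}.
       ereal (Ah \<Omega> b \<mu> \<beta> \<T> u v / (LPSD_norm \<Omega> b \<alpha> \<beta> \<T> u * LPSD_norm \<Omega> b \<alpha> \<beta> \<T> v)))
    \<ge> ereal \<gamma>"
proof -
  obtain \<sigma>0 where \<sigma>0: "\<And>\<T> K. \<T> \<in> \<F> \<Longrightarrow> K \<in> \<T> \<Longrightarrow> diameter K \<le> \<sigma>0 * ball_diameter K"
    using assms(8) unfolding shape_regular_def by blast
  obtain \<zeta> where \<zeta>: "\<zeta> \<ge> 1" "\<And>\<T> a K. \<T> \<in> \<F> \<Longrightarrow> a \<in> vertices \<T> \<Longrightarrow> K \<in> star \<T> a \<Longrightarrow>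
     1 / \<zeta> \<le> h_vertex \<T> a / diameter K \<and> h_vertex \<T> a / diameter K \<le> \<zeta>"
    using assms(9) unfolding locally_quasi_uniform_def by blast
  \<comment> \<open>The bounds taken from the hypotheses may have any sign; the maximum with 1 makes
    them positive, here and for \<open>B\<close> and \<open>M\<close>.\<close>
  define \<sigma> where "\<sigma> = max 1 \<sigma>0"
  have bd: "bounded (closure \<Omega>)" using assms(1) bounded_closure[of \<Omega>] by (simp add: polygonal_domain_def)
  have cc: "compact (closure \<Omega>)" using bd by (simp add: compact_eq_bounded_closed)
  have "bounded (b ` closure \<Omega>)" by (rule compact_imp_bounded[OF compact_continuous_image[OF assms(3) cc]])
  then obtain B0 where B0: "\<forall>y\<in>b ` closure \<Omega>. norm y \<le> B0" unfolding bounded_iff by (rule exE)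
  define B where "B = max 1 B0"
  have B: "B > 0" "\<And>x. x \<in> closure \<Omega> \<Longrightarrow> norm (b x) \<le> B" using B0 by (auto simp: B_def le_max_iff_disj)
  obtain M0 where M0: "AE x in lebesgue_on \<Omega>. \<bar>\<mu> x\<bar> \<le> M0" using assms(4) unfolding Linf_def by blast
  define M where "M = max 1 M0"
  have M: "M > 0" "AE x in lebesgue_on \<Omega>. \<bar>\<mu> x\<bar> \<le> M"
    using M0 by (auto simp: M_def elim!: eventually_mono)
  \<comment> \<open>Every triangle of every mesh lies in the closure of \<Omega>, so one number
    bounds all diameters; the added 1 makes it positive.\<close>
  define d where "d = diameter (closure \<Omega>) + 1"
  have d0: "d > 0" using diameter_ge_0[OF bd] by (simp add: d_def)
  have \<sigma>: "\<sigma> > 0" by (simp add: \<sigma>_def)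
  have \<zeta>0: "\<zeta> > 0" using \<zeta>(1) by simp
  obtain \<gamma> where \<gamma>: "\<gamma> > 0" and main:
    "\<And>\<Omega> \<T> b \<mu> u. advection \<Omega> \<T> \<sigma> \<zeta> b \<mu> \<alpha> \<beta> B M d \<Longrightarrow> u \<in> Vh \<Omega> \<T> \<Longrightarrow> u \<noteq> (\<lambda>_. 0) \<Longrightarrow>
      \<exists>v\<in>Vh \<Omega> \<T> - {\<lambda>_. 0}. \<gamma> \<le> Ah \<Omega> b \<mu> \<beta> \<T> u v / (LPSD_norm \<Omega> b \<alpha> \<beta> \<T> u * LPSD_norm \<Omega> b \<alpha> \<beta> \<T> v)"
    by (rule advection_inf_sup[OF \<sigma> \<zeta>0 assms(5,10) B(1) M(1) d0]) blast
  show ?thesis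
  proof (intro exI[of _ \<gamma>] conjI ballI \<gamma>)
    fix \<T> assume T: "\<T> \<in> \<F>"
    interpret mesh \<Omega> \<T> by unfold_locales (use assms(1,7) T in auto)
    have adv: "advection \<Omega> \<T> \<sigma> \<zeta> b \<mu> \<alpha> \<beta> B M d"
    proof unfold_locales
      fix K assume K: "K \<in> \<T>"
      \<comment> \<open>Enlarging the shape constant is harmless because inscribed diameters are
        nonnegative.\<close>
      have "\<sigma>0 * ball_diameter K \<le> \<sigma> * ball_diameter K"
        using ball_diameter_nonneg[OF verts_mesh(4)[OF K] compact_imp_bounded[OF mesh_compact[OF K]]]
        by (intro mult_right_mono) (auto simp: \<sigma>_def)
      then show "diameter K \<le> \<sigma> * ball_diameter K" using \<sigma>0[OF T K] by linarith
      have "diameter K \<le> diameter (closure \<Omega>)" by (rule diameter_subset[OF mesh_subset[OF K] bd])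
      then show "diameter K \<le> d" by (simp add: d_def)
    qed (use assms B M d0 \<sigma> \<zeta> T in auto)
    show "ereal \<gamma> \<le> (INF u\<in>Vh \<Omega> \<T> - {\<lambda>_. 0}. SUP v\<in>Vh \<Omega> \<T> - {\<lambda>_. 0}.
       ereal (Ah \<Omega> b \<mu> \<beta> \<T> u v / (LPSD_norm \<Omega> b \<alpha> \<beta> \<T> u * LPSD_norm \<Omega> b \<alpha> \<beta> \<T> v)))"
    proof (rule INF_greatest)
      fix u assume "u \<in> Vh \<Omega> \<T> - {\<lambda>_. 0}"
      then obtain v where v: "v \<in> Vh \<Omega> \<T> - {\<lambda>_. 0}"
        "\<gamma> \<le> Ah \<Omega> b \<mu> \<beta> \<T> u v / (LPSD_norm \<Omega> b \<alpha> \<beta> \<T> u * LPSD_norm \<Omega> b \<alpha> \<beta> \<T> v)"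
        using main[OF adv, of u] by auto
      then show "ereal \<gamma> \<le> (SUP v\<in>Vh \<Omega> \<T> - {\<lambda>_. 0}.
         ereal (Ah \<Omega> b \<mu> \<beta> \<T> u v / (LPSD_norm \<Omega> b \<alpha> \<beta> \<T> u * LPSD_norm \<Omega> b \<alpha> \<beta> \<T> v)))"
        by (intro SUP_upper2[OF v(1)]) simp
    qed
  qed
qed

end
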